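(* Let $\mathcal K$ be a Markov kernel on $\mathbb R^d$, realized as a random map: a draw from $\mathcal K(a,\cdot)$ is obtained from the starting point $a$ and a realization of driving noise independent of $a$. Assume: (i) there is $C>0$ such that for all $a,b\in\mathbb R^d$, if $u\sim\mathcal K(a,\cdot)$ and $v\sim\mathcal K(b,\cdot)$ are generated with the same realization of the driving noise, then $|u-v|\le C|a-b|$ almost surely; (ii) for all $p\ge 2$ there is $C'>0$ such that for every random variable $u\in\mathbb R^d$ with $\mathbb E|u|^p<\infty$, $\mathbb E|\mathcal K(u,\cdot)|^p\le C'(1+\mathbb E|u|^p)$, where $\mathcal K(u,\cdot)$ on the left denotes a random variable drawn from the kernel started at $u$; (iii) the initial distribution $\rho_0=\pi_0$ has finite moments of all orders $p\ge2$. Let $\pi_{t_j}$ be the distribution of the mean-field ensemble Kalman filter (MFEnKF) and $\hat\pi^N_{t_j}$ the (empirical) distribution of the ensemble Kalman filter (EnKF) with $N$ ensemble members, both at the $j$-th observation time and both as defined in the context. Then, for every finite $j$, as $N\to\infty$, $$d(\hat\pi^N_{t_j},\pi_{t_j})=\mathcal O(N^{-1/2}),$$ where $d$ is the metric between random measures defined in the context.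
   Context: **Signal and data.** The signal is a Markov chain $u_0\sim\rho_0$, $u_{j+1}\sim\mathcal K(u_j,\cdot)$, $j=0,1,2,\dots$, in $\mathbb R^d$. The observations are $y_j=Hu_j+\eta_j$, $j=1,2,\dots$, with $H:\mathbb R^d\to\mathbb R^m$ linear and $\eta_j\sim N(0,\Gamma)$ i.i.d., $\Gamma\in\mathbb R^{m\times m}$ positive definite, independent of $u_0$ and of the noise in $\mathcal K$. All distributions are assumed to have Lebesgue densities (except empirical measures), and densities are identified with measures. The time of the $j$-th observation is denoted $t_j$. **MFEnKF.** This is the process with $v_0\sim\pi_0=\rho_0$ defined (given the data) recursively by $\widehat v_{j+1}\sim\mathcal K(v_j,\cdot)$, $\widehat m_{j+1}=\mathbb E\widehat v_{j+1}$, $\widehat C_{j+1}=\mathbb E(\widehat v_{j+1}-\widehat m_{j+1})\otimes(\widehat v_{j+1}-\widehat m_{j+1})$ (expectations for fixed observations), $S_{j+1}=H\widehat C_{j+1}H^T+\Gamma$, $K_{j+1}=\widehat C_{j+1}H^TS_{j+1}^{-1}$, $\tilde y_{j+1}=y_{j+1}+\tilde\eta_{j+1}$, $v_{j+1}=(I-K_{j+1}H)\widehat v_{j+1}+K_{j+1}\tilde y_{j+1}$, where $\tilde\eta_j$ are i.i.d. $N(0,\Gamma)$, independent of everything else. $\pi_{t_j}$ denotes the distribution of $v_j$ (given the observations $y_1,\dots,y_j$). **EnKF with $N$ members.** Start from $v_0^{(1)},\dots,v_0^{(N)}$ i.i.d. from $\rho_0$. For $n=1,\dots,N$, with independent driving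 noises, $\widehat v^{(n)}_{j+1}\sim\mathcal K(v_j^{(n)},\cdot)$, $\widehat m_{j+1}=\frac1N\sum_{n}\widehat v^{(n)}_{j+1}$, $\widehat C_{j+1}=\frac1N\sum_n(\widehat v^{(n)}_{j+1}-\widehat m_{j+1})\otimes(\widehat v^{(n)}_{j+1}-\widehat m_{j+1})$, $K_{j+1}=\widehat C_{j+1}H^T(H\widehat C_{j+1}H^T+\Gamma)^{-1}$ (with the sample covariance), $y^{(n)}_{j+1}=y_{j+1}+\tilde\eta^{(n)}_{j+1}$ with $\tilde\eta^{(n)}_{j}$ i.i.d. $N(0,\Gamma)$, $v^{(n)}_{j+1}=(I-K_{j+1}H)\widehat v^{(n)}_{j+1}+K_{j+1}y^{(n)}_{j+1}$. $\hat\pi^N_{t_j}$ is the empirical measure $\frac1N\sum_{n=1}^N\delta_{v_j^{(n)}}$. **Metric.** For a (signed) random measure $\mu$ on $\mathbb R^d$, $$\|\mu\|=\sup_{|f|_L\le1}\sqrt{\mathbb E\left|\int f\,d\mu\right|^2},\qquad |f|_L=|f|_\infty+\sup_{x\ne x'}\frac{|f(x)-f(x')|}{|x-x'|},$$ the supremum being over $f:\mathbb R^d\to\mathbb R$, and $d(\pi,p)=\|\pi-p\|$. The expectation is over the randomness of the measures (the observations, and the ensemble in the case of EnKF). *)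

theory Defs
  imports "HOL-Probability.Probability" "HOL-Library.Landau_Symbols"
begin

definition pos_def_matrix :: "real^'m^'m \<Rightarrow> bool" where
  "pos_def_matrix A \<longleftrightarrow> transpose A = A \<and> (\<forall>x. x \<noteq> 0 \<longrightarrow> x \<bullet> (A *v x) > 0)"

definition centered_gaussian :: "real^'m^'m \<Rightarrow> (real^'m) measure" where
  "centered_gaussian \<Gamma> = density lborel (\<lambda>x. ennreal
     (exp (- (x \<bullet> (matrix_inv \<Gamma> *v x)) / 2) / sqrt ((2 * pi) ^ CARD('m) * det \<Gamma>)))"

definition has_lebesgue_density :: "'a::euclidean_space measure \<Rightarrow> bool" where
  "has_lebesgue_density \<mu> \<longleftrightarrow>
     prob_space \<mu> \<and> (\<exists>f \<in> borel_measurable borel. \<mu> = density lborel f)"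

definition markov_kernel :: "('a::euclidean_space \<Rightarrow> 'a measure) \<Rightarrow> bool" where
  "markov_kernel \<K> \<longleftrightarrow> \<K> \<in> borel \<rightarrow>\<^sub>M prob_algebra borel"

text \<open>\<open>\<Phi> a x\<close> is the draw from \<open>\<K> a\<close> produced by the realization \<open>x\<close>
  of the driving noise, whose law is \<open>\<nu>\<close>.\<close>

definition realizes_kernel ::
  "('a::euclidean_space \<Rightarrow> 'a measure) \<Rightarrow> 'x measure \<Rightarrow> ('a \<Rightarrow> 'x \<Rightarrow> 'a) \<Rightarrow> bool" where
  "realizes_kernel \<K> \<nu> \<Phi> \<longleftrightarrow>
     prob_space \<nu> \<and> (\<lambda>(a, x). \<Phi> a x) \<in> borel \<Otimes>\<^sub>M \<nu> \<rightarrow>\<^sub>M borel \<and>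
     (\<forall>a. \<K> a = distr \<nu> borel (\<Phi> a))"

definition lipschitz_same_noise :: "'x measure \<Rightarrow> ('a::euclidean_space \<Rightarrow> 'x \<Rightarrow> 'a) \<Rightarrow> bool" where
  "lipschitz_same_noise \<nu> \<Phi> \<longleftrightarrow>
     (\<exists>C>0. \<forall>a b. AE x in \<nu>. norm (\<Phi> a x - \<Phi> b x) \<le> C * norm (a - b))"

definition finite_moment :: "real \<Rightarrow> 'a::euclidean_space measure \<Rightarrow> bool" where
  "finite_moment p \<mu> \<longleftrightarrow> integrable \<mu> (\<lambda>x. norm x powr p)"

definition moment :: "real \<Rightarrow> 'a::euclidean_space measure \<Rightarrow> real" where
  "moment p \<mu> = (\<integral>x. norm x powr p \<partial>\<mu>)"

text \<open>The random variable \<open>u\<close> enters only through its law \<open>\<mu>\<close>; a draw from the kernel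
  started at \<open>u\<close> then has law \<open>\<mu> \<bind> \<K>\<close>.\<close>

definition moment_growth :: "('a::euclidean_space \<Rightarrow> 'a measure) \<Rightarrow> bool" where
  "moment_growth \<K> \<longleftrightarrow> (\<forall>p\<ge>2. \<exists>C>0. \<forall>\<mu>.
     prob_space \<mu> \<and> sets \<mu> = sets borel \<and> finite_moment p \<mu> \<longrightarrow>
     finite_moment p (\<mu> \<bind> \<K>) \<and> moment p (\<mu> \<bind> \<K>) \<le> C * (1 + moment p \<mu>))"

text \<open>Three kinds of systems are run: the signal with its observations, the mean-field filter,
  and the ensemble members (numbered from \<open>0\<close>).  Each has an initial state with law \<open>\<rho>\<^sub>0\<close>,
  driving noise with law \<open>\<nu>\<close> and Gaussian noise with law \<open>N(0, \<Gamma>)\<close>; the latter is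
  the observation noise for \<open>Signal\<close> and the perturbation of the observations for the filters.
  Time index \<open>j\<close> of a noise always refers to the step from \<open>t\<^sub>j\<close> to \<open>t\<^bsub>j+1\<^esub>\<close>;
  e.g. \<open>gauss Signal j\<close> is the observation noise at time \<open>t\<^bsub>j+1\<^esub>\<close>.\<close>

datatype system = Signal | MeanField | Member nat

datatype source = Init system | Drive system nat | Gauss system nat

definition source_events ::
  "'w measure \<Rightarrow> 'x measure \<Rightarrow> (system \<Rightarrow> 'w \<Rightarrow> real^'d) \<Rightarrow> (system \<Rightarrow> nat \<Rightarrow> 'w \<Rightarrow> 'x) \<Rightarrow>
   (system \<Rightarrow> nat \<Rightarrow> 'w \<Rightarrow> real^'m) \<Rightarrow> source \<Rightarrow> 'w set set" where
  "source_events M \<nu> init drive gauss s =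
     (case s of
        Init p \<Rightarrow> sets (vimage_algebra (space M) (init p) borel)
      | Drive p j \<Rightarrow> sets (vimage_algebra (space M) (drive p j) \<nu>)
      | Gauss p j \<Rightarrow> sets (vimage_algebra (space M) (gauss p j) borel))"

definition independent_sources ::
  "'w measure \<Rightarrow> (real^'d) measure \<Rightarrow> 'x measure \<Rightarrow> real^'m^'m \<Rightarrow>
   (system \<Rightarrow> 'w \<Rightarrow> real^'d) \<Rightarrow> (system \<Rightarrow> nat \<Rightarrow> 'w \<Rightarrow> 'x) \<Rightarrow>
   (system \<Rightarrow> nat \<Rightarrow> 'w \<Rightarrow> real^'m) \<Rightarrow> bool" where
  "independent_sources M \<rho>\<^sub>0 \<nu> \<Gamma> init drive gauss \<longleftrightarrow>
     prob_space M \<and>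
     (\<forall>p. init p \<in> M \<rightarrow>\<^sub>M borel \<and> distr M borel (init p) = \<rho>\<^sub>0) \<and>
     (\<forall>p j. drive p j \<in> M \<rightarrow>\<^sub>M \<nu> \<and> distr M \<nu> (drive p j) = \<nu>) \<and>
     (\<forall>p j. gauss p j \<in> M \<rightarrow>\<^sub>M borel \<and> distr M borel (gauss p j) = centered_gaussian \<Gamma>) \<and>
     prob_space.indep_sets M (source_events M \<nu> init drive gauss) UNIV"

primrec signal ::
  "(real^'d \<Rightarrow> 'x \<Rightarrow> real^'d) \<Rightarrow> (system \<Rightarrow> 'w \<Rightarrow> real^'d) \<Rightarrow> (system \<Rightarrow> nat \<Rightarrow> 'w \<Rightarrow> 'x) \<Rightarrow>
   nat \<Rightarrow> 'w \<Rightarrow> real^'d" where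
  "signal \<Phi> init drive 0 = init Signal"
| "signal \<Phi> init drive (Suc j) = (\<lambda>\<omega>. \<Phi> (signal \<Phi> init drive j \<omega>) (drive Signal j \<omega>))"

text \<open>The data sequence is \<open>y\<^sub>1, y\<^sub>2, \<dots>\<close>; its entry number \<open>j\<close> is \<open>y\<^bsub>j+1\<^esub>\<close>.\<close>

definition observations ::
  "real^'d^'m \<Rightarrow> (real^'d \<Rightarrow> 'x \<Rightarrow> real^'d) \<Rightarrow> (system \<Rightarrow> 'w \<Rightarrow> real^'d) \<Rightarrow>
   (system \<Rightarrow> nat \<Rightarrow> 'w \<Rightarrow> 'x) \<Rightarrow> (system \<Rightarrow> nat \<Rightarrow> 'w \<Rightarrow> real^'m) \<Rightarrow> 'w \<Rightarrow> nat \<Rightarrow> real^'m" where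
  "observations H \<Phi> init drive gauss \<omega> j =
     H *v signal \<Phi> init drive (Suc j) \<omega> + gauss Signal j \<omega>"

definition outer_product :: "real^'d \<Rightarrow> real^'d \<Rightarrow> real^'d^'d" (infixl \<open>\<otimes>\<^sub>o\<close> 70) where
  "a \<otimes>\<^sub>o b = (\<chi> i k. a $ i * b $ k)"

definition kalman_gain :: "real^'d^'m \<Rightarrow> real^'m^'m \<Rightarrow> real^'d^'d \<Rightarrow> real^'m^'d" where
  "kalman_gain H \<Gamma> C = C ** transpose H ** matrix_inv (H ** C ** transpose H + \<Gamma>)"

definition analysis ::
  "real^'d^'m \<Rightarrow> real^'m^'d \<Rightarrow> real^'m \<Rightarrow> real^'d \<Rightarrow> real^'d" where
  "analysis H G y v = (mat 1 - G ** H) *v v + G *v y"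

definition mean_of :: "'w measure \<Rightarrow> ('w \<Rightarrow> real^'d) \<Rightarrow> real^'d" where
  "mean_of M v = (\<integral>\<omega>. v \<omega> \<partial>M)"

definition covariance_of :: "'w measure \<Rightarrow> ('w \<Rightarrow> real^'d) \<Rightarrow> real^'d^'d" where
  "covariance_of M v = (\<integral>\<omega>. (v \<omega> - mean_of M v) \<otimes>\<^sub>o (v \<omega> - mean_of M v) \<partial>M)"

text \<open>The mean-field process for a fixed data sequence \<open>y\<close>: all expectations are taken with
  \<open>y\<close> frozen.  The random measure \<open>\<pi>\<^bsub>t\<^sub>j\<^esub>\<close> is obtained by inserting the random
  data into its law \<open>mfenkf_law\<close>.\<close>

primrec mfenkf ::
  "'w measure \<Rightarrow> real^'d^'m \<Rightarrow> real^'m^'m \<Rightarrow> (real^'d \<Rightarrow> 'x \<Rightarrow> real^'d) \<Rightarrow>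
   (system \<Rightarrow> 'w \<Rightarrow> real^'d) \<Rightarrow> (system \<Rightarrow> nat \<Rightarrow> 'w \<Rightarrow> 'x) \<Rightarrow>
   (system \<Rightarrow> nat \<Rightarrow> 'w \<Rightarrow> real^'m) \<Rightarrow> (nat \<Rightarrow> real^'m) \<Rightarrow> nat \<Rightarrow> 'w \<Rightarrow> real^'d" where
  "mfenkf M H \<Gamma> \<Phi> init drive gauss y 0 = init MeanField"
| "mfenkf M H \<Gamma> \<Phi> init drive gauss y (Suc j) =
     (let vhat = (\<lambda>\<omega>. \<Phi> (mfenkf M H \<Gamma> \<Phi> init drive gauss y j \<omega>) (drive MeanField j \<omega>));
          G = kalman_gain H \<Gamma> (covariance_of M vhat)
      in (\<lambda>\<omega>. analysis H G (y j + gauss MeanField j \<omega>) (vhat \<omega>)))"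

definition mfenkf_law ::
  "'w measure \<Rightarrow> real^'d^'m \<Rightarrow> real^'m^'m \<Rightarrow> (real^'d \<Rightarrow> 'x \<Rightarrow> real^'d) \<Rightarrow>
   (system \<Rightarrow> 'w \<Rightarrow> real^'d) \<Rightarrow> (system \<Rightarrow> nat \<Rightarrow> 'w \<Rightarrow> 'x) \<Rightarrow>
   (system \<Rightarrow> nat \<Rightarrow> 'w \<Rightarrow> real^'m) \<Rightarrow> (nat \<Rightarrow> real^'m) \<Rightarrow> nat \<Rightarrow> (real^'d) measure" where
  "mfenkf_law M H \<Gamma> \<Phi> init drive gauss y j =
     distr M borel (mfenkf M H \<Gamma> \<Phi> init drive gauss y j)"

definition ensemble_mean :: "nat \<Rightarrow> (nat \<Rightarrow> real^'d) \<Rightarrow> real^'d" where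
  "ensemble_mean N v = (1 / real N) *\<^sub>R (\<Sum>n<N. v n)"

definition ensemble_covariance :: "nat \<Rightarrow> (nat \<Rightarrow> real^'d) \<Rightarrow> real^'d^'d" where
  "ensemble_covariance N v =
     (1 / real N) *\<^sub>R (\<Sum>n<N. (v n - ensemble_mean N v) \<otimes>\<^sub>o (v n - ensemble_mean N v))"

text \<open>\<open>enkf \<dots> N j \<omega> n\<close> is member \<open>n < N\<close> of the ensemble of size \<open>N\<close> at
  time \<open>t\<^sub>j\<close>; entries with \<open>n \<ge> N\<close> never influence those with \<open>n < N\<close>.\<close>

primrec enkf ::
  "real^'d^'m \<Rightarrow> real^'m^'m \<Rightarrow> (real^'d \<Rightarrow> 'x \<Rightarrow> real^'d) \<Rightarrow>
   (system \<Rightarrow> 'w \<Rightarrow> real^'d) \<Rightarrow> (system \<Rightarrow> nat \<Rightarrow> 'w \<Rightarrow> 'x) \<Rightarrow>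
   (system \<Rightarrow> nat \<Rightarrow> 'w \<Rightarrow> real^'m) \<Rightarrow> nat \<Rightarrow> nat \<Rightarrow> 'w \<Rightarrow> nat \<Rightarrow> real^'d" where
  "enkf H \<Gamma> \<Phi> init drive gauss N 0 = (\<lambda>\<omega> n. init (Member n) \<omega>)"
| "enkf H \<Gamma> \<Phi> init drive gauss N (Suc j) = (\<lambda>\<omega>.
     let vhat = (\<lambda>n. \<Phi> (enkf H \<Gamma> \<Phi> init drive gauss N j \<omega> n) (drive (Member n) j \<omega>));
         G = kalman_gain H \<Gamma> (ensemble_covariance N vhat);
         y = observations H \<Phi> init drive gauss \<omega> j
     in (\<lambda>n. analysis H G (y + gauss (Member n) j \<omega>) (vhat n)))"

definition empirical_measure :: "nat \<Rightarrow> (nat \<Rightarrow> 'a::euclidean_space) \<Rightarrow> 'a measure" where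
  "empirical_measure N v = distr (uniform_count_measure {..<N}) borel v"

text \<open>The value is \<open>\<infinity>\<close> if \<open>f\<close> is unbounded or not Lipschitz.\<close>

definition bounded_lipschitz_norm :: "('a::euclidean_space \<Rightarrow> real) \<Rightarrow> ennreal" where
  "bounded_lipschitz_norm f =
     (SUP x. ennreal \<bar>f x\<bar>) +
     (SUP (x, x') \<in> {(x, x'). x \<noteq> x'}. ennreal (\<bar>f x - f x'\<bar> / norm (x - x')))"

text \<open>The distance is \<open>\<parallel>\<pi> - q\<parallel>\<close>, with the integral against the signed measure
  \<open>\<pi> - q\<close> written as a difference.  The real-valued supremum is over a set bounded by
  \<open>2\<close> if \<open>\<pi>\<close> and \<open>q\<close> are random probability measures
  (\<open>random_measure_dist_bdd\<close>).\<close>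

definition random_measure_dist ::
  "'w measure \<Rightarrow> ('w \<Rightarrow> 'a::euclidean_space measure) \<Rightarrow> ('w \<Rightarrow> 'a measure) \<Rightarrow> real" where
  "random_measure_dist M \<pi> q =
     (SUP f \<in> {f. bounded_lipschitz_norm f \<le> 1}.
        sqrt (\<integral>\<omega>. \<bar>(\<integral>x. f x \<partial>\<pi> \<omega>) - (\<integral>x. f x \<partial>q \<omega>)\<bar>\<^sup>2 \<partial>M))"

lemma bounded_lipschitz_norm_le_1_bound:
  assumes "bounded_lipschitz_norm f \<le> 1"
  shows "\<bar>f x\<bar> \<le> 1"
proof -
  have "ennreal \<bar>f x\<bar> \<le> (SUP x. ennreal \<bar>f x\<bar>)" by (rule SUP_upper) simp
  also have "\<dots> \<le> bounded_lipschitz_norm f" unfolding bounded_lipschitz_norm_def by simp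
  finally show ?thesis using assms by (metis dual_order.trans ennreal_le_1)
qed

lemma prob_integral_bound:
  fixes f :: "'a \<Rightarrow> real"
  assumes "prob_space \<mu>" "\<And>x. \<bar>f x\<bar> \<le> 1"
  shows "\<bar>\<integral>x. f x \<partial>\<mu>\<bar> \<le> 1"
proof (cases "integrable \<mu> f")
  case True
  interpret prob_space \<mu> by fact
  have "\<bar>\<integral>x. f x \<partial>\<mu>\<bar> \<le> (\<integral>x. \<bar>f x\<bar> \<partial>\<mu>)" by (rule integral_abs_bound)
  also have "\<dots> \<le> (\<integral>x. 1 \<partial>\<mu>)" using True assms(2) by (intro integral_mono) auto
  finally show ?thesis by (simp add: prob_space)
qed (simp add: not_integrable_integral_eq)

lemma random_measure_dist_bdd:
  assumes "prob_space M" "\<And>\<omega>. prob_space (\<pi> \<omega>)" "\<And>\<omega>. prob_space (q \<omega>)"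
    and "bounded_lipschitz_norm f \<le> 1"
  shows "sqrt (\<integral>\<omega>. \<bar>(\<integral>x. f x \<partial>\<pi> \<omega>) - (\<integral>x. f x \<partial>q \<omega>)\<bar>\<^sup>2 \<partial>M) \<le> 2"
proof -
  let ?g = "\<lambda>\<omega>. \<bar>(\<integral>x. f x \<partial>\<pi> \<omega>) - (\<integral>x. f x \<partial>q \<omega>)\<bar>\<^sup>2"
  interpret prob_space M by fact
  have g: "?g \<omega> \<le> 4" for \<omega>
  proof -
    have "\<bar>\<integral>x. f x \<partial>\<pi> \<omega>\<bar> \<le> 1" "\<bar>\<integral>x. f x \<partial>q \<omega>\<bar> \<le> 1"
      using prob_integral_bound[OF assms(2) bounded_lipschitz_norm_le_1_bound[OF assms(4)]]
        prob_integral_bound[OF assms(3) bounded_lipschitz_norm_le_1_bound[OF assms(4)]] by auto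
    then have "\<bar>(\<integral>x. f x \<partial>\<pi> \<omega>) - (\<integral>x. f x \<partial>q \<omega>)\<bar> \<le> 2" by linarith
    then have "?g \<omega> \<le> 2\<^sup>2" by (intro power_mono) auto
    then show ?thesis by simp
  qed
  have "(\<integral>\<omega>. ?g \<omega> \<partial>M) \<le> 4"
  proof (cases "integrable M ?g")
    case True
    then have "(\<integral>\<omega>. ?g \<omega> \<partial>M) \<le> (\<integral>\<omega>. 4 \<partial>M)" using g by (intro integral_mono) auto
    then show ?thesis by (simp add: prob_space)
  qed (simp add: not_integrable_integral_eq)
  then have "sqrt (\<integral>\<omega>. ?g \<omega> \<partial>M) \<le> sqrt 4" by (rule real_sqrt_le_mono)
  then show ?thesis by simp
qed

end

theory Submission imports Defs begin

text \<open>Each ensemble member is coupled to a copy of the mean-field process that is driven by the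
  noises of that member and uses the exact mean-field gain.  Given the observations the copies are
  independent with law \<open>\<pi>\<^bsub>t\<^sub>j\<^esub>\<close>, so their empirical measure is within \<open>N\<^bsup>-1/2\<^esup>\<close> of that
  law, and their sample covariance is within \<open>N\<^bsup>-1/2\<^esup>\<close> of the mean-field covariance in every
  \<open>L\<^sup>p\<close>.  Call two families of random variables close if all moments of \<open>\<surd>N\<close> times their
  difference are bounded uniformly in \<open>N\<close>.  On families with bounded moments this relation is a
  congruence for sums, products and averages over the ensemble, and the Kalman gain is locally
  Lipschitz in the covariance because \<open>H C H\<^sup>T + \<Gamma> \<ge> \<Gamma>\<close>; so closeness of the members to their
  copies propagates from one observation time to the next.\<close>

section \<open>Even moments of sums of orthogonal random variables\<close>

text \<open>No fixed exponent survives a time step. The sample covariance is quadratic in the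
  ensemble and the analysis multiplies the gain by the innovation, so bounding products costs a
  doubling of the exponent at every step. Closeness is therefore demanded in all moments at once,
  and only the final estimate falls back on the second moment.

  The other obstacle is independence. The copies share the data, so they are independent only
  conditionally; the members interact through the sample covariance and are not even that. In place
  of abstract conditional expectations, a copy is a function of two sample points, one supplying the
  data and one supplying its own noises. Integrating over the second with the first frozen is
  exactly how the mean-field expectations are defined. The law of large numbers then needs only that
  each centered term is orthogonal to powers of the sum of its predecessors.

  The supremum over test functions requires constants independent of \<open>f\<close>. For this the
  Lipschitz bound and a variance estimate for bounded terms are used.\<close>

lemma even_power_add_le:
  fixes a b :: real
  shows "(a + b) ^ (2 * k) \<le> 4 ^ k * (a ^ (2 * k) + b ^ (2 * k))"
proof -
  have m: "\<bar>a + b\<bar> \<le> 2 * max \<bar>a\<bar> \<bar>b\<bar>" by linarith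
  have "(a + b) ^ (2 * k) = \<bar>a + b\<bar> ^ (2 * k)" by (simp add: power_even_abs)
  also have "\<dots> \<le> (2 * max \<bar>a\<bar> \<bar>b\<bar>) ^ (2 * k)" by (intro power_mono m) simp
  also have "\<dots> = 4 ^ k * max \<bar>a\<bar> \<bar>b\<bar> ^ (2 * k)" by (simp add: power_mult_distrib power_mult)
  also have "max \<bar>a\<bar> \<bar>b\<bar> ^ (2 * k) \<le> a ^ (2 * k) + b ^ (2 * k)"
    by (auto simp: max_def power_even_abs)
  finally show ?thesis by simp
qed

lemma even_power_mult_le:
  fixes a b :: real
  shows "(a * b) ^ (2 * k) \<le> a ^ (2 * (2 * k)) + b ^ (2 * (2 * k))"
proof -
  let ?x = "a ^ (2 * k)" and ?y = "b ^ (2 * k)"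
  have "0 \<le> (?x - ?y)\<^sup>2 + ?x\<^sup>2 + ?y\<^sup>2" by simp
  then have "?x * ?y \<le> ?x\<^sup>2 + ?y\<^sup>2" by (simp add: power2_diff)
  then show ?thesis by (simp add: power_mult_distrib power_mult power_even_eq flip: power_mult)
qed

lemma even_power_mono:
  fixes a b :: real
  assumes "\<bar>a\<bar> \<le> \<bar>b\<bar>"
  shows "a ^ (2 * k) \<le> b ^ (2 * k)"
  using power_mono[OF assms, of "2 * k"] by (simp add: power_even_abs)

lemma even_power_average_le:
  fixes a :: "nat \<Rightarrow> real"
  assumes "N > 0"
  shows "((\<Sum>n<N. a n) / N) ^ (2 * k) \<le> (\<Sum>n<N. a n ^ (2 * k)) / N"
proof -
  have "(\<Sum>n<N. (1 / N) *\<^sub>R a n) ^ (2 * k) \<le> (\<Sum>n<N. 1 / N * a n ^ (2 * k))"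
    using assms by (intro convex_on_sum[OF _ _ convex_power_even]) auto
  then show ?thesis by (simp add: sum_divide_distrib)
qed

text \<open>In the binomial expansion the term linear in \<open>x\<close> is kept exactly, because
  its expectation will vanish by orthogonality. Every later term contains at least two factors
  \<open>x\<close>. It is at most \<open>s ^ (2 * k - 2) * x\<^sup>2\<close> or
  \<open>x ^ (2 * k)\<close>, depending on which of |s| and |x| is larger. The constant
  \<open>4 ^ k\<close> is the sum of all binomial coefficients.\<close>

lemma power_add_le_first_order:
  fixes s x :: real
  assumes k: "k \<ge> 1"
  shows "(s + x) ^ (2 * k) \<le> s ^ (2 * k) + 2 * real k * s ^ (2 * k - 1) * x
           + 4 ^ k * (s ^ (2 * k - 2) * x\<^sup>2 + x ^ (2 * k))"
proof -
  define t where "t i = real ((2 * k) choose i) * s ^ i * x ^ (2 * k - i)" for i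
  let ?R = "s ^ (2 * k - 2) * x\<^sup>2 + x ^ (2 * k)"
  have R0: "?R \<ge> 0"
    by (simp add: zero_le_even_power)
  have t: "t i \<le> real ((2 * k) choose i) * ?R" if i: "i \<le> 2 * k - 2" for i
  proof -
    have "s ^ i * x ^ (2 * k - i) \<le> \<bar>s\<bar> ^ i * \<bar>x\<bar> ^ (2 * k - i)"
      by (metis abs_ge_self abs_mult power_abs)
    also have "\<dots> \<le> \<bar>s\<bar> ^ (2 * k - 2) * \<bar>x\<bar>\<^sup>2 + \<bar>x\<bar> ^ (2 * k)"
    proof (cases "\<bar>s\<bar> \<le> \<bar>x\<bar>")
      case True
      have "\<bar>s\<bar> ^ i * \<bar>x\<bar> ^ (2 * k - i) \<le> \<bar>x\<bar> ^ i * \<bar>x\<bar> ^ (2 * k - i)"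
        by (intro mult_right_mono power_mono True) auto
      also have "\<dots> = \<bar>x\<bar> ^ (2 * k)" using i by (simp flip: power_add)
      finally show ?thesis by (smt (verit) zero_le_mult_iff zero_le_power abs_ge_zero)
    next
      case False
      have "\<bar>s\<bar> ^ i * \<bar>x\<bar> ^ (2 * k - i) = \<bar>s\<bar> ^ i * \<bar>x\<bar> ^ (2 * k - 2 - i) * \<bar>x\<bar>\<^sup>2"
      proof -
        have "2 * k - i = (2 * k - 2 - i) + 2" using i k by simp
        then have "\<bar>x\<bar> ^ (2 * k - i) = \<bar>x\<bar> ^ (2 * k - 2 - i) * \<bar>x\<bar>\<^sup>2" by (metis power_add)
        then show ?thesis by simp
      qed
      also have "\<dots> \<le> \<bar>s\<bar> ^ i * \<bar>s\<bar> ^ (2 * k - 2 - i) * \<bar>x\<bar>\<^sup>2"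
        using False by (intro mult_right_mono mult_left_mono power_mono) auto
      also have "\<bar>s\<bar> ^ i * \<bar>s\<bar> ^ (2 * k - 2 - i) = \<bar>s\<bar> ^ (2 * k - 2)"
        using i le_add_diff_inverse by (metis power_add)
      finally show ?thesis by (smt (verit) zero_le_mult_iff zero_le_power abs_ge_zero)
    qed
    also have "\<dots> = ?R" using k by (simp add: power_even_abs)
    finally show ?thesis unfolding t_def mult.assoc
      by (rule mult_left_mono) simp
  qed
  have set: "{..2 * k} = insert (2 * k) (insert (2 * k - 1) {..2 * k - 2})" using k by auto
  have "(s + x) ^ (2 * k) = (\<Sum>i\<le>2 * k. t i)" unfolding t_def by (rule binomial_ring)
  also have "\<dots> = t (2 * k) + t (2 * k - 1) + (\<Sum>i\<le>2 * k - 2. t i)"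
    unfolding set using k by (subst sum.insert; (subst sum.insert)?; auto)
  also have "t (2 * k) = s ^ (2 * k)" by (simp add: t_def)
  also have "t (2 * k - 1) = 2 * real k * s ^ (2 * k - 1) * x"
    using k binomial_symmetric[of 1 "2 * k"] by (simp add: t_def)
  also have "(\<Sum>i\<le>2 * k - 2. t i) \<le> (\<Sum>i\<le>2 * k - 2. real ((2 * k) choose i) * ?R)"
    by (intro sum_mono t) simp
  also have "\<dots> \<le> (\<Sum>i\<le>2 * k. real ((2 * k) choose i) * ?R)"
    using R0 by (intro sum_mono2) auto
  also have "\<dots> = real (\<Sum>i\<le>2 * k. (2 * k) choose i) * ?R"
    by (simp add: sum_distrib_right)
  also have "\<dots> = 4 ^ k * ?R" by (simp add: choose_row_sum power_mult)
  finally show ?thesis by simp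
qed

text \<open>The weight \<open>1 / n\<close> makes the recursion for the moments of partial sums polynomial.\<close>

lemma power_add_le_weighted:
  fixes s x :: real
  assumes k: "k \<ge> 1" and n: "n \<ge> 1"
  shows "(s + x) ^ (2 * k) \<le> (1 + 1 / real n) * s ^ (2 * k) + 2 * real k * s ^ (2 * k - 1) * x
           + 2 * (4 ^ k) ^ k * real n ^ (k - 1) * x ^ (2 * k)"
proof -
  define c :: real where "c = 4 ^ k"
  have c1: "c \<ge> 1" by (simp add: c_def)
  have sk: "s ^ (2 * k) = s ^ (2 * k - 2) * s\<^sup>2" for s :: real
    using k by (cases k) (auto simp: power2_eq_square)
  have sk': "s ^ (2 * k - 2) = (s\<^sup>2) ^ (k - 1)" for s :: real
    by (simp add: right_diff_distrib' flip: power_mult)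
  have ck: "c ^ k = c * c ^ (k - 1)" using k by (cases k) auto
  \<comment> \<open>Either \<open>x\<close> is small compared with \<open>s\<close>, and the
    quadratic term is absorbed into s^(2k) / n; or s^2 < c n x^2, and the remaining powers of
    \<open>s\<close> are traded for powers of c n x^2. The second case produces the constant c^k and
    the factor n^(k-1).\<close>
  have 1: "c * (s ^ (2 * k - 2) * x\<^sup>2) \<le> s ^ (2 * k) / n + c ^ k * real n ^ (k - 1) * x ^ (2 * k)"
  proof (cases "c * x\<^sup>2 * n \<le> s\<^sup>2")
    case True
    then have "c * x\<^sup>2 \<le> s\<^sup>2 / n" using n by (simp add: field_simps)
    then have "s ^ (2 * k - 2) * (c * x\<^sup>2) \<le> s ^ (2 * k - 2) * (s\<^sup>2 / n)"
      by (intro mult_left_mono) (auto simp: zero_le_even_power)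
    moreover have "0 \<le> c ^ k * real n ^ (k - 1) * x ^ (2 * k)"
      using c1 by (simp add: zero_le_even_power)
    moreover have "s ^ (2 * k) / n = s ^ (2 * k - 2) * (s\<^sup>2 / n)" by (simp add: sk[of s])
    ultimately show ?thesis by (simp only: mult.left_commute)
  next
    case False
    have "s ^ (2 * k - 2) \<le> (c * x\<^sup>2 * n) ^ (k - 1)"
      unfolding sk' using False by (intro power_mono) auto
    then have "c * (s ^ (2 * k - 2) * x\<^sup>2) \<le> c * ((c * x\<^sup>2 * n) ^ (k - 1) * x\<^sup>2)"
      using c1 by (intro mult_left_mono mult_right_mono) auto
    also have "\<dots> = (c * c ^ (k - 1)) * real n ^ (k - 1) * ((x\<^sup>2) ^ (k - 1) * x\<^sup>2)"
      by (simp only: power_mult_distrib mult_ac)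
    also have "\<dots> = c ^ k * real n ^ (k - 1) * x ^ (2 * k)"
      by (simp only: ck sk[of x] sk'[of x])
    finally show ?thesis using zero_le_even_power[of "2 * k" s]
      by (smt (verit, best) dvd_triv_left divide_nonneg_nonneg of_nat_0_le_iff)
  qed
  have 2: "c * x ^ (2 * k) \<le> c ^ k * real n ^ (k - 1) * x ^ (2 * k)"
  proof -
    have "c * 1 \<le> c * (c ^ (k - 1) * real n ^ (k - 1))"
      using c1 n by (intro mult_left_mono) (auto simp flip: power_mult_distrib intro!: one_le_power mult_ge1_I)
    then show ?thesis by (intro mult_right_mono) (auto simp: ck mult_ac zero_le_even_power)
  qed
  \<comment> \<open>The two remainder terms contribute the same bound each, whence the factor
    2.\<close>
  show ?thesis
    using power_add_le_first_order[OF k, of s x] 1 2 unfolding c_def[symmetric]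
    by (simp add: algebra_simps)
qed

lemma (in prob_space) integrable_even_power_sum:
  fixes X :: "nat \<Rightarrow> 'a \<Rightarrow> real"
  assumes [measurable]: "\<And>n. n < N \<Longrightarrow> random_variable borel (X n)"
    and int: "\<And>n. n < N \<Longrightarrow> integrable M (\<lambda>\<omega>. X n \<omega> ^ (2 * k))"
    and "n \<le> N"
  shows "integrable M (\<lambda>\<omega>. (\<Sum>i<n. X i \<omega>) ^ (2 * k))"
  using \<open>n \<le> N\<close>
proof (induction n)
  case (Suc n)
  have [measurable]: "(\<lambda>\<omega>. \<Sum>i<n. X i \<omega>) \<in> borel_measurable M" "X n \<in> borel_measurable M"
    using Suc.prems by (auto intro!: borel_measurable_sum assms)
  show ?case
  proof (rule Bochner_Integration.integrable_bound)
    show "integrable M (\<lambda>\<omega>. 4 ^ k * ((\<Sum>i<n. X i \<omega>) ^ (2 * k) + X n \<omega> ^ (2 * k)))"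
      using Suc int by (intro integrable_mult_right Bochner_Integration.integrable_add) auto
    show "AE \<omega> in M. norm ((\<Sum>i<Suc n. X i \<omega>) ^ (2 * k))
        \<le> norm (4 ^ k * ((\<Sum>i<n. X i \<omega>) ^ (2 * k) + X n \<omega> ^ (2 * k)))"
      using even_power_add_le by (auto simp: zero_le_even_power power_even_abs)
  qed simp
qed simp

text \<open>The orthogonality hypothesis holds for sums of independent centered variables, and also
  when independence is only conditional.\<close>

lemma (in prob_space) even_moment_orthogonal_sum:
  fixes X :: "nat \<Rightarrow> 'a \<Rightarrow> real"
  assumes k: "k \<ge> 2"
    and [measurable]: "\<And>n. n < N \<Longrightarrow> random_variable borel (X n)"
    and int: "\<And>n. n < N \<Longrightarrow> integrable M (\<lambda>\<omega>. X n \<omega> ^ (2 * k))"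
    and bound: "\<And>n. n < N \<Longrightarrow> expectation (\<lambda>\<omega>. X n \<omega> ^ (2 * k)) \<le> m"
    and orth: "\<And>n. n < N \<Longrightarrow> expectation (\<lambda>\<omega>. (\<Sum>i<n. X i \<omega>) ^ (2 * k - 1) * X n \<omega>) = 0"
    and "m \<ge> 0"
  shows "expectation (\<lambda>\<omega>. (\<Sum>i<N. X i \<omega>) ^ (2 * k)) \<le> 2 * (4 ^ k) ^ k * real N ^ k * m"
proof -
  define D :: real where "D = 2 * (4 ^ k) ^ k"
  have D1: "D \<ge> 1"
  proof -
    have "(4 ^ k :: real) ^ k \<ge> 1" by (intro one_le_power) simp
    then show ?thesis unfolding D_def by linarith
  qed
  have "expectation (\<lambda>\<omega>. (\<Sum>i<n. X i \<omega>) ^ (2 * k)) \<le> D * real n ^ k * m" if "n \<le> N" for n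
    using that
  proof (induction n)
    case (Suc n)
    let ?S = "\<lambda>\<omega>. \<Sum>i<n. X i \<omega>"
    have [measurable]: "?S \<in> borel_measurable M" "X n \<in> borel_measurable M"
      using Suc.prems by (auto intro!: borel_measurable_sum assms)
    have intS: "integrable M (\<lambda>\<omega>. ?S \<omega> ^ (2 * k))"
      using Suc.prems by (intro integrable_even_power_sum[of N] assms) auto
    have intX: "integrable M (\<lambda>\<omega>. X n \<omega> ^ (2 * k))" using Suc.prems int by simp
    have bX: "expectation (\<lambda>\<omega>. X n \<omega> ^ (2 * k)) \<le> m" using Suc.prems bound by simp
    show ?case
    \<comment> \<open>The weight 1 / n is meaningful only for n \<ge> 1, so the first summand is
      treated separately.\<close>
    proof (cases "n = 0")
      case True
      have "m \<le> D * m" using D1 \<open>m \<ge> 0\<close> mult_right_mono[of 1 D m] by simp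
      then show ?thesis using True bX by simp
    next
      case False
      then have n: "n \<ge> 1" by simp
      have intSX: "integrable M (\<lambda>\<omega>. ?S \<omega> ^ (2 * k - 1) * X n \<omega>)"
      proof (rule Bochner_Integration.integrable_bound)
        show "integrable M (\<lambda>\<omega>. ?S \<omega> ^ (2 * k) + X n \<omega> ^ (2 * k))"
          by (intro Bochner_Integration.integrable_add intS intX)
        have "norm (s ^ (2 * k - 1) * x) \<le> norm (s ^ (2 * k) + x ^ (2 * k))" for s x :: real
        proof -
          have "\<bar>s\<bar> ^ (2 * k - 1) * \<bar>x\<bar> \<le> max \<bar>s\<bar> \<bar>x\<bar> ^ (2 * k - 1) * max \<bar>s\<bar> \<bar>x\<bar>"
            by (intro mult_mono power_mono) auto
          also have "\<dots> = max \<bar>s\<bar> \<bar>x\<bar> ^ (2 * k)"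
            using k by (cases k) auto
          also have "\<dots> \<le> \<bar>s\<bar> ^ (2 * k) + \<bar>x\<bar> ^ (2 * k)" by (auto simp: max_def)
          finally show ?thesis by (simp add: abs_mult power_abs power_even_abs)
        qed
        then show "AE \<omega> in M. norm (?S \<omega> ^ (2 * k - 1) * X n \<omega>)
            \<le> norm (?S \<omega> ^ (2 * k) + X n \<omega> ^ (2 * k))" by simp
      qed simp
      have "expectation (\<lambda>\<omega>. (\<Sum>i<Suc n. X i \<omega>) ^ (2 * k))
          \<le> expectation (\<lambda>\<omega>. (1 + 1 / real n) * ?S \<omega> ^ (2 * k)
              + 2 * real k * (?S \<omega> ^ (2 * k - 1) * X n \<omega>)
              + D * real n ^ (k - 1) * X n \<omega> ^ (2 * k))"
      proof (rule integral_mono)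
        show "integrable M (\<lambda>\<omega>. (\<Sum>i<Suc n. X i \<omega>) ^ (2 * k))"
          using Suc.prems by (intro integrable_even_power_sum[of N] assms) auto
        show "(\<Sum>i<Suc n. X i \<omega>) ^ (2 * k) \<le> (1 + 1 / real n) * ?S \<omega> ^ (2 * k)
              + 2 * real k * (?S \<omega> ^ (2 * k - 1) * X n \<omega>)
              + D * real n ^ (k - 1) * X n \<omega> ^ (2 * k)" for \<omega>
          using power_add_le_weighted[of k n "?S \<omega>" "X n \<omega>"] k n by (simp add: D_def mult.assoc)
      qed (intro Bochner_Integration.integrable_add integrable_mult_right intS intX intSX)
      also have "\<dots> = (1 + 1 / real n) * expectation (\<lambda>\<omega>. ?S \<omega> ^ (2 * k))
              + 2 * real k * expectation (\<lambda>\<omega>. ?S \<omega> ^ (2 * k - 1) * X n \<omega>)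
              + D * real n ^ (k - 1) * expectation (\<lambda>\<omega>. X n \<omega> ^ (2 * k))"
        using intS intX intSX by simp
      also have "\<dots> \<le> (1 + 1 / real n) * (D * real n ^ k * m) + D * real n ^ (k - 1) * m"
      proof -
        have "(1 + 1 / real n) * expectation (\<lambda>\<omega>. ?S \<omega> ^ (2 * k)) \<le> (1 + 1 / real n) * (D * real n ^ k * m)"
          using Suc by (intro mult_left_mono) auto
        moreover have "D * real n ^ (k - 1) * expectation (\<lambda>\<omega>. X n \<omega> ^ (2 * k)) \<le> D * real n ^ (k - 1) * m"
          using bX D1 by (intro mult_left_mono) auto
        ultimately show ?thesis using orth[of n] Suc.prems by simp
      qed
      also have "\<dots> = D * m * (real n ^ k + 2 * real n ^ (k - 1))"
        using n k by (cases k) (auto simp: field_simps)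
      \<comment> \<open>Here k \<ge> 2 enters: the two terms of order n^(k-1) fit under the second
        term of the binomial expansion of (n + 1)^k, which closes the induction with the same
        constant \<open>D\<close>.\<close>
      also have "\<dots> \<le> D * m * (real n ^ k + real k * real n ^ (k - 1))"
        using k D1 \<open>m \<ge> 0\<close> by (intro mult_left_mono add_left_mono mult_right_mono) auto
      also have "\<dots> \<le> D * m * real (Suc n) ^ k"
      proof -
        have "real (Suc n) ^ k = (real n + 1) ^ k" by (simp add: add.commute)
        also have "\<dots> = (\<Sum>i\<le>k. real (k choose i) * real n ^ i)"
          by (simp add: binomial_ring)
        also have "\<dots> \<ge> (\<Sum>i\<in>{k, k - 1}. real (k choose i) * real n ^ i)"
          by (intro sum_mono2) auto
        also have "(\<Sum>i\<in>{k, k - 1}. real (k choose i) * real n ^ i)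
            = real n ^ k + real k * real n ^ (k - 1)"
          using k binomial_symmetric[of 1 k] by simp
        finally show ?thesis using D1 \<open>m \<ge> 0\<close> by (intro mult_left_mono) auto
      qed
      finally show ?thesis by (simp add: mult_ac)
    qed
  qed (use k in \<open>auto simp: power_0_left\<close>)
  then show ?thesis by (simp add: D_def)
qed

text \<open>The exponent 2 is outside the range of \<open>even_moment_orthogonal_sum\<close>, but
  for it the mixed term drops out and the second moments simply add. The result depends on the
  summands only through the pointwise bound \<open>B\<close>, so it is uniform over all test
  functions of norm at most 1.\<close>

lemma (in prob_space) second_moment_orthogonal_sum:
  fixes X :: "nat \<Rightarrow> 'a \<Rightarrow> real"
  assumes [measurable]: "\<And>n. n < N \<Longrightarrow> random_variable borel (X n)"
    and bound: "\<And>n \<omega>. n < N \<Longrightarrow> \<bar>X n \<omega>\<bar> \<le> B"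
    and orth: "\<And>n. n < N \<Longrightarrow> expectation (\<lambda>\<omega>. (\<Sum>i<n. X i \<omega>) * X n \<omega>) = 0"
  shows "expectation (\<lambda>\<omega>. (\<Sum>i<N. X i \<omega>)\<^sup>2) \<le> real N * B\<^sup>2"
proof -
  have "expectation (\<lambda>\<omega>. (\<Sum>i<n. X i \<omega>)\<^sup>2) \<le> real n * B\<^sup>2" if "n \<le> N" for n
    using that
  proof (induction n)
    case (Suc n)
    let ?S = "\<lambda>\<omega>. \<Sum>i<n. X i \<omega>"
    have [measurable]: "?S \<in> borel_measurable M" "X n \<in> borel_measurable M"
      using Suc.prems by (auto intro!: borel_measurable_sum assms)
    have S: "\<bar>?S \<omega>\<bar> \<le> real n * B" for \<omega>
    proof -
      have "\<bar>?S \<omega>\<bar> \<le> (\<Sum>i<n. \<bar>X i \<omega>\<bar>)" by (rule sum_abs)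
      also have "\<dots> \<le> (\<Sum>i<n. B)" using Suc.prems bound by (intro sum_mono) auto
      finally show ?thesis by simp
    qed
    have X: "\<bar>X n \<omega>\<bar> \<le> B" for \<omega> using Suc.prems bound by simp
    have B: "B \<ge> 0" using X abs_ge_zero order_trans by blast
    have S2: "(?S \<omega>)\<^sup>2 \<le> (real n * B)\<^sup>2" and X2: "(X n \<omega>)\<^sup>2 \<le> B\<^sup>2"
      and SX: "\<bar>?S \<omega> * X n \<omega>\<bar> \<le> real n * B * B" for \<omega>
      using S X B by (auto simp: abs_mult intro!: mult_mono simp flip: abs_le_square_iff)
    have int: "integrable M (\<lambda>\<omega>. (?S \<omega>)\<^sup>2)" "integrable M (\<lambda>\<omega>. (X n \<omega>)\<^sup>2)"
        "integrable M (\<lambda>\<omega>. ?S \<omega> * X n \<omega>)"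
      by (rule integrable_const_bound[where B="(real n * B)\<^sup>2"], use S2 in auto)
        (rule integrable_const_bound[where B="B\<^sup>2"], use X2 in auto,
         rule integrable_const_bound[where B="real n * B * B"], use SX in auto)
    have "expectation (\<lambda>\<omega>. (\<Sum>i<Suc n. X i \<omega>)\<^sup>2)
        = expectation (\<lambda>\<omega>. (?S \<omega>)\<^sup>2 + (X n \<omega>)\<^sup>2 + 2 * (?S \<omega> * X n \<omega>))"
      by (simp add: power2_sum algebra_simps)
    also have "\<dots> = expectation (\<lambda>\<omega>. (?S \<omega>)\<^sup>2) + expectation (\<lambda>\<omega>. (X n \<omega>)\<^sup>2)"
      using int orth[of n] Suc.prems by simp
    also have "\<dots> \<le> real n * B\<^sup>2 + expectation (\<lambda>\<omega>. B\<^sup>2)"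
      using Suc X2 int by (intro add_mono integral_mono) auto
    finally show ?case by (simp add: prob_space algebra_simps)
  qed simp
  then show ?thesis by simp
qed

section \<open>Families with uniformly bounded moments\<close>

context prob_space
begin

text \<open>Entries \<open>X N n\<close> with \<open>n \<ge> N\<close> are junk.  Even powers control all moments and need no
  absolute values.\<close>

definition bounded_moments :: "(nat \<Rightarrow> nat \<Rightarrow> 'a \<Rightarrow> real) \<Rightarrow> bool" where
  "bounded_moments X \<longleftrightarrow>
     (\<forall>N n. n < N \<longrightarrow> random_variable borel (X N n)) \<and>
     (\<forall>k. \<exists>c. \<forall>N n. n < N \<longrightarrow> (\<integral>\<^sup>+\<omega>. ennreal (X N n \<omega> ^ (2 * k)) \<partial>M) \<le> ennreal c)"

lemma bounded_moments_measurable: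
  "bounded_moments X \<Longrightarrow> n < N \<Longrightarrow> random_variable borel (X N n)"
  by (auto simp: bounded_moments_def)

lemma bounded_momentsE:
  assumes "bounded_moments X"
  obtains c where "c \<ge> 0"
    "\<And>N n. n < N \<Longrightarrow> (\<integral>\<^sup>+\<omega>. ennreal (X N n \<omega> ^ (2 * k)) \<partial>M) \<le> ennreal c"
proof -
  from assms obtain c where
    "\<And>N n. n < N \<Longrightarrow> (\<integral>\<^sup>+\<omega>. ennreal (X N n \<omega> ^ (2 * k)) \<partial>M) \<le> ennreal c"
    unfolding bounded_moments_def by blast
  then show ?thesis by (intro that[of "max 0 c"]) (auto simp: ennreal_max_0 max.commute)
qed

lemma bounded_moments_integrable:
  assumes "bounded_moments X" "n < N"
  shows "integrable M (\<lambda>\<omega>. X N n \<omega> ^ (2 * k))"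
proof -
  obtain c where "\<And>N n. n < N \<Longrightarrow> (\<integral>\<^sup>+\<omega>. ennreal (X N n \<omega> ^ (2 * k)) \<partial>M) \<le> ennreal c"
    using bounded_momentsE[OF assms(1)] by metis
  from this[OF assms(2)] have "(\<integral>\<^sup>+\<omega>. ennreal (X N n \<omega> ^ (2 * k)) \<partial>M) < \<infinity>"
    using ennreal_less_top order_le_less_trans by (metis infinity_ennreal_def)
  with bounded_moments_measurable[OF assms] show ?thesis
    by (intro integrableI_nonneg) (auto simp: zero_le_even_power)
qed

lemma bounded_moments_expectationE:
  assumes "bounded_moments X"
  obtains c where "c \<ge> 0"
    "\<And>N n. n < N \<Longrightarrow> expectation (\<lambda>\<omega>. X N n \<omega> ^ (2 * k)) \<le> c"
proof -
  obtain c where c: "c \<ge> 0"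
    "\<And>N n. n < N \<Longrightarrow> (\<integral>\<^sup>+\<omega>. ennreal (X N n \<omega> ^ (2 * k)) \<partial>M) \<le> ennreal c"
    using bounded_momentsE[OF assms] by metis
  show ?thesis
  proof (rule that[OF c(1)])
    fix N n :: nat assume n: "n < N"
    have "ennreal (expectation (\<lambda>\<omega>. X N n \<omega> ^ (2 * k))) = (\<integral>\<^sup>+\<omega>. ennreal (X N n \<omega> ^ (2 * k)) \<partial>M)"
      by (intro nn_integral_eq_integral[symmetric] bounded_moments_integrable assms n)
        (simp add: zero_le_even_power)
    then show "expectation (\<lambda>\<omega>. X N n \<omega> ^ (2 * k)) \<le> c" using c n by (metis ennreal_le_iff)
  qed
qed

text \<open>Domination is required only almost surely, which is what the Lipschitz hypothesis on the
  random map provides.\<close>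

lemma bounded_moments_mono_AE:
  assumes "bounded_moments Y" "\<And>N n. n < N \<Longrightarrow> random_variable borel (X N n)"
    and "\<And>N n. n < N \<Longrightarrow> AE \<omega> in M. \<bar>X N n \<omega>\<bar> \<le> \<bar>Y N n \<omega>\<bar>"
  shows "bounded_moments X"
  unfolding bounded_moments_def
proof (intro conjI allI impI)
  fix k
  obtain c where c:
    "\<And>N n. n < N \<Longrightarrow> (\<integral>\<^sup>+\<omega>. ennreal (Y N n \<omega> ^ (2 * k)) \<partial>M) \<le> ennreal c"
    using bounded_momentsE[OF assms(1)] by metis
  have "(\<integral>\<^sup>+\<omega>. ennreal (X N n \<omega> ^ (2 * k)) \<partial>M) \<le> ennreal c" if n: "n < N" for N n
  proof -
    have "(\<integral>\<^sup>+\<omega>. ennreal (X N n \<omega> ^ (2 * k)) \<partial>M) \<le> (\<integral>\<^sup>+\<omega>. ennreal (Y N n \<omega> ^ (2 * k)) \<partial>M)"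
      by (rule nn_integral_mono_AE, use assms(3)[OF n] in eventually_elim)
        (intro ennreal_leI even_power_mono)
    with c[OF n] show ?thesis by (rule order_trans[rotated])
  qed
  then show "\<exists>c. \<forall>N n. n < N \<longrightarrow> (\<integral>\<^sup>+\<omega>. ennreal (X N n \<omega> ^ (2 * k)) \<partial>M) \<le> ennreal c" by blast
qed (use assms(2) in auto)

lemma bounded_moments_cong:
  assumes "bounded_moments X" "\<And>N n. n < N \<Longrightarrow> random_variable borel (Y N n)"
    and "\<And>N n. n < N \<Longrightarrow> AE \<omega> in M. Y N n \<omega> = X N n \<omega>"
  shows "bounded_moments Y"
proof (rule bounded_moments_mono_AE[OF assms(1,2)])
  show "AE \<omega> in M. \<bar>Y N n \<omega>\<bar> \<le> \<bar>X N n \<omega>\<bar>" if "n < N" for N n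
    using assms(3)[OF that] by eventually_elim simp
qed

lemma bounded_moments_const: "bounded_moments (\<lambda>N n \<omega>. c)"
  unfolding bounded_moments_def by (auto simp: emeasure_space_1 zero_le_even_power)

lemma bounded_moments_add:
  assumes X: "bounded_moments X" and Y: "bounded_moments Y"
  shows "bounded_moments (\<lambda>N n \<omega>. X N n \<omega> + Y N n \<omega>)"
  unfolding bounded_moments_def
proof (intro conjI allI impI)
  note [measurable] = bounded_moments_measurable[OF X] bounded_moments_measurable[OF Y]
  show "(\<lambda>\<omega>. X N n \<omega> + Y N n \<omega>) \<in> borel_measurable M" if "n < N" for N n using that by measurable
  fix k
  obtain c d where c: "c \<ge> 0" "\<And>N n. n < N \<Longrightarrow> (\<integral>\<^sup>+\<omega>. ennreal (X N n \<omega> ^ (2 * k)) \<partial>M) \<le> ennreal c"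
    and d: "d \<ge> 0" "\<And>N n. n < N \<Longrightarrow> (\<integral>\<^sup>+\<omega>. ennreal (Y N n \<omega> ^ (2 * k)) \<partial>M) \<le> ennreal d"
    using bounded_momentsE[OF X] bounded_momentsE[OF Y] by metis
  have "(\<integral>\<^sup>+\<omega>. ennreal ((X N n \<omega> + Y N n \<omega>) ^ (2 * k)) \<partial>M) \<le> ennreal (4 ^ k * (c + d))"
    if n: "n < N" for N n
  proof -
    note [measurable] = bounded_moments_measurable[OF X n] bounded_moments_measurable[OF Y n]
    have "(\<integral>\<^sup>+\<omega>. ennreal ((X N n \<omega> + Y N n \<omega>) ^ (2 * k)) \<partial>M)
        \<le> (\<integral>\<^sup>+\<omega>. ennreal (4 ^ k) * (ennreal (X N n \<omega> ^ (2 * k)) + ennreal (Y N n \<omega> ^ (2 * k))) \<partial>M)"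
      by (intro nn_integral_mono)
        (auto simp: zero_le_even_power simp flip: ennreal_plus ennreal_mult
          intro!: ennreal_leI even_power_add_le)
    also have "\<dots> = ennreal (4 ^ k) * ((\<integral>\<^sup>+\<omega>. ennreal (X N n \<omega> ^ (2 * k)) \<partial>M)
        + (\<integral>\<^sup>+\<omega>. ennreal (Y N n \<omega> ^ (2 * k)) \<partial>M))"
      by (simp add: nn_integral_cmult nn_integral_add)
    also have "\<dots> \<le> ennreal (4 ^ k) * (ennreal c + ennreal d)"
      by (intro mult_left_mono add_mono c d n) auto
    finally show ?thesis using c d by (simp add: ennreal_mult)
  qed
  then show "\<exists>c. \<forall>N n. n < N \<longrightarrow>
      (\<integral>\<^sup>+\<omega>. ennreal ((X N n \<omega> + Y N n \<omega>) ^ (2 * k)) \<partial>M) \<le> ennreal c" by blast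
qed

text \<open>The moment of order 2k of a product is paid for with moments of order 4k of the factors.
  The class is closed under products only because every order is included.\<close>

lemma bounded_moments_mult:
  assumes X: "bounded_moments X" and Y: "bounded_moments Y"
  shows "bounded_moments (\<lambda>N n \<omega>. X N n \<omega> * Y N n \<omega>)"
  unfolding bounded_moments_def
proof (intro conjI allI impI)
  note [measurable] = bounded_moments_measurable[OF X] bounded_moments_measurable[OF Y]
  show "(\<lambda>\<omega>. X N n \<omega> * Y N n \<omega>) \<in> borel_measurable M" if "n < N" for N n using that by measurable
  fix k
  obtain c d where c: "c \<ge> 0" "\<And>N n. n < N \<Longrightarrow> (\<integral>\<^sup>+\<omega>. ennreal (X N n \<omega> ^ (2 * (2 * k))) \<partial>M) \<le> ennreal c"
    and d: "d \<ge> 0" "\<And>N n. n < N \<Longrightarrow> (\<integral>\<^sup>+\<omega>. ennreal (Y N n \<omega> ^ (2 * (2 * k))) \<partial>M) \<le> ennreal d"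
    using bounded_momentsE[OF X] bounded_momentsE[OF Y] by metis
  have "(\<integral>\<^sup>+\<omega>. ennreal ((X N n \<omega> * Y N n \<omega>) ^ (2 * k)) \<partial>M) \<le> ennreal (c + d)"
    if n: "n < N" for N n
  proof -
    note [measurable] = bounded_moments_measurable[OF X n] bounded_moments_measurable[OF Y n]
    have "(\<integral>\<^sup>+\<omega>. ennreal ((X N n \<omega> * Y N n \<omega>) ^ (2 * k)) \<partial>M)
        \<le> (\<integral>\<^sup>+\<omega>. ennreal (X N n \<omega> ^ (2 * (2 * k))) + ennreal (Y N n \<omega> ^ (2 * (2 * k))) \<partial>M)"
      using even_power_mult_le[of "X N n _" "Y N n _" k]
      by (intro nn_integral_mono) (simp add: zero_le_even_power ennreal_leI flip: ennreal_plus)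
    also have "\<dots> = (\<integral>\<^sup>+\<omega>. ennreal (X N n \<omega> ^ (2 * (2 * k))) \<partial>M)
        + (\<integral>\<^sup>+\<omega>. ennreal (Y N n \<omega> ^ (2 * (2 * k))) \<partial>M)"
      by (simp add: nn_integral_add)
    also have "\<dots> \<le> ennreal c + ennreal d" by (intro add_mono c d n)
    finally show ?thesis using c d by simp
  qed
  then show "\<exists>c. \<forall>N n. n < N \<longrightarrow>
      (\<integral>\<^sup>+\<omega>. ennreal ((X N n \<omega> * Y N n \<omega>) ^ (2 * k)) \<partial>M) \<le> ennreal c" by blast
qed

lemma bounded_moments_diff:
  assumes "bounded_moments X" "bounded_moments Y"
  shows "bounded_moments (\<lambda>N n \<omega>. X N n \<omega> - Y N n \<omega>)"
  using bounded_moments_add[OF assms(1) bounded_moments_mult[OF bounded_moments_const[of "-1"] assms(2)]]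
  by simp

lemma bounded_moments_abs:
  assumes "bounded_moments X"
  shows "bounded_moments (\<lambda>N n \<omega>. \<bar>X N n \<omega>\<bar>)"
  by (rule bounded_moments_mono_AE[OF assms]) (use bounded_moments_measurable[OF assms] in auto)

lemma bounded_moments_sum:
  assumes "\<And>i. i \<in> I \<Longrightarrow> bounded_moments (X i)"
  shows "bounded_moments (\<lambda>N n \<omega>. \<Sum>i\<in>I. X i N n \<omega>)"
  using assms
  by (induction I rule: infinite_finite_induct) (simp_all add: bounded_moments_const bounded_moments_add)

text \<open>By convexity of even powers the average inherits the bound of its terms. Uniformity of
  that bound in both the ensemble size and the member is what makes this work.\<close>

lemma bounded_moments_average:
  assumes X: "bounded_moments X"
  shows "bounded_moments (\<lambda>N n \<omega>. (\<Sum>m<N. X N m \<omega>) / N)"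
  unfolding bounded_moments_def
proof (intro conjI allI impI)
  note [measurable] = bounded_moments_measurable[OF X]
  show "(\<lambda>\<omega>. (\<Sum>m<N. X N m \<omega>) / N) \<in> borel_measurable M" for N by measurable
  fix k
  obtain c where c: "c \<ge> 0" "\<And>N n. n < N \<Longrightarrow> (\<integral>\<^sup>+\<omega>. ennreal (X N n \<omega> ^ (2 * k)) \<partial>M) \<le> ennreal c"
    using bounded_momentsE[OF X] by metis
  have "(\<integral>\<^sup>+\<omega>. ennreal (((\<Sum>m<N. X N m \<omega>) / N) ^ (2 * k)) \<partial>M) \<le> ennreal c"
    if n: "n < N" for N n :: nat
  proof -
    have "(\<integral>\<^sup>+\<omega>. ennreal (((\<Sum>m<N. X N m \<omega>) / N) ^ (2 * k)) \<partial>M)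
        \<le> (\<integral>\<^sup>+\<omega>. (\<Sum>m<N. ennreal (1 / N) * ennreal (X N m \<omega> ^ (2 * k))) \<partial>M)"
    proof (rule nn_integral_mono)
      fix \<omega>
      have "((\<Sum>m<N. X N m \<omega>) / N) ^ (2 * k) \<le> (\<Sum>m<N. 1 / N * X N m \<omega> ^ (2 * k))"
        using even_power_average_le[of N "\<lambda>m. X N m \<omega>" k] n by (simp add: sum_divide_distrib)
      then show "ennreal (((\<Sum>m<N. X N m \<omega>) / N) ^ (2 * k))
          \<le> (\<Sum>m<N. ennreal (1 / N) * ennreal (X N m \<omega> ^ (2 * k)))"
        by (simp add: ennreal_leI zero_le_even_power flip: ennreal_mult)
    qed
    also have "\<dots> = (\<Sum>m<N. ennreal (1 / N) * (\<integral>\<^sup>+\<omega>. ennreal (X N m \<omega> ^ (2 * k)) \<partial>M))"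
      by (subst nn_integral_sum) (auto intro!: sum.cong nn_integral_cmult)
    also have "\<dots> \<le> (\<Sum>m<N. ennreal (1 / N) * ennreal c)"
      by (intro sum_mono mult_left_mono c) auto
    also have "\<dots> = ennreal c"
      using n c by (simp add: ennreal_of_nat_eq_real_of_nat flip: ennreal_mult)
    finally show ?thesis .
  qed
  then show "\<exists>c. \<forall>N n. n < N \<longrightarrow>
      (\<integral>\<^sup>+\<omega>. ennreal (((\<Sum>m<N. X N m \<omega>) / N) ^ (2 * k)) \<partial>M) \<le> ennreal c" by blast
qed

end

text \<open>The moment estimate for orthogonal sums is available for k \<ge> 2 only. The lower
  orders follow from x^(2k) \<le> 1 + x^(2(k+2)).\<close>

lemma (in prob_space) bounded_momentsI:
  assumes "\<And>N n. n < N \<Longrightarrow> random_variable borel (X N n)"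
    and "\<And>k. k \<ge> 2 \<Longrightarrow>
      \<exists>c. \<forall>N n. n < N \<longrightarrow> (\<integral>\<^sup>+\<omega>. ennreal (X N n \<omega> ^ (2 * k)) \<partial>M) \<le> ennreal c"
  shows "bounded_moments X"
  unfolding bounded_moments_def
proof (intro conjI allI impI)
  fix k
  obtain c where c: "\<And>N n. n < N \<Longrightarrow> (\<integral>\<^sup>+\<omega>. ennreal (X N n \<omega> ^ (2 * (k + 2))) \<partial>M) \<le> ennreal c"
    using assms(2)[of "k + 2"] by auto
  have p: "x ^ (2 * k) \<le> 1 + x ^ (2 * (k + 2))" for x :: real
  proof (cases "\<bar>x\<bar> \<le> 1")
    case True
    then have "x ^ (2 * k) \<le> 1" using even_power_mono[of x 1 k] by simp
    then show ?thesis by (smt (verit) even_mult_iff even_numeral zero_le_even_power)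
  next
    case False
    then have "\<bar>x\<bar> ^ (2 * k) \<le> \<bar>x\<bar> ^ (2 * (k + 2))" by (intro power_increasing) auto
    moreover have "\<bar>x\<bar> ^ (2 * k) = x ^ (2 * k)" "\<bar>x\<bar> ^ (2 * (k + 2)) = x ^ (2 * (k + 2))"
      by (intro power_even_abs; simp)+
    ultimately show ?thesis by linarith
  qed
  have "(\<integral>\<^sup>+\<omega>. ennreal (X N n \<omega> ^ (2 * k)) \<partial>M) \<le> ennreal (1 + max 0 c)" if n: "n < N" for N n
  proof -
    note [measurable] = assms(1)[OF n]
    have "(\<integral>\<^sup>+\<omega>. ennreal (X N n \<omega> ^ (2 * k)) \<partial>M)
        \<le> (\<integral>\<^sup>+\<omega>. ennreal 1 + ennreal (X N n \<omega> ^ (2 * (k + 2))) \<partial>M)"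
      using ennreal_leI[OF p] unfolding ennreal_plus[OF zero_le_one zero_le_even_power']
      by (rule nn_integral_mono)
    also have "\<dots> = 1 + (\<integral>\<^sup>+\<omega>. ennreal (X N n \<omega> ^ (2 * (k + 2))) \<partial>M)"
      by (subst nn_integral_add) (auto simp: emeasure_space_1)
    also have "\<dots> \<le> 1 + ennreal c" by (intro add_left_mono c n)
    also have "\<dots> = ennreal (1 + max 0 c)" by (simp add: ennreal_max_0 max.commute)
    finally show ?thesis .
  qed
  then show "\<exists>c. \<forall>N n. n < N \<longrightarrow> (\<integral>\<^sup>+\<omega>. ennreal (X N n \<omega> ^ (2 * k)) \<partial>M) \<le> ennreal c" by blast
qed (use assms(1) in auto)

text \<open>Jensen's inequality in a form that needs no integrability beforehand: if the right side
  is infinite there is nothing to show, for k = 0 both sides are 1, and otherwise \<open>X\<close>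
  is integrable. It is applied to conditional means, where the conditional moment may be infinite
  for exceptional data.\<close>

lemma (in prob_space) even_power_expectation_le:
  fixes X :: "'a \<Rightarrow> real"
  assumes [measurable]: "random_variable borel X"
  shows "ennreal (expectation X ^ (2 * k)) \<le> (\<integral>\<^sup>+\<omega>. ennreal (X \<omega> ^ (2 * k)) \<partial>M)"
proof (cases "(\<integral>\<^sup>+\<omega>. ennreal (X \<omega> ^ (2 * k)) \<partial>M) = \<infinity> \<or> k = 0")
  case True
  then show ?thesis by (auto simp: emeasure_space_1)
next
  case False
  then have k: "k \<ge> 1" by simp
  have int: "integrable M (\<lambda>\<omega>. X \<omega> ^ (2 * k))"
    using False by (intro integrableI_nonneg) (auto simp: zero_le_even_power less_top)
  have intX: "integrable M X"
  proof (rule Bochner_Integration.integrable_bound)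
    show "integrable M (\<lambda>\<omega>. 1 + X \<omega> ^ (2 * k))" using int by simp
    have "\<bar>x\<bar> \<le> \<bar>1 + x ^ (2 * k)\<bar>" for x :: real
    proof (cases "\<bar>x\<bar> \<le> 1")
      case False
      then have "\<bar>x\<bar> ^ 1 \<le> \<bar>x\<bar> ^ (2 * k)" using k by (intro power_increasing) auto
      then show ?thesis by (simp add: power_even_abs)
    next
      case True
      moreover have "0 \<le> x ^ (2 * k)" by (simp add: zero_le_even_power)
      ultimately show ?thesis by linarith
    qed
    then show "AE \<omega> in M. norm (X \<omega>) \<le> norm (1 + X \<omega> ^ (2 * k))" by simp
  qed simp
  have "expectation X ^ (2 * k) \<le> expectation (\<lambda>\<omega>. X \<omega> ^ (2 * k))"
    by (rule jensens_inequality[where I = UNIV]) (auto intro: intX int convex_power_even)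
  moreover have "(\<integral>\<^sup>+\<omega>. ennreal (X \<omega> ^ (2 * k)) \<partial>M) = ennreal (expectation (\<lambda>\<omega>. X \<omega> ^ (2 * k)))"
    by (intro nn_integral_eq_integral int) (simp add: zero_le_even_power)
  ultimately show ?thesis by (simp add: ennreal_leI)
qed

section \<open>The closeness relation and its congruence rules\<close>

context prob_space
begin

text \<open>The moment bounds on both families are built into the relation so that it is preserved
  by products, where each difference is multiplied by a factor of the other pair.\<close>

definition root_N_close ::
  "(nat \<Rightarrow> nat \<Rightarrow> 'a \<Rightarrow> real) \<Rightarrow> (nat \<Rightarrow> nat \<Rightarrow> 'a \<Rightarrow> real) \<Rightarrow> bool" where
  "root_N_close X Y \<longleftrightarrow> bounded_moments X \<and> bounded_moments Y \<and>
     bounded_moments (\<lambda>N n \<omega>. sqrt N * (X N n \<omega> - Y N n \<omega>))"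

text \<open>For N \<ge> 1 the unscaled difference is at most the scaled one, so the moments of
  \<open>X\<close> are controlled by those of \<open>Y\<close> and of the scaled difference. Hence
  the ensemble members need no a priori moment bound: theirs comes from the copies.\<close>

lemma root_N_closeI:
  assumes Y: "bounded_moments Y" and X: "\<And>N n. n < N \<Longrightarrow> random_variable borel (X N n)"
    and D: "bounded_moments (\<lambda>N n \<omega>. sqrt N * (X N n \<omega> - Y N n \<omega>))"
  shows "root_N_close X Y"
  unfolding root_N_close_def
proof (intro conjI Y D)
  show "bounded_moments X"
  proof (rule bounded_moments_mono_AE[OF bounded_moments_add[OF bounded_moments_abs[OF Y] bounded_moments_abs[OF D]] X])
    fix N n :: nat assume "n < N"
    then have "sqrt N \<ge> 1" by simp
    then have "\<bar>x\<bar> \<le> \<bar>\<bar>y\<bar> + \<bar>sqrt N * (x - y)\<bar>\<bar>" for x y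
      using mult_right_mono[of 1 "sqrt N" "\<bar>x - y\<bar>"] by (simp add: abs_mult)
    then show "AE \<omega> in M. \<bar>X N n \<omega>\<bar> \<le> \<bar>\<bar>Y N n \<omega>\<bar> + \<bar>sqrt N * (X N n \<omega> - Y N n \<omega>)\<bar>\<bar>" by blast
  qed
qed

lemma root_N_close_refl: "bounded_moments X \<Longrightarrow> root_N_close X X"
  by (simp add: root_N_close_def bounded_moments_const)

lemma root_N_close_trans:
  assumes "root_N_close X Y" "root_N_close Y Z"
  shows "root_N_close X Z"
proof -
  have "bounded_moments (\<lambda>N n \<omega>. sqrt N * (X N n \<omega> - Y N n \<omega>) + sqrt N * (Y N n \<omega> - Z N n \<omega>))"
    by (rule bounded_moments_add) (use assms in \<open>auto simp: root_N_close_def\<close>)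
  then show ?thesis using assms by (simp add: root_N_close_def flip: distrib_left)
qed

lemma root_N_close_add:
  assumes "root_N_close X Y" "root_N_close X' Y'"
  shows "root_N_close (\<lambda>N n \<omega>. X N n \<omega> + X' N n \<omega>) (\<lambda>N n \<omega>. Y N n \<omega> + Y' N n \<omega>)"
proof -
  have "bounded_moments (\<lambda>N n \<omega>. sqrt N * (X N n \<omega> - Y N n \<omega>) + sqrt N * (X' N n \<omega> - Y' N n \<omega>))"
    by (rule bounded_moments_add) (use assms in \<open>auto simp: root_N_close_def\<close>)
  then show ?thesis using assms
    by (simp add: root_N_close_def bounded_moments_add add_diff_add flip: distrib_left)
qed

lemma root_N_close_mult:
  assumes "root_N_close X Y" "root_N_close X' Y'"
  shows "root_N_close (\<lambda>N n \<omega>. X N n \<omega> * X' N n \<omega>) (\<lambda>N n \<omega>. Y N n \<omega> * Y' N n \<omega>)"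
proof -
  \<comment> \<open>The usual telescoping XX' - YY' = (X - Y) X' + (X' - Y') Y.\<close>
  have "bounded_moments (\<lambda>N n \<omega>. sqrt N * (X N n \<omega> - Y N n \<omega>) * X' N n \<omega>
      + sqrt N * (X' N n \<omega> - Y' N n \<omega>) * Y N n \<omega>)"
    by (rule bounded_moments_add; rule bounded_moments_mult)
      (use assms in \<open>auto simp: root_N_close_def\<close>)
  then have "bounded_moments (\<lambda>N n \<omega>. sqrt N * (X N n \<omega> * X' N n \<omega> - Y N n \<omega> * Y' N n \<omega>))"
    by (simp add: algebra_simps)
  then show ?thesis using assms by (simp add: root_N_close_def bounded_moments_mult)
qed

lemma root_N_close_diff:
  assumes "root_N_close X Y" "root_N_close X' Y'"
  shows "root_N_close (\<lambda>N n \<omega>. X N n \<omega> - X' N n \<omega>) (\<lambda>N n \<omega>. Y N n \<omega> - Y' N n \<omega>)"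
  using root_N_close_add[OF assms(1)
      root_N_close_mult[OF root_N_close_refl[OF bounded_moments_const[of "-1"]] assms(2)]]
  by simp

lemma root_N_close_sum:
  assumes "\<And>i. i \<in> I \<Longrightarrow> root_N_close (X i) (Y i)"
  shows "root_N_close (\<lambda>N n \<omega>. \<Sum>i\<in>I. X i N n \<omega>) (\<lambda>N n \<omega>. \<Sum>i\<in>I. Y i N n \<omega>)"
  using assms
  by (induction I rule: infinite_finite_induct)
    (simp_all add: root_N_close_refl bounded_moments_const root_N_close_add)

lemma root_N_close_average:
  assumes "root_N_close X Y"
  shows "root_N_close (\<lambda>N n \<omega>. (\<Sum>m<N. X N m \<omega>) / N) (\<lambda>N n \<omega>. (\<Sum>m<N. Y N m \<omega>) / N)"
proof -
  have "bounded_moments (\<lambda>N n \<omega>. (\<Sum>m<N. sqrt N * (X N m \<omega> - Y N m \<omega>)) / N)"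
    by (rule bounded_moments_average) (use assms in \<open>auto simp: root_N_close_def\<close>)
  then show ?thesis using assms
    by (simp add: root_N_close_def bounded_moments_average sum_subtractf diff_divide_distrib
        right_diff_distrib flip: sum_distrib_left)
qed

end

text \<open>Used for the mean-field covariance, whose expression by first and second moments is
  available only for almost all data.\<close>

lemma (in prob_space) root_N_close_cong_right:
  assumes "root_N_close X Y" "\<And>N n. n < N \<Longrightarrow> random_variable borel (Z N n)"
    and "\<And>N n. n < N \<Longrightarrow> AE \<omega> in M. Z N n \<omega> = Y N n \<omega>"
  shows "root_N_close X Z"
proof -
  have "bounded_moments (\<lambda>N n \<omega>. sqrt N * (X N n \<omega> - Z N n \<omega>))"
  proof (rule bounded_moments_cong)
    show "bounded_moments (\<lambda>N n \<omega>. sqrt N * (X N n \<omega> - Y N n \<omega>))"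
      using assms(1) by (simp add: root_N_close_def)
    fix N n :: nat assume n: "n < N"
    have "bounded_moments X" using assms(1) by (simp add: root_N_close_def)
    note [measurable] = bounded_moments_measurable[OF this n] assms(2)[OF n]
    show "(\<lambda>\<omega>. sqrt N * (X N n \<omega> - Z N n \<omega>)) \<in> borel_measurable M" by measurable
    show "AE \<omega> in M. sqrt N * (X N n \<omega> - Z N n \<omega>) = sqrt N * (X N n \<omega> - Y N n \<omega>)"
      using assms(3)[OF n] by eventually_elim simp
  qed
  then show ?thesis
    using assms bounded_moments_cong[of Y Z] by (simp add: root_N_close_def)
qed

section \<open>The Kalman gain\<close>

text \<open>\<open>norm\<close> on matrices is the Frobenius norm, so Cauchy-Schwarz in each row
  suffices.\<close>

lemma norm_matrix_vector_mult_le: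
  fixes A :: "real^'n^'m"
  shows "norm (A *v x) \<le> norm A * norm x"
proof -
  have "norm (A *v x) \<le> L2_set (\<lambda>i. norm (A $ i) * norm x) UNIV"
    unfolding norm_vec_def[of "A *v x"]
    by (intro L2_set_mono) (auto simp: matrix_vector_mul_component Cauchy_Schwarz_ineq2)
  also have "\<dots> = norm A * norm x" by (simp add: norm_vec_def[of A] L2_set_left_distrib)
  finally show ?thesis .
qed

lemma continuous_on_matrix_vector_mult [continuous_intros]:
  fixes A :: "'a::topological_space \<Rightarrow> real^'n^'m"
  assumes "continuous_on S A" "continuous_on S x"
  shows "continuous_on S (\<lambda>z. A z *v x z)"
  unfolding matrix_vector_mult_def
  by (intro continuous_intros assms)

lemma borel_measurable_matrix_vector_mult [measurable (raw)]:
  fixes A :: "'a \<Rightarrow> real^'n^'m"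
  assumes "A \<in> borel_measurable M" "x \<in> borel_measurable M"
  shows "(\<lambda>z. A z *v x z) \<in> borel_measurable M"
  by (rule borel_measurable_continuous_Pair[OF assms]) (intro continuous_intros)

lemma borel_measurable_matrix_entries:
  fixes A :: "'a \<Rightarrow> real^'n^'m"
  assumes "\<And>i k. (\<lambda>z. A z $ i $ k) \<in> borel_measurable M"
  shows "A \<in> borel_measurable M"
  unfolding borel_measurable_euclidean_space[of A] Basis_vec_def using assms
  by (auto simp: inner_axis)

lemma borel_measurable_vec_entry [measurable (raw)]:
  fixes f :: "'a \<Rightarrow> 'b::second_countable_topology^'n"
  assumes "f \<in> borel_measurable M"
  shows "(\<lambda>z. f z $ i) \<in> borel_measurable M"
  by (rule borel_measurable_continuous_on[OF _ assms]) (intro continuous_intros)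

lemma norm_matrix_le_sum_entries:
  fixes A :: "real^'n^'m"
  shows "norm A \<le> (\<Sum>i\<in>UNIV. \<Sum>k\<in>UNIV. \<bar>A $ i $ k\<bar>)"
proof -
  have "norm A \<le> (\<Sum>i\<in>UNIV. norm (A $ i))" by (simp add: norm_vec_def L2_set_le_sum)
  also have "\<dots> \<le> (\<Sum>i\<in>UNIV. \<Sum>k\<in>UNIV. \<bar>A $ i $ k\<bar>)"
    by (intro sum_mono norm_le_l1_cart)
  finally show ?thesis .
qed

text \<open>The constant is the minimum of the quadratic form on the unit sphere, attained by
  compactness; homogeneity extends the bound to all vectors.\<close>

lemma pos_def_matrix_lower_bound:
  fixes \<Gamma> :: "real^'m^'m"
  assumes "pos_def_matrix \<Gamma>"
  obtains l where "l > 0" "\<And>x. l * (norm x)\<^sup>2 \<le> x \<bullet> (\<Gamma> *v x)"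
proof -
  have "continuous_on (sphere 0 1) (\<lambda>x::real^'m. x \<bullet> (\<Gamma> *v x))" by (intro continuous_intros)
  then obtain x0 where x0: "x0 \<in> sphere 0 1"
    and min: "\<And>x. x \<in> sphere 0 1 \<Longrightarrow> x0 \<bullet> (\<Gamma> *v x0) \<le> x \<bullet> (\<Gamma> *v x)"
    using continuous_attains_inf[OF compact_sphere, of 0 1 "\<lambda>x. x \<bullet> (\<Gamma> *v x)"] by auto
  show ?thesis
  proof
    have "x0 \<noteq> 0" using x0 by auto
    then show "x0 \<bullet> (\<Gamma> *v x0) > 0" using assms by (auto simp: pos_def_matrix_def)
    fix x :: "real^'m"
    show "x0 \<bullet> (\<Gamma> *v x0) * (norm x)\<^sup>2 \<le> x \<bullet> (\<Gamma> *v x)"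
    proof (cases "x = 0")
      case False
      let ?u = "x /\<^sub>R norm x"
      have "x0 \<bullet> (\<Gamma> *v x0) * (norm x)\<^sup>2 \<le> (?u \<bullet> (\<Gamma> *v ?u)) * (norm x)\<^sup>2"
        using False by (intro mult_right_mono min) auto
      also have "\<dots> = x \<bullet> (\<Gamma> *v x)"
        using False by (simp add: matrix_vector_mult_scaleR power2_eq_square field_simps)
      finally show ?thesis .
    qed simp
  qed
qed

text \<open>Only the sign of the quadratic form is recorded, which is what coercivity of H C H^T +
  \<Gamma> rests on.\<close>

definition psd_matrix :: "real^'n^'n \<Rightarrow> bool" where
  "psd_matrix C \<longleftrightarrow> (\<forall>x. 0 \<le> x \<bullet> (C *v x))"

text \<open>A finite-dimensional Lax-Milgram argument: coercivity makes the kernel trivial, and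
  testing S x = z against x itself bounds the inverse by 1 / l. With S = H C H^T + \<Gamma> this
  bound is the same for all positive semidefinite C.\<close>

lemma matrix_inv_coercive:
  fixes S :: "real^'m^'m"
  assumes l: "l > 0" and S: "\<And>x. l * (norm x)\<^sup>2 \<le> x \<bullet> (S *v x)"
  shows "S ** matrix_inv S = mat 1" "matrix_inv S ** S = mat 1"
    "norm (matrix_inv S *v z) \<le> norm z / l"
proof -
  have "x = 0" if "S *v x = 0" for x
    using S[of x] l that by (simp add: mult_le_0_iff)
  then have "invertible S"
    by (simp add: invertible_left_inverse matrix_left_invertible_ker)
  then show inv: "S ** matrix_inv S = mat 1" "matrix_inv S ** S = mat 1"
    by (auto simp: matrix_inv_def invertible_def intro: someI2_ex)
  let ?x = "matrix_inv S *v z"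
  have "S *v ?x = z" by (simp add: matrix_vector_mul_assoc inv)
  then have "l * (norm ?x)\<^sup>2 \<le> ?x \<bullet> z" using S[of ?x] by simp
  also have "\<dots> \<le> norm ?x * norm z" by (rule norm_cauchy_schwarz)
  finally have "norm ?x * (l * norm ?x) \<le> norm ?x * norm z"
    by (simp add: power2_eq_square mult_ac)
  then have "l * norm ?x \<le> norm z" by (cases "?x = 0") auto
  then show "norm ?x \<le> norm z / l" using l by (simp add: field_simps)
qed

locale gain_bounds =
  fixes H :: "real^'d^'m" and \<Gamma> :: "real^'m^'m" and l :: real
  assumes l: "l > 0" and \<Gamma>: "\<And>x. l * (norm x)\<^sup>2 \<le> x \<bullet> (\<Gamma> *v x)"
begin

lemma innovation_covariance_coercive:
  assumes "psd_matrix C"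
  shows "l * (norm x)\<^sup>2 \<le> x \<bullet> ((H ** C ** transpose H + \<Gamma>) *v x)"
proof -
  have "x \<bullet> ((H ** C ** transpose H) *v x) = (transpose H *v x) \<bullet> (C *v (transpose H *v x))"
    by (simp only: matrix_vector_mul_assoc[symmetric] dot_lmul_matrix[symmetric] transpose_matrix_vector)
  then have "0 \<le> x \<bullet> ((H ** C ** transpose H) *v x)"
    using assms by (simp add: psd_matrix_def)
  then show ?thesis using \<Gamma>[of x] by (simp add: matrix_vector_mult_add_rdistrib inner_add_right)
qed

lemma kalman_gain_mult:
  "kalman_gain H \<Gamma> C *v z
     = C *v (transpose H *v (matrix_inv (H ** C ** transpose H + \<Gamma>) *v z))"
  by (simp add: kalman_gain_def matrix_vector_mul_assoc matrix_mul_assoc)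

lemma norm_transpose_matrix_inv_le:
  assumes "psd_matrix C"
  shows "norm (transpose H *v (matrix_inv (H ** C ** transpose H + \<Gamma>) *v z))
    \<le> norm (transpose H) * (norm z / l)"
  using norm_matrix_vector_mult_le matrix_inv_coercive(3)[OF l innovation_covariance_coercive[OF assms]]
  by (meson mult_left_mono norm_ge_zero order_trans)

lemma norm_kalman_gain_mult_le:
  assumes "psd_matrix C"
  shows "norm (kalman_gain H \<Gamma> C *v z) \<le> norm C * (norm (transpose H) * (norm z / l))"
  unfolding kalman_gain_mult using norm_matrix_vector_mult_le norm_transpose_matrix_inv_le[OF assms]
  by (meson mult_left_mono norm_ge_zero order_trans)

text \<open>The resolvent identity
  \<open>inv S_C - inv S_D = - inv S_D H (C - D) H^T inv S_C\<close> reduces the difference of the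
  gains to C - D. The Lipschitz factor involves the norm of \<open>D\<close> only. In the
  application \<open>D\<close> is the mean-field covariance, whose moments are under control, and
  \<open>C\<close> is the sample covariance.\<close>

lemma norm_kalman_gain_diff_mult_le:
  assumes C: "psd_matrix C" and D: "psd_matrix D"
  shows "norm (kalman_gain H \<Gamma> C *v z - kalman_gain H \<Gamma> D *v z)
    \<le> norm (C - D) * (norm (transpose H) / l * (1 + norm D * norm (transpose H) / l * norm H)) * norm z"
proof -
  let ?T = "transpose H"
  define S where "S C = H ** C ** ?T + \<Gamma>" for C
  have co: "l * (norm x)\<^sup>2 \<le> x \<bullet> (S C *v x)" if "psd_matrix C" for C x
    using innovation_covariance_coercive[OF that] by (simp add: S_def)
  define u where "u = ?T *v (matrix_inv (S C) *v z)"
  have u: "norm u \<le> norm ?T * (norm z / l)"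
    unfolding u_def S_def by (rule norm_transpose_matrix_inv_le[OF C])
  have res: "matrix_inv (S C) *v z - matrix_inv (S D) *v z
      = - (matrix_inv (S D) *v (H *v ((C - D) *v u)))"
  proof -
    have "H *v ((C - D) *v u) = (S C - S D) *v (matrix_inv (S C) *v z)"
      by (simp add: S_def u_def matrix_vector_mult_diff_rdistrib matrix_vector_mult_diff_distrib
          matrix_vector_mult_add_rdistrib matrix_vector_mul_assoc[symmetric] del: matrix_vector_mul_assoc)
    also have "\<dots> = S C *v (matrix_inv (S C) *v z) - S D *v (matrix_inv (S C) *v z)"
      by (rule matrix_vector_mult_diff_rdistrib)
    also have "S C *v (matrix_inv (S C) *v z) = z"
      using matrix_inv_coercive(1)[OF l co[OF C]] by (simp add: matrix_vector_mul_assoc)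
    finally show ?thesis using matrix_inv_coercive(2)[OF l co[OF D]]
      by (simp add: matrix_vector_mult_diff_distrib matrix_vector_mul_assoc matrix_mul_assoc)
  qed
  have "kalman_gain H \<Gamma> C *v z - kalman_gain H \<Gamma> D *v z
      = (C - D) *v u + D *v (?T *v (matrix_inv (S C) *v z - matrix_inv (S D) *v z))"
    by (simp add: kalman_gain_mult u_def S_def matrix_vector_mult_diff_distrib matrix_vector_mult_diff_rdistrib)
  \<comment> \<open>The product of \<open>D\<close>, the transpose of \<open>H\<close> and the
    inverse of \<open>S D\<close> is the gain at \<open>D\<close>, so the bound for a single gain
    applies to the second term.\<close>
  also have "\<dots> = (C - D) *v u - D *v (?T *v (matrix_inv (S D) *v (H *v ((C - D) *v u))))"
    unfolding res by (simp add: linear_neg[OF matrix_vector_mul_linear])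
  also have "norm \<dots> \<le> norm ((C - D) *v u) + norm (kalman_gain H \<Gamma> D *v (H *v ((C - D) *v u)))"
    unfolding kalman_gain_mult S_def by (rule norm_triangle_ineq4)
  also have "\<dots> \<le> norm ((C - D) *v u)
      + norm D * (norm ?T * (norm H * norm ((C - D) *v u) / l))"
    using l by (intro add_left_mono order_trans[OF norm_kalman_gain_mult_le[OF D]] mult_left_mono
        divide_right_mono norm_matrix_vector_mult_le) auto
  also have "\<dots> = (1 + norm D * norm ?T / l * norm H) * norm ((C - D) *v u)"
    by (simp add: algebra_simps)
  also have "\<dots> \<le> (1 + norm D * norm ?T / l * norm H) * (norm (C - D) * (norm ?T * (norm z / l)))"
    using l u by (intro mult_left_mono order_trans[OF norm_matrix_vector_mult_le]) auto
  finally show ?thesis by (simp add: mult_ac)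
qed

lemma abs_entry_le_norm_column:
  fixes A :: "real^'n^'k"
  shows "\<bar>A $ i $ k\<bar> \<le> norm (A *v axis k 1)"
  using component_le_norm_cart[of "A *v axis k 1" i]
  by (simp add: matrix_vector_mult_basis column_def)

lemma abs_kalman_gain_entry_le:
  assumes "psd_matrix C"
  shows "\<bar>kalman_gain H \<Gamma> C $ i $ k\<bar> \<le> norm C * (norm (transpose H) / l)"
  using order_trans[OF abs_entry_le_norm_column norm_kalman_gain_mult_le[OF assms]] by simp

lemma abs_kalman_gain_entry_diff_le:
  assumes "psd_matrix C" "psd_matrix D"
  shows "\<bar>kalman_gain H \<Gamma> C $ i $ k - kalman_gain H \<Gamma> D $ i $ k\<bar>
    \<le> norm (C - D) * (norm (transpose H) / l * (1 + norm D * norm (transpose H) / l * norm H))"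
  using order_trans[OF abs_entry_le_norm_column
      norm_kalman_gain_diff_mult_le[OF assms, of "axis k 1", folded matrix_vector_mult_diff_rdistrib]]
  by simp

text \<open>Continuity is the route to measurability of the gain of a random covariance. It is
  restricted to positive semidefinite matrices because elsewhere the innovation covariance may be
  singular, and \<open>matrix_inv\<close> is then an arbitrary choice.\<close>

lemma continuous_on_kalman_gain_entry:
  "continuous_on {C. psd_matrix C} (\<lambda>C. kalman_gain H \<Gamma> C $ i $ k)"
  unfolding continuous_on
proof
  fix D :: "real^'d^'d" assume D: "D \<in> {C. psd_matrix C}"
  let ?c = "norm (transpose H) / l * (1 + norm D * norm (transpose H) / l * norm H)"
  show "((\<lambda>C. kalman_gain H \<Gamma> C $ i $ k) \<longlongrightarrow> kalman_gain H \<Gamma> D $ i $ k) (at D within {C. psd_matrix C})"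
  proof (rule Lim_null_comparison[THEN LIM_zero_cancel])
    show "\<forall>\<^sub>F C in at D within {C. psd_matrix C}.
        norm (kalman_gain H \<Gamma> C $ i $ k - kalman_gain H \<Gamma> D $ i $ k) \<le> norm (C - D) * ?c"
      using abs_kalman_gain_entry_diff_le D by (auto simp: eventually_at_filter)
    have "((\<lambda>C. norm (C - D) * ?c) \<longlongrightarrow> norm (D - D) * ?c) (at D within {C. psd_matrix C})"
      by (intro tendsto_intros)
    then show "((\<lambda>C. norm (C - D) * ?c) \<longlongrightarrow> 0) (at D within {C. psd_matrix C})" by simp
  qed
qed

lemma borel_measurable_kalman_gain:
  assumes "C \<in> borel_measurable M" "\<And>z. z \<in> space M \<Longrightarrow> psd_matrix (C z)"
  shows "(\<lambda>z. kalman_gain H \<Gamma> (C z)) \<in> borel_measurable M"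
proof (rule borel_measurable_matrix_entries)
  fix i k
  have "C \<in> measurable M (restrict_space borel {C. psd_matrix C})"
    using assms by (intro measurable_restrict_space2) auto
  then show "(\<lambda>z. kalman_gain H \<Gamma> (C z) $ i $ k) \<in> borel_measurable M"
    by (rule measurable_compose)
      (rule borel_measurable_continuous_on_restrict[OF continuous_on_kalman_gain_entry])
qed

end

section \<open>Covariances and Gaussian moments\<close>

lemma outer_product_mult: "(a \<otimes>\<^sub>o b) *v x = (b \<bullet> x) *\<^sub>R a"
  by (simp add: vec_eq_iff outer_product_def matrix_vector_mult_def inner_vec_def sum_distrib_left mult_ac)

lemma psd_outer_product: "psd_matrix (a \<otimes>\<^sub>o a)"
  by (simp add: psd_matrix_def outer_product_mult inner_commute[of _ a])

lemma bounded_linear_quadratic_form: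
  "bounded_linear (\<lambda>A::real^'n^'n. x \<bullet> (A *v x))"
proof (rule linear_conv_bounded_linear[THEN iffD1], rule linearI)
qed (simp_all add: matrix_vector_mult_add_rdistrib inner_add_right scaleR_matrix_vector_assoc[symmetric])

text \<open>Without second moments the covariance is the junk value \<open>0\<close>, which is still positive
  semidefinite.\<close>

lemma psd_covariance_of: "psd_matrix (covariance_of M v)"
  unfolding psd_matrix_def
proof
  fix x
  let ?f = "\<lambda>\<omega>. (v \<omega> - mean_of M v) \<otimes>\<^sub>o (v \<omega> - mean_of M v)"
  show "0 \<le> x \<bullet> (covariance_of M v *v x)"
  proof (cases "integrable M ?f")
    case True
    have "x \<bullet> (covariance_of M v *v x) = (\<integral>\<omega>. x \<bullet> (?f \<omega> *v x) \<partial>M)"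
      unfolding covariance_of_def
      using integral_bounded_linear[OF bounded_linear_quadratic_form True] by simp
    also have "\<dots> \<ge> 0"
      using psd_outer_product unfolding psd_matrix_def
      by (intro Bochner_Integration.integral_nonneg_AE AE_I2) blast
    finally show ?thesis .
  next
    case False
    then show ?thesis by (simp add: covariance_of_def not_integrable_integral_eq)
  qed
qed

lemma psd_ensemble_covariance: "psd_matrix (ensemble_covariance N v)"
  unfolding psd_matrix_def
proof
  fix x
  interpret bounded_linear "\<lambda>A::real^'a^'a. x \<bullet> (A *v x)" by (rule bounded_linear_quadratic_form)
  have "x \<bullet> (ensemble_covariance N v *v x) = (1 / N) * (\<Sum>n<N. x \<bullet>
      (((v n - ensemble_mean N v) \<otimes>\<^sub>o (v n - ensemble_mean N v)) *v x))"
    by (simp only: ensemble_covariance_def scaleR sum real_scaleR_def)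
  also have "\<dots> \<ge> 0"
    using psd_outer_product by (intro mult_nonneg_nonneg sum_nonneg) (auto simp: psd_matrix_def)
  finally show "0 \<le> x \<bullet> (ensemble_covariance N v *v x)" .
qed

text \<open>Expanding the centering turns the entry into a polynomial in ensemble averages, the form
  to which the congruence rules for closeness apply.\<close>

lemma ensemble_covariance_entry:
  assumes "N > 0"
  shows "ensemble_covariance N v $ i $ k =
    (\<Sum>n<N. v n $ i * v n $ k) / N - (\<Sum>n<N. v n $ i) / N * ((\<Sum>n<N. v n $ k) / N)"
proof -
  define a where "a = (\<Sum>n<N. v n $ i) / N"
  define b where "b = (\<Sum>n<N. v n $ k) / N"
  have "ensemble_covariance N v $ i $ k = (\<Sum>n<N. (v n $ i - a) * (v n $ k - b)) / N"
    by (simp add: ensemble_covariance_def ensemble_mean_def outer_product_def a_def b_def)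
  also have "(\<Sum>n<N. (v n $ i - a) * (v n $ k - b))
      = (\<Sum>n<N. v n $ i * v n $ k) - a * (\<Sum>n<N. v n $ k) - (\<Sum>n<N. v n $ i) * b + N * (a * b)"
    by (simp add: algebra_simps sum.distrib sum_subtractf sum_distrib_left sum_distrib_right)
  also have "\<dots> = (\<Sum>n<N. v n $ i * v n $ k) - N * (a * b)"
    using assms by (simp add: a_def b_def field_simps)
  finally show ?thesis using assms by (simp add: a_def b_def diff_divide_distrib)
qed

lemma integrable_matrix_entries:
  fixes A :: "'w \<Rightarrow> real^'n^'m"
  assumes "\<And>i k. integrable M (\<lambda>\<omega>. A \<omega> $ i $ k)"
  shows "integrable M A"
proof (rule Bochner_Integration.integrable_bound)
  show "integrable M (\<lambda>\<omega>. \<Sum>i\<in>UNIV. \<Sum>k\<in>UNIV. \<bar>A \<omega> $ i $ k\<bar>)" using assms by simp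
  show "A \<in> borel_measurable M"
    using assms by (intro borel_measurable_matrix_entries) (auto dest: borel_measurable_integrable)
  show "AE \<omega> in M. norm (A \<omega>) \<le> norm (\<Sum>i\<in>UNIV. \<Sum>k\<in>UNIV. \<bar>A \<omega> $ i $ k\<bar>)"
    by (intro AE_I2 order_trans[OF norm_matrix_le_sum_entries]) simp
qed

lemma integral_vec_entry:
  fixes f :: "'w \<Rightarrow> 'b::euclidean_space^'n"
  assumes "integrable M f"
  shows "integral\<^sup>L M f $ i = (\<integral>\<omega>. f \<omega> $ i \<partial>M)"
  using integral_bounded_linear[OF bounded_linear_vec_nth assms] by simp

lemma integrable_vec_entries:
  fixes v :: "'w \<Rightarrow> real^'n"
  assumes "\<And>i. integrable M (\<lambda>\<omega>. v \<omega> $ i)"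
  shows "integrable M v"
proof (rule Bochner_Integration.integrable_bound)
  show "integrable M (\<lambda>\<omega>. \<Sum>i\<in>UNIV. \<bar>v \<omega> $ i\<bar>)" using assms by simp
  show "v \<in> borel_measurable M"
    unfolding borel_measurable_euclidean_space[of v] Basis_vec_def
    using assms by (auto simp: inner_axis)
  show "AE \<omega> in M. norm (v \<omega>) \<le> norm (\<Sum>i\<in>UNIV. \<bar>v \<omega> $ i\<bar>)"
    by (intro AE_I2 order_trans[OF norm_le_l1_cart]) simp
qed

lemma (in prob_space) integrable_of_square:
  fixes X :: "'a \<Rightarrow> real"
  assumes "random_variable borel X" "integrable M (\<lambda>\<omega>. (X \<omega>)\<^sup>2)"
  shows "integrable M X"
proof (rule Bochner_Integration.integrable_bound)
  show "integrable M (\<lambda>\<omega>. 1 + (X \<omega>)\<^sup>2)" using assms by simp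
  have "\<bar>x\<bar> \<le> 1 + x\<^sup>2" for x :: real
  proof -
    have "2 * \<bar>x\<bar> \<le> x\<^sup>2 + 1" using sum_squares_bound[of "\<bar>x\<bar>" 1] by simp
    then show ?thesis using zero_le_power2[of x] by linarith
  qed
  then show "AE \<omega> in M. norm (X \<omega>) \<le> norm (1 + (X \<omega>)\<^sup>2)" by auto
qed (use assms in simp)

lemma integrable_mult_of_squares:
  fixes X Y :: "'a \<Rightarrow> real"
  assumes "X \<in> borel_measurable M" "Y \<in> borel_measurable M"
    and "integrable M (\<lambda>\<omega>. (X \<omega>)\<^sup>2)" "integrable M (\<lambda>\<omega>. (Y \<omega>)\<^sup>2)"
  shows "integrable M (\<lambda>\<omega>. X \<omega> * Y \<omega>)"
proof (rule Bochner_Integration.integrable_bound)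
  show "integrable M (\<lambda>\<omega>. (X \<omega>)\<^sup>2 + (Y \<omega>)\<^sup>2)" using assms by simp
  have "norm (x * y) \<le> norm (x\<^sup>2 + y\<^sup>2)" for x y :: real
  proof -
    have "2 * (\<bar>x\<bar> * \<bar>y\<bar>) \<le> x\<^sup>2 + y\<^sup>2" using sum_squares_bound[of "\<bar>x\<bar>" "\<bar>y\<bar>"] by simp
    moreover have "0 \<le> \<bar>x\<bar> * \<bar>y\<bar>" by simp
    ultimately show ?thesis unfolding real_norm_def abs_mult by linarith
  qed
  then show "AE \<omega> in M. norm (X \<omega> * Y \<omega>) \<le> norm ((X \<omega>)\<^sup>2 + (Y \<omega>)\<^sup>2)" by (intro AE_I2)
qed (use assms in simp)

text \<open>Square integrability of all entries makes the matrix-valued Bochner integral genuine, so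
  that it may be taken entry by entry; without integrability it would take the default value
  0.\<close>

lemma (in prob_space) covariance_of_entry:
  fixes v :: "'a \<Rightarrow> real^'d"
  assumes [measurable]: "random_variable borel v"
    and sq: "\<And>i. integrable M (\<lambda>\<omega>. (v \<omega> $ i)\<^sup>2)"
  shows "covariance_of M v $ i $ k =
    expectation (\<lambda>\<omega>. v \<omega> $ i * v \<omega> $ k) - expectation (\<lambda>\<omega>. v \<omega> $ i) * expectation (\<lambda>\<omega>. v \<omega> $ k)"
proof -
  let ?m = "mean_of M v"
  have int1: "integrable M (\<lambda>\<omega>. v \<omega> $ i)" for i
    by (rule integrable_of_square[OF _ sq]) measurable
  have int2: "integrable M (\<lambda>\<omega>. v \<omega> $ i * v \<omega> $ k)" for i k
    by (rule integrable_mult_of_squares[OF _ _ sq sq]; measurable)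
  have m: "?m $ i = expectation (\<lambda>\<omega>. v \<omega> $ i)" for i
    unfolding mean_of_def by (intro integral_vec_entry integrable_vec_entries int1)
  have e: "((v \<omega> - ?m) \<otimes>\<^sub>o (v \<omega> - ?m)) $ i $ k
      = v \<omega> $ i * v \<omega> $ k - ?m $ i * v \<omega> $ k - ?m $ k * v \<omega> $ i + ?m $ i * ?m $ k" for \<omega> i k
    by (simp add: outer_product_def algebra_simps)
  have int: "integrable M (\<lambda>\<omega>. ((v \<omega> - ?m) \<otimes>\<^sub>o (v \<omega> - ?m)) $ i $ k)" for i k
    unfolding e using int1 int2 by simp
  have "covariance_of M v $ i $ k = expectation (\<lambda>\<omega>. ((v \<omega> - ?m) \<otimes>\<^sub>o (v \<omega> - ?m)) $ i $ k)"
    unfolding covariance_of_def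
    by (simp add: integral_vec_entry integrable_matrix_entries int integrable_vec_entries)
  also have "\<dots> = expectation (\<lambda>\<omega>. v \<omega> $ i * v \<omega> $ k) - ?m $ i * ?m $ k"
    unfolding e using int1 int2 by (simp add: m prob_space)
  finally show ?thesis by (simp add: m)
qed

section \<open>Moments of the Gaussian noise\<close>

lemma matrix_inv_quadratic_form_lower_bound:
  fixes \<Gamma> :: "real^'m^'m"
  assumes "pos_def_matrix \<Gamma>"
  obtains q where "q > 0" "\<And>x. q * (norm x)\<^sup>2 \<le> x \<bullet> (matrix_inv \<Gamma> *v x)"
proof -
  obtain l where l: "l > 0" "\<And>x. l * (norm x)\<^sup>2 \<le> x \<bullet> (\<Gamma> *v x)"
    using pos_def_matrix_lower_bound[OF assms] by blast
  \<comment> \<open>Put z for the inverse of \<Gamma> applied to x. The form equals z . \<Gamma> z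
    \<ge> l |z|^2, while |x| \<le> g |z|; this gives the constant l / g^2. Adding 1 makes
    \<open>g\<close> positive at once.\<close>
  define g where "g = norm \<Gamma> + 1"
  have g: "g > 0" "norm \<Gamma> \<le> g" by (auto simp: g_def add_nonneg_pos)
  show ?thesis
  proof
    show "l / g\<^sup>2 > 0" using l g by simp
    fix x
    let ?z = "matrix_inv \<Gamma> *v x"
    have z: "\<Gamma> *v ?z = x" using matrix_inv_coercive(1)[OF l] by (simp add: matrix_vector_mul_assoc)
    have "norm x \<le> norm \<Gamma> * norm ?z" using norm_matrix_vector_mult_le[of \<Gamma> ?z] z by simp
    also have "\<dots> \<le> g * norm ?z" using g by (intro mult_right_mono) auto
    finally have "(norm x)\<^sup>2 \<le> (g * norm ?z)\<^sup>2" by (intro power_mono) auto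
    then have "l / g\<^sup>2 * (norm x)\<^sup>2 \<le> l / g\<^sup>2 * (g * norm ?z)\<^sup>2"
      using l g by (intro mult_left_mono) auto
    also have "\<dots> = l * (norm ?z)\<^sup>2" using g by (simp add: power_mult_distrib)
    also have "\<dots> \<le> ?z \<bullet> (\<Gamma> *v ?z)" by (rule l)
    finally show "l / g\<^sup>2 * (norm x)\<^sup>2 \<le> x \<bullet> ?z" by (simp add: z inner_commute)
  qed
qed

lemma nn_integral_exp_neg_square_finite:
  assumes "q > 0"
  shows "(\<integral>\<^sup>+x. ennreal (exp (- q * x\<^sup>2)) \<partial>(lborel :: real measure)) < \<infinity>"
proof -
  \<comment> \<open>The standard deviation for which exp(-q x^2) is a multiple of a normal
    density.\<close>
  define s where "s = sqrt (1 / (2 * q))"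
  have s: "s > 0" "s\<^sup>2 = 1 / (2 * q)" using assms by (auto simp: s_def)
  have e: "exp (- q * x\<^sup>2) = sqrt (2 * pi * s\<^sup>2) * normal_density 0 s x" for x
    using assms s by (simp add: normal_density_def field_simps)
  have "integrable lborel (\<lambda>x. exp (- q * x\<^sup>2))"
    unfolding e using s by (intro integrable_mult_right integrable_normal_density) auto
  then show ?thesis by (simp add: integrable_iff_bounded)
qed

lemma nn_integral_exp_neg_norm_square_finite:
  assumes "q > 0"
  shows "(\<integral>\<^sup>+x. ennreal (exp (- q * (norm x)\<^sup>2)) \<partial>(lborel :: 'a::euclidean_space measure)) < \<infinity>"
proof -
  have "ennreal (exp (- q * (norm x)\<^sup>2)) = (\<Prod>b\<in>Basis. ennreal (exp (- q * (x \<bullet> b)\<^sup>2)))" for x :: 'a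
  proof -
    have "(norm x)\<^sup>2 = (\<Sum>b\<in>Basis. (x \<bullet> b)\<^sup>2)"
      by (subst power2_norm_eq_inner, subst euclidean_inner) (simp add: power2_eq_square)
    then show ?thesis by (simp add: prod_ennreal sum_distrib_left exp_sum)
  qed
  then have "(\<integral>\<^sup>+x. ennreal (exp (- q * (norm x)\<^sup>2)) \<partial>(lborel :: 'a measure))
      = (\<Prod>b\<in>(Basis::'a set). (\<integral>\<^sup>+x. ennreal (exp (- q * x\<^sup>2)) \<partial>lborel))"
    by (simp only:) (rule nn_integral_lborel_prod; simp)
  also have "\<dots> < \<infinity>"
    using nn_integral_exp_neg_square_finite[OF assms] by (simp add: power_less_top_ennreal)
  finally show ?thesis .
qed

text \<open>With s = q |x|^2 / 4 the density decays at least like exp(-2s), and s^k \<le> k! exp(s)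
  absorbs the polynomial into half of that decay. The normalizing constant enters through the
  absolute value of its inverse, so neither its value nor its sign has to be determined.\<close>

lemma centered_gaussian_even_moment:
  fixes \<Gamma> :: "real^'m^'m"
  assumes "pos_def_matrix \<Gamma>"
  shows "(\<integral>\<^sup>+x. ennreal ((x $ i) ^ (2 * k)) \<partial>centered_gaussian \<Gamma>) < \<infinity>"
proof -
  obtain q where q: "q > 0" "\<And>x. q * (norm x)\<^sup>2 \<le> x \<bullet> (matrix_inv \<Gamma> *v x)"
    using matrix_inv_quadratic_form_lower_bound[OF assms] by blast
  define r where "r = sqrt ((2 * pi) ^ CARD('m) * det \<Gamma>)"
  define d where "d x = exp (- (x \<bullet> (matrix_inv \<Gamma> *v x)) / 2) / r" for x
  define c where "c = (4 / q) ^ k * fact k * \<bar>1 / r\<bar>"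
  have [measurable]: "d \<in> borel_measurable borel"
    unfolding d_def by measurable
  have bound: "\<bar>d x * (x $ i) ^ (2 * k)\<bar> \<le> c * exp (- (q / 4) * (norm x)\<^sup>2)" for x
  proof -
    let ?s = "q / 4 * (norm x)\<^sup>2"
    have "\<bar>(x $ i) ^ (2 * k)\<bar> = \<bar>x $ i\<bar> ^ (2 * k)" by (simp add: power_abs)
    also have "\<dots> \<le> norm x ^ (2 * k)" by (intro power_mono component_le_norm_cart) simp
    also have "\<dots> = (4 / q) ^ k * ?s ^ k" using q by (simp add: power_mult flip: power_mult_distrib)
    also have "\<dots> \<le> (4 / q) ^ k * (fact k * exp ?s)"
    proof (intro mult_left_mono)
      have "?s ^ k / fact k \<le> (\<Sum>n. ?s ^ n / fact n)"
        using q summable_exp[of ?s] by (intro sum_le_suminf[where I="{k}", simplified]) (auto simp: field_simps)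
      also have "\<dots> = exp ?s" by (simp add: exp_def field_simps)
      finally show "?s ^ k \<le> fact k * exp ?s" by (simp add: field_simps)
    qed (use q in auto)
    finally have x: "\<bar>(x $ i) ^ (2 * k)\<bar> \<le> (4 / q) ^ k * fact k * exp ?s" by (simp add: mult_ac)
    have "\<bar>d x\<bar> = \<bar>1 / r\<bar> * exp (- (x \<bullet> (matrix_inv \<Gamma> *v x)) / 2)"
      by (simp add: d_def abs_mult)
    also have "\<dots> \<le> \<bar>1 / r\<bar> * exp (- 2 * ?s)"
      using q(2)[of x] by (intro mult_left_mono) auto
    finally have "\<bar>d x\<bar> * \<bar>(x $ i) ^ (2 * k)\<bar>
        \<le> (\<bar>1 / r\<bar> * exp (- 2 * ?s)) * ((4 / q) ^ k * fact k * exp ?s)"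
      using x by (intro mult_mono) auto
    also have "\<dots> = c * (exp (- 2 * ?s) * exp ?s)" by (simp add: c_def mult_ac)
    also have "exp (- 2 * ?s) * exp ?s = exp (- (q / 4) * (norm x)\<^sup>2)" by (simp flip: exp_add)
    finally show ?thesis by (simp add: abs_mult)
  qed
  have "(\<integral>\<^sup>+x. ennreal ((x $ i) ^ (2 * k)) \<partial>centered_gaussian \<Gamma>)
      = (\<integral>\<^sup>+x. ennreal (d x) * ennreal ((x $ i) ^ (2 * k)) \<partial>lborel)"
    unfolding centered_gaussian_def d_def[symmetric] r_def[symmetric] by (intro nn_integral_density) measurable
  also have "\<dots> \<le> (\<integral>\<^sup>+x. ennreal c * ennreal (exp (- (q / 4) * (norm x)\<^sup>2)) \<partial>(lborel :: (real^'m) measure))"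
  proof (rule nn_integral_mono)
    fix x :: "real^'m"
    have "ennreal (d x) * ennreal ((x $ i) ^ (2 * k)) = ennreal (d x * (x $ i) ^ (2 * k))"
      by (simp add: ennreal_mult'' zero_le_even_power)
    also have "\<dots> \<le> ennreal (c * exp (- (q / 4) * (norm x)\<^sup>2))"
      using bound[of x] by (intro ennreal_leI) linarith
    also have "\<dots> = ennreal c * ennreal (exp (- (q / 4) * (norm x)\<^sup>2))"
      by (simp add: ennreal_mult'')
    finally show "ennreal (d x) * ennreal ((x $ i) ^ (2 * k))
      \<le> ennreal c * ennreal (exp (- (q / 4) * (norm x)\<^sup>2))" .
  qed
  also have "\<dots> = ennreal c * (\<integral>\<^sup>+x. ennreal (exp (- (q / 4) * (norm x)\<^sup>2)) \<partial>(lborel :: (real^'m) measure))"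
    by (intro nn_integral_cmult) measurable
  also have "\<dots> < \<infinity>"
    using nn_integral_exp_neg_norm_square_finite[where 'a="real^'m", of "q / 4"] q by (simp add: ennreal_mult_less_top)
  finally show ?thesis .
qed

section \<open>Independence of disjoint sets of noise sources\<close>

locale ensemble_kalman =
  fixes \<K> :: "real^'d \<Rightarrow> (real^'d) measure"
    and \<nu> :: "'x measure"
    and \<Phi> :: "real^'d \<Rightarrow> 'x \<Rightarrow> real^'d"
    and \<rho>\<^sub>0 :: "(real^'d) measure"
    and H :: "real^'d^'m"
    and \<Gamma> :: "real^'m^'m"
    and M :: "'w measure"
    and init :: "system \<Rightarrow> 'w \<Rightarrow> real^'d"
    and drive :: "system \<Rightarrow> nat \<Rightarrow> 'w \<Rightarrow> 'x"
    and gauss :: "system \<Rightarrow> nat \<Rightarrow> 'w \<Rightarrow> real^'m"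
  assumes pos_def: "pos_def_matrix \<Gamma>"
    and realization: "realizes_kernel \<K> \<nu> \<Phi>"
    and sources: "independent_sources M \<rho>\<^sub>0 \<nu> \<Gamma> init drive gauss"
    and lipschitz: "lipschitz_same_noise \<nu> \<Phi>"
    and growth: "moment_growth \<K>"
    and initial_moments: "\<And>p. p \<ge> 2 \<Longrightarrow> finite_moment p \<rho>\<^sub>0"

sublocale ensemble_kalman \<subseteq> prob_space M
  using sources by (simp add: independent_sources_def)

context ensemble_kalman
begin

lemma measurable_init [measurable]: "init p \<in> M \<rightarrow>\<^sub>M borel"
  and measurable_drive [measurable]: "drive p j \<in> M \<rightarrow>\<^sub>M \<nu>"
  and measurable_gauss [measurable]: "gauss p j \<in> M \<rightarrow>\<^sub>M borel"
  and distr_init: "distr M borel (init p) = \<rho>\<^sub>0"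
  and distr_drive: "distr M \<nu> (drive p j) = \<nu>"
  and distr_gauss: "distr M borel (gauss p j) = centered_gaussian \<Gamma>"
  using sources by (auto simp: independent_sources_def)

lemma measurable_realization: "(\<lambda>(a, x). \<Phi> a x) \<in> borel \<Otimes>\<^sub>M \<nu> \<rightarrow>\<^sub>M borel"
  using realization by (simp add: realizes_kernel_def)

lemma measurable_realization' [measurable (raw)]:
  "f \<in> L \<rightarrow>\<^sub>M borel \<Longrightarrow> g \<in> L \<rightarrow>\<^sub>M \<nu> \<Longrightarrow> (\<lambda>z. \<Phi> (f z) (g z)) \<in> L \<rightarrow>\<^sub>M borel"
  using measurable_compose[OF measurable_Pair measurable_realization] by simp

text \<open>Measurability with respect to \<open>sources_algebra A\<close> expresses that a quantity
  is a function of the sources in \<open>A\<close>. Only the sigma-algebra matters: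
  \<open>sigma\<close> carries the zero measure, and integrals are always taken with respect to
  \<open>M\<close>.\<close>

definition sources_algebra :: "source set \<Rightarrow> 'w measure" where
  "sources_algebra A = sigma (space M) (\<Union>s\<in>A. source_events M \<nu> init drive gauss s)"

lemma sets_vimage_algebra_subset:
  assumes "f \<in> M \<rightarrow>\<^sub>M N"
  shows "sets (vimage_algebra (space M) f N) \<subseteq> sets M"
proof -
  have "f \<in> space M \<rightarrow> space N" using assms by (auto dest: measurable_space)
  then show ?thesis using measurable_sets[OF assms] by (auto simp: sets_vimage_algebra2)
qed

lemma source_events_subset: "source_events M \<nu> init drive gauss s \<subseteq> sets M"
  using sets_vimage_algebra_subset[OF measurable_init] sets_vimage_algebra_subset[OF measurable_drive]
    sets_vimage_algebra_subset[OF measurable_gauss]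
  by (cases s) (simp_all add: source_events_def)

lemma Union_source_events_subset: "(\<Union>s\<in>A. source_events M \<nu> init drive gauss s) \<subseteq> Pow (space M)"
  using source_events_subset sets.space_closed by blast

lemma space_sources_algebra [simp]: "space (sources_algebra A) = space M"
  unfolding sources_algebra_def using Union_source_events_subset by (rule space_measure_of)

lemma sets_sources_algebra:
  "sets (sources_algebra A) = sigma_sets (space M) (\<Union>s\<in>A. source_events M \<nu> init drive gauss s)"
  unfolding sources_algebra_def using Union_source_events_subset by (rule sets_measure_of)

lemma sets_sources_algebra_subset: "sets (sources_algebra A) \<subseteq> sets M"
  unfolding sets_sources_algebra using source_events_subset by (intro sets.sigma_sets_subset) blast

lemma measurable_sources_algebra_id [measurable]: "(\<lambda>\<omega>. \<omega>) \<in> M \<rightarrow>\<^sub>M sources_algebra A"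
proof (rule measurableI)
  fix E assume "E \<in> sets (sources_algebra A)"
  then show "(\<lambda>\<omega>. \<omega>) -` E \<inter> space M \<in> sets M"
    using sets_sources_algebra_subset by (auto intro: sets.Int)
qed simp

lemma sets_sources_algebra_mono:
  "A \<subseteq> B \<Longrightarrow> sets (sources_algebra A) \<subseteq> sets (sources_algebra B)"
  unfolding sets_sources_algebra by (rule sigma_sets_mono') blast

lemma measurable_sources_algebra_mono:
  "A \<subseteq> B \<Longrightarrow> f \<in> sources_algebra A \<rightarrow>\<^sub>M N \<Longrightarrow> f \<in> sources_algebra B \<rightarrow>\<^sub>M N"
  using measurable_mono[of N N "sources_algebra A" "sources_algebra B"] sets_sources_algebra_mono
  by auto

lemma measurable_sources_algebraD: "f \<in> sources_algebra A \<rightarrow>\<^sub>M N \<Longrightarrow> f \<in> M \<rightarrow>\<^sub>M N"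
  by (rule measurable_compose[OF measurable_sources_algebra_id])

lemma measurable_pair_sources_algebra_mono:
  assumes "A \<subseteq> B" "f \<in> L \<Otimes>\<^sub>M sources_algebra A \<rightarrow>\<^sub>M N"
  shows "f \<in> L \<Otimes>\<^sub>M sources_algebra B \<rightarrow>\<^sub>M N"
proof -
  have "(\<lambda>z. (fst z, snd z)) \<in> L \<Otimes>\<^sub>M sources_algebra B \<rightarrow>\<^sub>M L \<Otimes>\<^sub>M sources_algebra A"
    by (intro measurable_Pair measurable_fst measurable_compose[OF measurable_snd]
        measurable_sources_algebra_mono[OF assms(1)] measurable_ident_sets refl)
  from measurable_compose[OF this assms(2)] show ?thesis by simp
qed

lemma measurable_pair_sources_algebra_mono_left:
  assumes "A \<subseteq> B" "f \<in> sources_algebra A \<Otimes>\<^sub>M L \<rightarrow>\<^sub>M N"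
  shows "f \<in> sources_algebra B \<Otimes>\<^sub>M L \<rightarrow>\<^sub>M N"
proof -
  have "(\<lambda>z. (fst z, snd z)) \<in> sources_algebra B \<Otimes>\<^sub>M L \<rightarrow>\<^sub>M sources_algebra A \<Otimes>\<^sub>M L"
    by (intro measurable_Pair measurable_snd measurable_compose[OF measurable_fst]
        measurable_sources_algebra_mono[OF assms(1)] measurable_ident_sets refl)
  from measurable_compose[OF this assms(2)] show ?thesis by simp
qed

lemma measurable_pair_sources_algebraD:
  assumes "f \<in> L \<Otimes>\<^sub>M sources_algebra A \<rightarrow>\<^sub>M N"
  shows "f \<in> L \<Otimes>\<^sub>M M \<rightarrow>\<^sub>M N"
proof -
  have "(\<lambda>z. (fst z, snd z)) \<in> L \<Otimes>\<^sub>M M \<rightarrow>\<^sub>M L \<Otimes>\<^sub>M sources_algebra A"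
    by (intro measurable_Pair measurable_fst measurable_compose[OF measurable_snd]
        measurable_sources_algebra_id)
  from measurable_compose[OF this assms] show ?thesis by simp
qed

lemma measurable_sources_algebra_diagonal:
  assumes "f \<in> sources_algebra A \<Otimes>\<^sub>M sources_algebra A \<rightarrow>\<^sub>M N"
  shows "(\<lambda>\<omega>. f (\<omega>, \<omega>)) \<in> sources_algebra A \<rightarrow>\<^sub>M N"
  by (rule measurable_compose[OF _ assms]) (intro measurable_Pair measurable_ident_sets refl)

lemma measurable_sources_algebra_source:
  assumes "s \<in> A" "sets (vimage_algebra (space M) f N) \<subseteq> source_events M \<nu> init drive gauss s"
    and "f \<in> M \<rightarrow>\<^sub>M N"
  shows "f \<in> sources_algebra A \<rightarrow>\<^sub>M N"
proof (rule measurableI)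
  fix E assume "E \<in> sets N"
  then have "f -` E \<inter> space M \<in> sets (vimage_algebra (space M) f N)" by (rule in_vimage_algebra)
  then show "f -` E \<inter> space (sources_algebra A) \<in> sets (sources_algebra A)"
    using assms(1,2) by (auto simp: sets_sources_algebra)
qed (use assms(3) measurable_space in auto)

lemma measurable_init_sources: "Init p \<in> A \<Longrightarrow> init p \<in> sources_algebra A \<rightarrow>\<^sub>M borel"
  and measurable_drive_sources: "Drive p j \<in> A \<Longrightarrow> drive p j \<in> sources_algebra A \<rightarrow>\<^sub>M \<nu>"
  and measurable_gauss_sources: "Gauss p j \<in> A \<Longrightarrow> gauss p j \<in> sources_algebra A \<rightarrow>\<^sub>M borel"
  by (erule measurable_sources_algebra_source; simp add: source_events_def)+

text \<open>The events of each source form an intersection-stable system, so independence passes to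
  the sigma-algebras generated by disjoint groups of sources, and from there to anything measurable
  with respect to them.\<close>

lemma indep_var_sources_algebra:
  assumes "A \<inter> B = {}" "f \<in> sources_algebra A \<rightarrow>\<^sub>M S" "g \<in> sources_algebra B \<rightarrow>\<^sub>M T"
  shows "indep_var S f T g"
proof -
  have ind: "indep_sets (source_events M \<nu> init drive gauss) UNIV"
    using sources by (simp add: independent_sources_def)
  have "indep_sets (\<lambda>b. sigma_sets (space M)
      (\<Union>s\<in>case_bool A B b. source_events M \<nu> init drive gauss s)) UNIV"
  proof (rule indep_sets_collect_sigma)
    show "indep_sets (source_events M \<nu> init drive gauss) (\<Union>b. case_bool A B b)"
      using ind by (rule indep_sets_mono_index[rotated]) simp
    show "Int_stable (source_events M \<nu> init drive gauss s)" for s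
      by (cases s) (auto simp: Int_stable_def source_events_def)
    show "disjoint_family (case_bool A B)"
      using assms(1) by (auto simp: disjoint_family_on_def split: bool.splits)
  qed
  then have "indep_sets (\<lambda>b. sets (sources_algebra (case_bool A B b))) UNIV"
    by (simp add: sets_sources_algebra)
  then have "indep_sets (case_bool (sigma_sets (space M) {f -` E \<inter> space M |E. E \<in> sets S})
      (sigma_sets (space M) {g -` E \<inter> space M |E. E \<in> sets T})) UNIV"
  proof (rule indep_sets_mono_sets)
    have *: "sigma_sets (space M) {h -` E \<inter> space M |E. E \<in> sets R} \<subseteq> sets (sources_algebra C)"
      if "h \<in> sources_algebra C \<rightarrow>\<^sub>M R" for h :: "'w \<Rightarrow> 'z" and C R
    proof -
      have "sigma_sets (space (sources_algebra C)) {h -` E \<inter> space M |E. E \<in> sets R}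
          \<subseteq> sets (sources_algebra C)"
        using measurable_sets[OF that] by (intro sets.sigma_sets_subset) auto
      then show ?thesis by simp
    qed
    show "case_bool (sigma_sets (space M) {f -` E \<inter> space M |E. E \<in> sets S})
        (sigma_sets (space M) {g -` E \<inter> space M |E. E \<in> sets T}) b
      \<subseteq> sets (sources_algebra (case_bool A B b))" for b
      using *[OF assms(2)] *[OF assms(3)] by (cases b) auto
  qed
  then show ?thesis
    using assms(2,3)[THEN measurable_sources_algebraD] by (simp add: indep_var_eq indep_set_def)
qed

text \<open>A pair of functions of disjoint sets of sources may be integrated as if the two occurrences
  of the sample point were independent.\<close>

lemma distr_diagonal_sources:
  assumes "A \<inter> B = {}"
  shows "distr M (sources_algebra A \<Otimes>\<^sub>M sources_algebra B) (\<lambda>\<omega>. (\<omega>, \<omega>))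
    = distr M (sources_algebra A) (\<lambda>\<omega>. \<omega>) \<Otimes>\<^sub>M distr M (sources_algebra B) (\<lambda>\<omega>. \<omega>)"
  using indep_var_sources_algebra[OF assms, of "\<lambda>\<omega>. \<omega>" _ "\<lambda>\<omega>. \<omega>"]
  by (simp add: indep_var_distribution_eq)

lemma distr_pair_sources:
  assumes "A \<inter> B = {}" and f: "f \<in> sources_algebra A \<rightarrow>\<^sub>M S" and g: "g \<in> sources_algebra B \<rightarrow>\<^sub>M T"
  shows "distr M (S \<Otimes>\<^sub>M T) (\<lambda>\<omega>. (f \<omega>, g \<omega>)) = distr M S f \<Otimes>\<^sub>M distr M T g"
proof -
  let ?A = "distr M (sources_algebra A) (\<lambda>\<omega>. \<omega>)" and ?B = "distr M (sources_algebra B) (\<lambda>\<omega>. \<omega>)"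
  note [measurable] = f g
  interpret B: prob_space "distr M T g" using g by (intro prob_space_distr measurable_sources_algebraD)
  have "distr M S f \<Otimes>\<^sub>M distr M T g = distr ?A S f \<Otimes>\<^sub>M distr ?B T g"
    by (simp add: distr_distr comp_def)
  also have "\<dots> = distr (?A \<Otimes>\<^sub>M ?B) (S \<Otimes>\<^sub>M T) (\<lambda>(x, y). (f x, g y))"
    by (rule pair_measure_distr) (simp_all add: distr_distr comp_def B.sigma_finite_measure_axioms)
  also have "\<dots> = distr M (S \<Otimes>\<^sub>M T) (\<lambda>\<omega>. (f \<omega>, g \<omega>))"
    unfolding distr_diagonal_sources[OF assms(1), symmetric] by (simp add: distr_distr comp_def)
  finally show ?thesis by simp
qed

lemma prob_space_distr_sources_algebra: "prob_space (distr M (sources_algebra A) (\<lambda>\<omega>. \<omega>))"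
  by (rule prob_space_distr) simp

text \<open>The inner integral, with the first argument frozen, is a version of the conditional
  expectation given the sources in \<open>A\<close>. In this way conditioning on the data becomes
  ordinary integration with the data held fixed.\<close>

lemma nn_integral_diagonal:
  assumes "A \<inter> B = {}" and h: "h \<in> borel_measurable (sources_algebra A \<Otimes>\<^sub>M sources_algebra B)"
  shows "(\<integral>\<^sup>+\<omega>. h (\<omega>, \<omega>) \<partial>M) = (\<integral>\<^sup>+\<omega>. \<integral>\<^sup>+\<omega>'. h (\<omega>, \<omega>') \<partial>M \<partial>M)"
proof -
  let ?A = "distr M (sources_algebra A) (\<lambda>\<omega>. \<omega>)" and ?B = "distr M (sources_algebra B) (\<lambda>\<omega>. \<omega>)"
  interpret B: prob_space ?B by (rule prob_space_distr_sources_algebra)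
  have [measurable_cong]: "sets ?A = sets (sources_algebra A)" "sets ?B = sets (sources_algebra B)" by simp_all
  note h [measurable]
  have "(\<integral>\<^sup>+\<omega>. h (\<omega>, \<omega>) \<partial>M) = (\<integral>\<^sup>+z. h z \<partial>(?A \<Otimes>\<^sub>M ?B))"
    unfolding distr_diagonal_sources[OF assms(1), symmetric] by (simp add: nn_integral_distr)
  also have "\<dots> = (\<integral>\<^sup>+\<omega>. \<integral>\<^sup>+\<omega>'. h (\<omega>, \<omega>') \<partial>?B \<partial>?A)"
    by (rule B.nn_integral_fst[symmetric]) measurable
  also have "\<dots> = (\<integral>\<^sup>+\<omega>. \<integral>\<^sup>+\<omega>'. h (\<omega>, \<omega>') \<partial>?B \<partial>M)"
    by (rule nn_integral_distr) measurable
  also have "\<dots> = (\<integral>\<^sup>+\<omega>. \<integral>\<^sup>+\<omega>'. h (\<omega>, \<omega>') \<partial>M \<partial>M)"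
    by (intro nn_integral_cong nn_integral_distr) auto
  finally show ?thesis .
qed

lemma integral_diagonal:
  fixes h :: "'w \<times> 'w \<Rightarrow> real"
  assumes "A \<inter> B = {}" and h: "h \<in> borel_measurable (sources_algebra A \<Otimes>\<^sub>M sources_algebra B)"
    and int: "integrable M (\<lambda>\<omega>. h (\<omega>, \<omega>))"
  shows "(\<integral>\<omega>. h (\<omega>, \<omega>) \<partial>M) = (\<integral>\<omega>. \<integral>\<omega>'. h (\<omega>, \<omega>') \<partial>M \<partial>M)"
proof -
  let ?A = "distr M (sources_algebra A) (\<lambda>\<omega>. \<omega>)" and ?B = "distr M (sources_algebra B) (\<lambda>\<omega>. \<omega>)"
  interpret A: prob_space ?A by (rule prob_space_distr_sources_algebra)
  interpret B: prob_space ?B by (rule prob_space_distr_sources_algebra)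
  interpret pair_sigma_finite ?A ?B ..
  have [measurable_cong]: "sets ?A = sets (sources_algebra A)" "sets ?B = sets (sources_algebra B)" by simp_all
  note h [measurable]
  have "integrable (?A \<Otimes>\<^sub>M ?B) h"
    unfolding distr_diagonal_sources[OF assms(1), symmetric] using int
    by (subst integrable_distr_eq) measurable
  then have "(\<integral>\<omega>. \<integral>\<omega>'. h (\<omega>, \<omega>') \<partial>?B \<partial>?A) = (\<integral>z. h z \<partial>(?A \<Otimes>\<^sub>M ?B))"
    by (rule integral_fst')
  also have "\<dots> = (\<integral>\<omega>. h (\<omega>, \<omega>) \<partial>M)"
    unfolding distr_diagonal_sources[OF assms(1), symmetric] by (rule integral_distr) measurable
  finally have "(\<integral>\<omega>. h (\<omega>, \<omega>) \<partial>M) = (\<integral>\<omega>. \<integral>\<omega>'. h (\<omega>, \<omega>') \<partial>?B \<partial>?A)" by simp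
  also have "\<dots> = (\<integral>\<omega>. \<integral>\<omega>'. h (\<omega>, \<omega>') \<partial>?B \<partial>M)"
    by (rule integral_distr) measurable
  also have "\<dots> = (\<integral>\<omega>. \<integral>\<omega>'. h (\<omega>, \<omega>') \<partial>M \<partial>M)"
    by (intro Bochner_Integration.integral_cong refl integral_distr) auto
  finally show ?thesis .
qed

lemma AE_diagonal:
  assumes "A \<inter> B = {}" and P: "Measurable.pred (sources_algebra A \<Otimes>\<^sub>M sources_algebra B) P"
    and ae: "\<And>\<omega>. \<omega> \<in> space M \<Longrightarrow> AE \<omega>' in M. P (\<omega>, \<omega>')"
  shows "AE \<omega> in M. P (\<omega>, \<omega>)"
proof -
  let ?h = "\<lambda>z. indicator {z. \<not> P z} z :: ennreal"
  note P [measurable]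
  have h: "?h \<in> borel_measurable (sources_algebra A \<Otimes>\<^sub>M sources_algebra B)" by measurable
  have "(\<integral>\<^sup>+\<omega>. ?h (\<omega>, \<omega>) \<partial>M) = (\<integral>\<^sup>+\<omega>. \<integral>\<^sup>+\<omega>'. ?h (\<omega>, \<omega>') \<partial>M \<partial>M)"
    by (rule nn_integral_diagonal[OF assms(1) h])
  also have "\<dots> = (\<integral>\<^sup>+\<omega>. 0 \<partial>M)"
  proof (intro nn_integral_cong)
    fix \<omega> assume "\<omega> \<in> space M"
    have "(\<integral>\<^sup>+\<omega>'. ?h (\<omega>, \<omega>') \<partial>M) = (\<integral>\<^sup>+\<omega>'. 0 \<partial>M)"
      by (rule nn_integral_cong_AE, use ae[OF \<open>\<omega> \<in> space M\<close>] in eventually_elim) simp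
    then show "(\<integral>\<^sup>+\<omega>'. ?h (\<omega>, \<omega>') \<partial>M) = 0" by simp
  qed
  finally have "(\<integral>\<^sup>+\<omega>. ?h (\<omega>, \<omega>) \<partial>M) = 0" by simp
  moreover have "(\<lambda>\<omega>. ?h (\<omega>, \<omega>)) \<in> borel_measurable M"
    by (rule measurable_compose[OF _ h]) measurable
  ultimately have "AE \<omega> in M. ?h (\<omega>, \<omega>) = 0" by (simp only: nn_integral_0_iff_AE)
  then show ?thesis by eventually_elim (auto simp: indicator_def split: if_splits)
qed

end

section \<open>The coupled mean-field process\<close>

lemma borel_measurable_outer_product [measurable (raw)]:
  fixes f :: "'a \<Rightarrow> real^'n"
  assumes [measurable]: "f \<in> borel_measurable M" "g \<in> borel_measurable M"
  shows "(\<lambda>z. f z \<otimes>\<^sub>o g z) \<in> borel_measurable M"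
  by (rule borel_measurable_matrix_entries) (simp add: outer_product_def)

lemma borel_measurable_analysis [measurable (raw)]:
  fixes G :: "'a \<Rightarrow> real^'m^'d"
  assumes [measurable]: "G \<in> borel_measurable M" "y \<in> borel_measurable M" "v \<in> borel_measurable M"
  shows "(\<lambda>z. analysis H (G z) (y z) (v z)) \<in> borel_measurable M"
  unfolding analysis_def
  by (simp add: matrix_vector_mult_diff_rdistrib flip: matrix_vector_mul_assoc)

text \<open>In innovation form each entry is a polynomial in the gain, the data, the perturbation
  and the forecast, as the congruence rules require.\<close>

lemma analysis_entry:
  "analysis H G y v $ i = v $ i + (\<Sum>k\<in>UNIV. G $ i $ k * (y $ k - (\<Sum>l\<in>UNIV. H $ k $ l * v $ l)))"
proof -
  have "analysis H G y v = v + G *v (y - H *v v)"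
    by (simp add: analysis_def matrix_vector_mult_diff_rdistrib matrix_vector_mult_diff_distrib
        flip: matrix_vector_mul_assoc)
  then show ?thesis by (simp add: matrix_vector_mult_def)
qed

lemma borel_measurable_ensemble_covariance:
  fixes v :: "'a \<Rightarrow> nat \<Rightarrow> real^'n"
  assumes [measurable]: "\<And>n. n < N \<Longrightarrow> (\<lambda>z. v z n) \<in> borel_measurable M"
  shows "(\<lambda>z. ensemble_covariance N (v z)) \<in> borel_measurable M"
  unfolding ensemble_covariance_def ensemble_mean_def by measurable

lemma covariance_of_cong_distr:
  fixes u v :: "'w \<Rightarrow> real^'d"
  assumes "u \<in> borel_measurable M" "v \<in> borel_measurable M"
    and "distr M borel u = distr M borel v"
  shows "covariance_of M u = covariance_of M v"
proof -
  have "covariance_of M v = covariance_of (distr M borel v) (\<lambda>x. x)"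
    if [measurable]: "v \<in> borel_measurable M" for v :: "'w \<Rightarrow> real^'d"
    unfolding covariance_of_def mean_of_def by (simp add: integral_distr)
  from this[OF assms(1)] this[OF assms(2)] assms(3) show ?thesis by simp
qed

context ensemble_kalman
begin

abbreviation observed :: "'w \<Rightarrow> nat \<Rightarrow> real^'m" where
  "observed \<equiv> observations H \<Phi> init drive gauss"

text \<open>The mean-field process run with the noises of the system \<open>p\<close>; for an ensemble member
  it is the coupled copy with which the member is compared.\<close>

definition mean_field :: "system \<Rightarrow> (nat \<Rightarrow> real^'m) \<Rightarrow> nat \<Rightarrow> 'w \<Rightarrow> real^'d" where
  "mean_field p = mfenkf M H \<Gamma> \<Phi> (\<lambda>_. init p) (\<lambda>_. drive p) (\<lambda>_. gauss p)"

definition mean_field_forecast :: "system \<Rightarrow> (nat \<Rightarrow> real^'m) \<Rightarrow> nat \<Rightarrow> 'w \<Rightarrow> real^'d" where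
  "mean_field_forecast p y j \<omega> = \<Phi> (mean_field p y j \<omega>) (drive p j \<omega>)"

definition mean_field_covariance :: "system \<Rightarrow> (nat \<Rightarrow> real^'m) \<Rightarrow> nat \<Rightarrow> real^'d^'d" where
  "mean_field_covariance p y j = covariance_of M (mean_field_forecast p y j)"

lemma mean_field_0: "mean_field p y 0 = init p"
  by (simp add: mean_field_def)

lemma mean_field_Suc: "mean_field p y (Suc j) = (\<lambda>\<omega>. analysis H
    (kalman_gain H \<Gamma> (mean_field_covariance p y j)) (y j + gauss p j \<omega>) (mean_field_forecast p y j \<omega>))"
  by (simp add: mean_field_def mean_field_forecast_def[abs_def] mean_field_covariance_def Let_def)

text \<open>The recursion reads only the \<open>MeanField\<close> slot of each noise. This is why
  filling all slots with the noises of \<open>p\<close>, as in \<open>mean_field\<close>, runs the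
  filter on the noises of \<open>p\<close>.\<close>

lemma mfenkf_eq_mean_field: "mfenkf M H \<Gamma> \<Phi> init drive gauss y j = mean_field MeanField y j"
  unfolding mean_field_def by (induction j) (simp_all add: Let_def)

definition own_sources :: "system \<Rightarrow> source set" where
  "own_sources p = {s. case s of Init q \<Rightarrow> q = p | Drive q i \<Rightarrow> q = p | Gauss q i \<Rightarrow> q = p}"

text \<open>All randomness available at time index \<open>j\<close>. Noises with index
  \<open>j\<close> belong to the step that follows, so they are independent of every state at time
  index \<open>j\<close>.\<close>

definition past_sources :: "nat \<Rightarrow> source set" where
  "past_sources j = {s. case s of Init q \<Rightarrow> True | Drive q i \<Rightarrow> i < j | Gauss q i \<Rightarrow> i < j}"

lemma own_sources_iff [simp]:
  "Init q \<in> own_sources p \<longleftrightarrow> q = p"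
  "Drive q i \<in> own_sources p \<longleftrightarrow> q = p"
  "Gauss q i \<in> own_sources p \<longleftrightarrow> q = p"
  by (simp_all add: own_sources_def)

lemma past_sources_iff [simp]:
  "Init q \<in> past_sources j"
  "Drive q i \<in> past_sources j \<longleftrightarrow> i < j"
  "Gauss q i \<in> past_sources j \<longleftrightarrow> i < j"
  by (simp_all add: past_sources_def)

lemma own_sources_disjoint: "p \<noteq> q \<Longrightarrow> own_sources p \<inter> own_sources q = {}"
proof (intro equals0I)
  fix s assume "p \<noteq> q" "s \<in> own_sources p \<inter> own_sources q"
  then show False by (cases s) auto
qed

lemma past_sources_mono: "i \<le> j \<Longrightarrow> past_sources i \<subseteq> past_sources j"
  by (auto simp: past_sources_def split: source.splits)

lemma ex_gain_bounds: obtains l where "gain_bounds \<Gamma> l"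
  using pos_def_matrix_lower_bound[OF pos_def] by (metis gain_bounds.intro)

lemma borel_measurable_kalman_gain [measurable (raw)]:
  assumes "C \<in> borel_measurable L" "\<And>z. z \<in> space L \<Longrightarrow> psd_matrix (C z)"
  shows "(\<lambda>z. kalman_gain H \<Gamma> (C z)) \<in> borel_measurable L"
  using gain_bounds.borel_measurable_kalman_gain[OF _ assms] ex_gain_bounds by metis

lemma borel_measurable_covariance_of:
  assumes [measurable]: "(\<lambda>(l, \<omega>). v l \<omega>) \<in> borel_measurable (L \<Otimes>\<^sub>M M)"
  shows "(\<lambda>l. covariance_of M (v l) :: real^'d^'d) \<in> borel_measurable L"
  unfolding covariance_of_def mean_of_def by measurable

text \<open>The parameter \<open>l\<close> supplies the data and \<omega> the noises of
  \<open>p\<close>. The gain depends on \<open>l\<close> alone, through an integral over \<omega>,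
  so each induction step uses measurability of parameter integrals. Joint measurability is what
  later permits both Fubini arguments and the insertion of random data.\<close>

lemma borel_measurable_mean_field_aux:
  assumes "\<And>i. i < j \<Longrightarrow> (\<lambda>l. Y l i) \<in> borel_measurable L"
  shows "(\<lambda>(l, \<omega>). mean_field p (Y l) j \<omega>)
    \<in> borel_measurable (L \<Otimes>\<^sub>M sources_algebra (own_sources p \<inter> past_sources j))"
  using assms
proof (induction j)
  case 0
  have "Init p \<in> own_sources p \<inter> past_sources 0" by simp_all
  from measurable_init_sources[OF this, measurable] show ?case by (simp add: mean_field_0)
next
  case (Suc j)
  let ?S = "sources_algebra (own_sources p \<inter> past_sources (Suc j))"
  have W: "(\<lambda>(l, \<omega>). mean_field p (Y l) j \<omega>)
      \<in> borel_measurable (L \<Otimes>\<^sub>M sources_algebra (own_sources p \<inter> past_sources j))"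
    using Suc by simp
  have [measurable]: "(\<lambda>z. mean_field p (Y (fst z)) j (snd z)) \<in> borel_measurable (L \<Otimes>\<^sub>M ?S)"
    using past_sources_mono[of j "Suc j"]
    by (intro measurable_pair_sources_algebra_mono[OF _ W, unfolded case_prod_beta']) auto
  have "Drive p j \<in> own_sources p \<inter> past_sources (Suc j)" "Gauss p j \<in> own_sources p \<inter> past_sources (Suc j)"
    by simp_all
  note [measurable] = measurable_drive_sources[OF this(1)] measurable_gauss_sources[OF this(2)]
  have forecast: "(\<lambda>z. mean_field_forecast p (Y (fst z)) j (snd z)) \<in> borel_measurable (L \<Otimes>\<^sub>M ?S)"
    unfolding mean_field_forecast_def by measurable
  note [measurable] = forecast
  have "(\<lambda>l. mean_field_covariance p (Y l) j) \<in> borel_measurable L"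
    unfolding mean_field_covariance_def
  proof (rule borel_measurable_covariance_of)
    show "(\<lambda>(l, \<omega>). mean_field_forecast p (Y l) j \<omega>) \<in> borel_measurable (L \<Otimes>\<^sub>M M)"
      using measurable_pair_sources_algebraD[OF forecast] by (simp add: case_prod_beta')
  qed
  then have [measurable]: "(\<lambda>l. kalman_gain H \<Gamma> (mean_field_covariance p (Y l) j)) \<in> borel_measurable L"
    by (rule borel_measurable_kalman_gain) (simp add: mean_field_covariance_def psd_covariance_of)
  have [measurable]: "(\<lambda>l. Y l j) \<in> borel_measurable L" using Suc by simp
  show ?case unfolding mean_field_Suc case_prod_beta' by measurable
qed

lemma borel_measurable_mean_field:
  assumes "\<And>i. i < j \<Longrightarrow> (\<lambda>l. Y l i) \<in> borel_measurable L"
    and "own_sources p \<inter> past_sources j \<subseteq> A"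
  shows "(\<lambda>(l, \<omega>). mean_field p (Y l) j \<omega>) \<in> borel_measurable (L \<Otimes>\<^sub>M sources_algebra A)"
  by (rule measurable_pair_sources_algebra_mono[OF assms(2) borel_measurable_mean_field_aux[OF assms(1)]])

lemma borel_measurable_mean_field_diagonal:
  assumes "\<And>i. i < j \<Longrightarrow> (\<lambda>l. Y l i) \<in> borel_measurable (sources_algebra A)"
    and "own_sources p \<inter> past_sources j \<subseteq> A"
  shows "(\<lambda>\<omega>. mean_field p (Y \<omega>) j \<omega>) \<in> borel_measurable (sources_algebra A)"
  using measurable_sources_algebra_diagonal[OF borel_measurable_mean_field[OF assms]] by simp

lemma borel_measurable_mean_field_fixed_data:
  "own_sources p \<inter> past_sources j \<subseteq> A \<Longrightarrow> mean_field p y j \<in> borel_measurable (sources_algebra A)"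
  using borel_measurable_mean_field_diagonal[of j "\<lambda>_. y"] by simp

lemma borel_measurable_mean_field_forecast:
  assumes "\<And>i. i < j \<Longrightarrow> (\<lambda>l. Y l i) \<in> borel_measurable L"
    and "own_sources p \<subseteq> A"
  shows "(\<lambda>(l, \<omega>). mean_field_forecast p (Y l) j \<omega>) \<in> borel_measurable (L \<Otimes>\<^sub>M sources_algebra A)"
proof -
  have [measurable]: "(\<lambda>z. mean_field p (Y (fst z)) j (snd z)) \<in> borel_measurable (L \<Otimes>\<^sub>M sources_algebra A)"
    using borel_measurable_mean_field[of j Y L p A] assms by (auto simp: case_prod_beta')
  have [measurable]: "drive p j \<in> sources_algebra A \<rightarrow>\<^sub>M \<nu>"
    using assms(2) by (intro measurable_drive_sources) auto
  show ?thesis unfolding mean_field_forecast_def case_prod_beta' by measurable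
qed

lemma mean_field_fixed_data_measurable [measurable]: "mean_field p y j \<in> borel_measurable M"
  using borel_measurable_mean_field_fixed_data[OF subset_UNIV] by (rule measurable_sources_algebraD)

lemma mean_field_forecast_fixed_data_measurable [measurable]:
  "mean_field_forecast p y j \<in> borel_measurable M"
  unfolding mean_field_forecast_def[abs_def] by measurable

text \<open>State, driving noise and perturbation at one time are functions of disjoint sets of
  sources, so the joint law is a product construction from the law of the state. The pair is
  considered because the analysis combines both of its components.\<close>

lemma distr_mean_field_forecast_eq:
  assumes "distr M borel (mean_field p y j) = distr M borel (mean_field q y j)"
  shows "distr M (borel \<Otimes>\<^sub>M borel) (\<lambda>\<omega>. (mean_field_forecast p y j \<omega>, gauss p j \<omega>))
    = distr M (borel \<Otimes>\<^sub>M borel) (\<lambda>\<omega>. (mean_field_forecast q y j \<omega>, gauss q j \<omega>))"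
proof -
  have "distr M (borel \<Otimes>\<^sub>M borel) (\<lambda>\<omega>. (mean_field_forecast p y j \<omega>, gauss p j \<omega>))
    = distr (distr M borel (mean_field p y j) \<Otimes>\<^sub>M \<nu>) borel (\<lambda>(a, x). \<Phi> a x) \<Otimes>\<^sub>M centered_gaussian \<Gamma>"
    (is "_ = ?R p") for p
  proof -
    let ?A = "own_sources p \<inter> past_sources j"
    let ?B = "insert (Drive p j) ?A"
    have d: "Drive p j \<notin> ?A" and g: "Gauss p j \<notin> ?B" by simp_all
    have [measurable]: "mean_field p y j \<in> borel_measurable (sources_algebra ?B)"
      by (rule borel_measurable_mean_field_fixed_data) blast
    note measurable_drive_sources[OF insertI1[of "Drive p j" ?A], measurable]
    have "mean_field_forecast p y j \<in> borel_measurable (sources_algebra ?B)"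
      unfolding mean_field_forecast_def[abs_def] by measurable
    then have 1: "distr M (borel \<Otimes>\<^sub>M borel) (\<lambda>\<omega>. (mean_field_forecast p y j \<omega>, gauss p j \<omega>))
        = distr M borel (mean_field_forecast p y j) \<Otimes>\<^sub>M centered_gaussian \<Gamma>"
      using g measurable_gauss_sources[of p j "{Gauss p j}"]
      by (subst distr_gauss[of p j, symmetric]) (intro distr_pair_sources[where A="?B" and B="{Gauss p j}"]; simp)
    have "distr M (borel \<Otimes>\<^sub>M \<nu>) (\<lambda>\<omega>. (mean_field p y j \<omega>, drive p j \<omega>))
        = distr M borel (mean_field p y j) \<Otimes>\<^sub>M distr M \<nu> (drive p j)"
      using d measurable_drive_sources[of p j "{Drive p j}"]
      by (intro distr_pair_sources[where A="?A" and B="{Drive p j}"]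
          borel_measurable_mean_field_fixed_data) auto
    then have "distr M borel (mean_field_forecast p y j)
        = distr (distr M borel (mean_field p y j) \<Otimes>\<^sub>M \<nu>) borel (\<lambda>(a, x). \<Phi> a x)"
      using distr_distr[OF measurable_realization, of "\<lambda>\<omega>. (mean_field p y j \<omega>, drive p j \<omega>)" M]
      by (simp add: comp_def mean_field_forecast_def[abs_def] distr_drive)
    with 1 show ?thesis by simp
  qed
  then show ?thesis using assms by simp
qed

text \<open>For the same data, equal forecast laws give equal covariances, hence the same gain, and
  the analysis then applies one and the same map to equal joint laws. Each coupled copy thus has the
  law of the mean-field filter.\<close>

lemma distr_mean_field_eq: "distr M borel (mean_field p y j) = distr M borel (mean_field q y j)"
proof (induction j)
  case 0
  then show ?case by (simp add: mean_field_0 distr_init)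
next
  case (Suc j)
  note joint = distr_mean_field_forecast_eq[OF Suc]
  have "distr M borel (mean_field_forecast p y j) = distr M borel (mean_field_forecast q y j)"
    using arg_cong[OF joint, of "\<lambda>m. distr m borel fst"] by (simp add: distr_distr comp_def)
  then have C: "mean_field_covariance p y j = mean_field_covariance q y j"
    unfolding mean_field_covariance_def by (intro covariance_of_cong_distr) measurable
  let ?f = "\<lambda>(v, e). analysis H (kalman_gain H \<Gamma> (mean_field_covariance q y j)) (y j + e) v"
  have f: "?f \<in> borel_measurable (borel \<Otimes>\<^sub>M borel)" unfolding case_prod_beta' by measurable
  have "distr M borel (mean_field r y (Suc j))
      = distr (distr M (borel \<Otimes>\<^sub>M borel) (\<lambda>\<omega>. (mean_field_forecast r y j \<omega>, gauss r j \<omega>))) borel ?f"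
    if "mean_field_covariance r y j = mean_field_covariance q y j" for r
  proof -
    have "mean_field r y (Suc j) = ?f \<circ> (\<lambda>\<omega>. (mean_field_forecast r y j \<omega>, gauss r j \<omega>))"
      using that by (simp add: mean_field_Suc comp_def)
    then show ?thesis by (simp add: distr_distr[OF f])
  qed
  from this[OF C] this[OF refl] joint show ?case by simp
qed

lemma distr_mean_field_forecast:
  "distr M borel (mean_field_forecast p y j) = distr M borel (mean_field_forecast q y j)"
  using arg_cong[OF distr_mean_field_forecast_eq[OF distr_mean_field_eq], of "\<lambda>m. distr m borel fst"]
  by (simp add: distr_distr comp_def)

lemma expectation_mean_field_eq:
  "f \<in> borel_measurable borel \<Longrightarrow>
    expectation (\<lambda>\<omega>. f (mean_field p y j \<omega>) :: real) = expectation (\<lambda>\<omega>. f (mean_field q y j \<omega>))"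
  using arg_cong[OF distr_mean_field_eq, of "\<lambda>m. integral\<^sup>L m f"] by (simp add: integral_distr)

lemma expectation_mean_field_forecast_eq:
  "f \<in> borel_measurable borel \<Longrightarrow> expectation (\<lambda>\<omega>. f (mean_field_forecast p y j \<omega>) :: real)
    = expectation (\<lambda>\<omega>. f (mean_field_forecast q y j \<omega>))"
  using arg_cong[OF distr_mean_field_forecast, of "\<lambda>m. integral\<^sup>L m f"] by (simp add: integral_distr)

lemma mean_field_covariance_eq: "mean_field_covariance p y j = mean_field_covariance q y j"
  unfolding mean_field_covariance_def
  by (intro covariance_of_cong_distr distr_mean_field_forecast) measurable

section \<open>One step of the kernel: Lipschitz and moment bounds\<close>

lemma lipschitz_drive_AE:
  obtains L where "L > 0"
    "\<And>A X X' p j. X \<in> borel_measurable (sources_algebra A) \<Longrightarrow> X' \<in> borel_measurable (sources_algebra A) \<Longrightarrow>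
      Drive p j \<notin> A \<Longrightarrow>
      AE \<omega> in M. norm (\<Phi> (X \<omega>) (drive p j \<omega>) - \<Phi> (X' \<omega>) (drive p j \<omega>)) \<le> L * norm (X \<omega> - X' \<omega>)"
proof -
  obtain L where L: "L > 0" "\<And>a b. AE x in \<nu>. norm (\<Phi> a x - \<Phi> b x) \<le> L * norm (a - b)"
    using lipschitz by (auto simp: lipschitz_same_noise_def)
  have "AE \<omega> in M. norm (\<Phi> (X \<omega>) (drive p j \<omega>) - \<Phi> (X' \<omega>) (drive p j \<omega>)) \<le> L * norm (X \<omega> - X' \<omega>)"
    if [measurable]: "X \<in> borel_measurable (sources_algebra A)" "X' \<in> borel_measurable (sources_algebra A)"
      and d: "Drive p j \<notin> A" for A X X' p j
  proof -
    let ?P = "\<lambda>(\<omega>, \<omega>'). norm (\<Phi> (X \<omega>) (drive p j \<omega>') - \<Phi> (X' \<omega>) (drive p j \<omega>')) \<le> L * norm (X \<omega> - X' \<omega>)"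
    note measurable_drive_sources[of p j "{Drive p j}", simplified, measurable]
    \<comment> \<open>The hypothesis gives a null set for each fixed pair of starting points. Random
      starting points are allowed because they are functions of sources other than this driving
      noise.\<close>
    have "AE \<omega> in M. ?P (\<omega>, \<omega>)"
    proof (rule AE_diagonal[of A "{Drive p j}"])
      show "Measurable.pred (sources_algebra A \<Otimes>\<^sub>M sources_algebra {Drive p j}) ?P"
        unfolding case_prod_beta' by measurable
      fix \<omega>
      show "AE \<omega>' in M. ?P (\<omega>, \<omega>')"
        using AE_distrD[OF measurable_drive[of p j], unfolded distr_drive, OF L(2)[of "X \<omega>" "X' \<omega>"]]
        by simp
    qed (use d in simp)
    then show ?thesis by simp
  qed
  with L(1) show ?thesis by (rule that)
qed

text \<open>A single finite moment serves as the bound for the whole family. Finiteness is asked for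
  k \<ge> 1, matching moment hypotheses of order p \<ge> 2; order 0 is the total mass.\<close>

lemma bounded_moments_identically_distributed:
  fixes v :: "nat \<Rightarrow> nat \<Rightarrow> 'w \<Rightarrow> real^'n"
  assumes v [measurable]: "\<And>N n. v N n \<in> borel_measurable M" and law: "\<And>N n. distr M borel (v N n) = \<mu>"
    and fin: "\<And>k. k \<ge> 1 \<Longrightarrow> (\<integral>\<^sup>+x. ennreal ((x $ i) ^ (2 * k)) \<partial>\<mu>) < \<infinity>"
  shows "bounded_moments (\<lambda>N n \<omega>. v N n \<omega> $ i)"
  unfolding bounded_moments_def
proof (intro conjI allI impI)
  fix k
  have "(\<integral>\<^sup>+x. ennreal ((x $ i) ^ (2 * k)) \<partial>\<mu>) < \<infinity>"
  proof (cases "k \<ge> 1")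
    case False
    have "prob_space \<mu>" using prob_space_distr[OF v] law by metis
    moreover have "k = 0" using False by simp
    ultimately show ?thesis by (simp add: prob_space.emeasure_space_1)
  qed (rule fin)
  moreover have "(\<integral>\<^sup>+\<omega>. ennreal ((v N n \<omega> $ i) ^ (2 * k)) \<partial>M) = (\<integral>\<^sup>+x. ennreal ((x $ i) ^ (2 * k)) \<partial>\<mu>)" for N n
    unfolding law[of N n, symmetric] by (simp add: nn_integral_distr)
  ultimately show "\<exists>c. \<forall>N n. n < N \<longrightarrow> (\<integral>\<^sup>+\<omega>. ennreal ((v N n \<omega> $ i) ^ (2 * k)) \<partial>M) \<le> ennreal c"
    by (metis ennreal_cases infinity_ennreal_def order_less_irrefl order_refl)
qed measurable

lemma finite_moment_entry:
  fixes \<mu> :: "(real^'n) measure"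
  assumes "finite_moment (real (2 * k)) \<mu>" "k \<ge> 1"
  shows "(\<integral>\<^sup>+x. ennreal ((x $ i) ^ (2 * k)) \<partial>\<mu>) < \<infinity>"
proof -
  have "(\<integral>\<^sup>+x. ennreal ((x $ i) ^ (2 * k)) \<partial>\<mu>) \<le> (\<integral>\<^sup>+x. ennreal (norm (norm x powr real (2 * k))) \<partial>\<mu>)"
  proof (intro nn_integral_mono ennreal_leI)
    fix x :: "real^'n"
    have "(x $ i) ^ (2 * k) \<le> norm x ^ (2 * k)"
      using component_le_norm_cart[of x i] by (intro even_power_mono) simp
    \<comment> \<open>At x = 0 this uses k \<ge> 1, since \<open>0 powr 0 = 0\<close> whereas
      \<open>0 ^ 0 = 1\<close>.\<close>
    also have "\<dots> = norm x powr real (2 * k)"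
      using assms(2) powr_realpow[of "norm x" "2 * k"] by (cases "x = 0") simp_all
    finally show "(x $ i) ^ (2 * k) \<le> norm (norm x powr real (2 * k))" by simp
  qed
  also have "\<dots> < \<infinity>" using assms(1) by (simp add: finite_moment_def integrable_iff_bounded)
  finally show ?thesis .
qed

lemma bounded_moments_init: "bounded_moments (\<lambda>N n \<omega>. init (p n) \<omega> $ i)"
proof (rule bounded_moments_identically_distributed[OF _ distr_init])
  show "(\<integral>\<^sup>+x. ennreal ((x $ i) ^ (2 * k)) \<partial>\<rho>\<^sub>0) < \<infinity>" if "k \<ge> 1" for k
    using that by (intro finite_moment_entry initial_moments) auto
qed simp

lemma bounded_moments_gauss: "bounded_moments (\<lambda>N n \<omega>. gauss (p n) j \<omega> $ i)"
  by (rule bounded_moments_identically_distributed[OF _ distr_gauss])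
    (rule measurable_gauss centered_gaussian_even_moment[OF pos_def])+

text \<open>The growth hypothesis is applied to the point mass at 0, all of whose moments vanish.
  The Lipschitz property will carry the result from the starting point 0 to random starting
  points.\<close>

lemma finite_moment_kernel:
  assumes "p \<ge> 2"
  shows "finite_moment p (distr \<nu> borel (\<Phi> 0))"
proof -
  interpret \<nu>: prob_space \<nu> using realization by (simp add: realizes_kernel_def)
  have K: "\<K> a = distr \<nu> borel (\<Phi> a)" for a using realization by (simp add: realizes_kernel_def)
  have [measurable]: "\<Phi> a \<in> \<nu> \<rightarrow>\<^sub>M borel" for a by measurable
  have "\<K> \<in> borel \<rightarrow>\<^sub>M subprob_algebra borel"
    unfolding K[abs_def]
    by (intro measurable_distr2[where M=\<nu>] measurable_realization measurable_const) 
      (auto simp: space_subprob_algebra \<nu>.prob_space_axioms prob_space_imp_subprob_space)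
  then have "return borel 0 \<bind> \<K> = \<K> 0" by (intro bind_return) auto
  moreover have "finite_moment p (return borel (0 :: real^'d))"
    unfolding finite_moment_def by (subst integrable_iff_bounded) (simp add: nn_integral_return)
  moreover have "prob_space (return borel (0 :: real^'d))" by (rule prob_space_return) simp
  ultimately show ?thesis using growth assms unfolding moment_growth_def by (metis K sets_return)
qed

text \<open>Comparison with the step that starts at 0 under the same noise: |\<Phi> X| \<le> |\<Phi>
  0| + L |X| almost surely. The bound is automatically uniform over the family, and it serves the
  signal as well as the copies.\<close>

lemma bounded_moments_kernel_step:
  assumes X: "\<And>N n. n < N \<Longrightarrow> X N n \<in> borel_measurable (sources_algebra A)"
    and "\<And>N n i. n < N \<Longrightarrow> Drive (p n) j \<notin> A"
    and bounded: "\<And>i. bounded_moments (\<lambda>N n \<omega>. X N n \<omega> $ i)"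
  shows "bounded_moments (\<lambda>N n \<omega>. \<Phi> (X N n \<omega>) (drive (p n) j \<omega>) $ i)"
proof -
  obtain L where L: "L > 0"
    "\<And>A X X' p j. X \<in> borel_measurable (sources_algebra A) \<Longrightarrow> X' \<in> borel_measurable (sources_algebra A) \<Longrightarrow>
      Drive p j \<notin> A \<Longrightarrow>
      AE \<omega> in M. norm (\<Phi> (X \<omega>) (drive p j \<omega>) - \<Phi> (X' \<omega>) (drive p j \<omega>)) \<le> L * norm (X \<omega> - X' \<omega>)"
    using lipschitz_drive_AE by blast
  have "distr M borel (\<lambda>\<omega>. \<Phi> 0 (drive p j \<omega>)) = distr \<nu> borel (\<Phi> 0)" for p
    using distr_distr[of "\<Phi> 0" \<nu> borel "drive p j" M] by (simp add: distr_drive comp_def)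
  then have 0: "bounded_moments (\<lambda>N n \<omega>. \<Phi> 0 (drive (p n) j \<omega>) $ i)" for i
  proof (rule bounded_moments_identically_distributed[rotated])
    show "(\<integral>\<^sup>+x. ennreal ((x $ i) ^ (2 * k)) \<partial>distr \<nu> borel (\<Phi> 0)) < \<infinity>" if "k \<ge> 1" for k
      using that by (intro finite_moment_entry finite_moment_kernel) auto
  qed measurable
  have "bounded_moments (\<lambda>N n \<omega>. \<bar>\<Phi> 0 (drive (p n) j \<omega>) $ i\<bar> + L * (\<Sum>i\<in>UNIV. \<bar>X N n \<omega> $ i\<bar>))"
    by (intro bounded_moments_add bounded_moments_mult bounded_moments_const bounded_moments_sum
        bounded_moments_abs 0 bounded)
  then show ?thesis
  proof (rule bounded_moments_mono_AE)
    fix N n :: nat assume n: "n < N"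
    note [measurable] = measurable_sources_algebraD[OF X[OF n]]
    show "random_variable borel (\<lambda>\<omega>. \<Phi> (X N n \<omega>) (drive (p n) j \<omega>) $ i)" by measurable
    have "AE \<omega> in M. norm (\<Phi> (X N n \<omega>) (drive (p n) j \<omega>) - \<Phi> 0 (drive (p n) j \<omega>)) \<le> L * norm (X N n \<omega> - 0)"
      using assms(2) n by (intro L(2)[of _ A "\<lambda>_. 0"] X) auto
    then show "AE \<omega> in M. \<bar>\<Phi> (X N n \<omega>) (drive (p n) j \<omega>) $ i\<bar>
        \<le> \<bar>\<bar>\<Phi> 0 (drive (p n) j \<omega>) $ i\<bar> + L * (\<Sum>i\<in>UNIV. \<bar>X N n \<omega> $ i\<bar>)\<bar>"
    proof eventually_elim
      case (elim \<omega>)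
      have "L * norm (X N n \<omega>) \<le> L * (\<Sum>i\<in>UNIV. \<bar>X N n \<omega> $ i\<bar>)"
        using L(1) by (intro mult_left_mono norm_le_l1_cart) auto
      then show ?case
        using elim component_le_norm_cart[of "\<Phi> (X N n \<omega>) (drive (p n) j \<omega>) - \<Phi> 0 (drive (p n) j \<omega>)" i]
        by simp
    qed
  qed
qed

end

section \<open>The conditional law of large numbers\<close>

context ensemble_kalman
begin

lemma conditional_mean_measurable:
  fixes \<phi> :: "'w \<Rightarrow> 'w \<Rightarrow> real"
  assumes "(\<lambda>(\<omega>', \<omega>). \<phi> \<omega>' \<omega>) \<in> borel_measurable (sources_algebra A \<Otimes>\<^sub>M sources_algebra B)"
  shows "(\<lambda>\<omega>'. expectation (\<phi> \<omega>')) \<in> borel_measurable (sources_algebra A)"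
  using measurable_pair_sources_algebraD[OF assms] by (rule borel_measurable_lebesgue_integral)

text \<open>With the first argument frozen, \<open>g\<close> is a constant factor and the centered
  term integrates to 0. The default value 0 of a non-integrable integral settles the remaining
  cases, for single sections as well as for the product, so the identity holds for measurable
  functions in general.\<close>

lemma orthogonal_to_centered:
  fixes \<phi> :: "'w \<Rightarrow> 'w \<Rightarrow> real"
  assumes AB: "A' \<subseteq> A" "A \<inter> B = {}" and g: "g \<in> borel_measurable (sources_algebra A)"
    and \<phi>: "(\<lambda>(\<omega>', \<omega>). \<phi> \<omega>' \<omega>) \<in> borel_measurable (sources_algebra A' \<Otimes>\<^sub>M sources_algebra B)"
    and mean: "\<And>\<omega>'. expectation (\<phi> \<omega>') = c \<omega>'"
  shows "expectation (\<lambda>\<omega>. g \<omega> * (\<phi> \<omega> \<omega> - c \<omega>)) = 0"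
proof -
  let ?h = "\<lambda>(\<omega>', \<omega>). g \<omega>' * (\<phi> \<omega>' \<omega> - c \<omega>')"
  have "(\<lambda>\<omega>'. expectation (\<phi> \<omega>')) \<in> borel_measurable (sources_algebra A)"
    by (rule measurable_sources_algebra_mono[OF AB(1) conditional_mean_measurable[OF \<phi>]])
  then have [measurable]: "c \<in> borel_measurable (sources_algebra A)" by (simp add: mean)
  note [measurable] = g
    measurable_pair_sources_algebra_mono_left[OF AB(1) \<phi>, unfolded case_prod_beta']
  have h: "?h \<in> borel_measurable (sources_algebra A \<Otimes>\<^sub>M sources_algebra B)"
    unfolding case_prod_beta' by measurable
  have zero: "expectation (\<lambda>\<omega>. \<phi> \<omega>' \<omega> - c \<omega>') = 0" for \<omega>'
  proof (cases "integrable M (\<phi> \<omega>')")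
    case True
    then show ?thesis by (simp add: mean prob_space)
  next
    case False
    have "\<not> integrable M (\<lambda>\<omega>. \<phi> \<omega>' \<omega> - c \<omega>')"
    proof
      assume "integrable M (\<lambda>\<omega>. \<phi> \<omega>' \<omega> - c \<omega>')"
      then have "integrable M (\<lambda>\<omega>. \<phi> \<omega>' \<omega> - c \<omega>' + c \<omega>')" by (intro Bochner_Integration.integrable_add) auto
      with False show False by simp
    qed
    then show ?thesis by (rule not_integrable_integral_eq)
  qed
  show ?thesis
  proof (cases "integrable M (\<lambda>\<omega>. ?h (\<omega>, \<omega>))")
    case True
    from integral_diagonal[OF AB(2) h True] show ?thesis by (simp add: zero)
  qed (simp add: not_integrable_integral_eq)
qed

text \<open>The preceding terms depend on the sources of the signal and of earlier members, which
  are disjoint from those of member \<open>n\<close>. The power \<open>r\<close> is free because the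
  even moments use r = 2k - 1 and the variance estimate uses r = 1.\<close>

lemma centered_partial_sums_orthogonal:
  fixes \<phi> :: "nat \<Rightarrow> 'w \<Rightarrow> 'w \<Rightarrow> real"
  assumes \<phi>: "\<And>n. (\<lambda>(\<omega>', \<omega>). \<phi> n \<omega>' \<omega>)
      \<in> borel_measurable (sources_algebra (own_sources Signal) \<Otimes>\<^sub>M sources_algebra (own_sources (Member n)))"
    and mean: "\<And>n \<omega>'. expectation (\<phi> n \<omega>') = c \<omega>'"
  shows "expectation (\<lambda>\<omega>. (\<Sum>i<n. \<phi> i \<omega> \<omega> - c \<omega>) ^ r * (\<phi> n \<omega> \<omega> - c \<omega>)) = 0"
proof -
  define X where "X n \<omega> = \<phi> n \<omega> \<omega> - c \<omega>" for n \<omega>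
  have "(\<lambda>\<omega>'. expectation (\<phi> 0 \<omega>')) \<in> borel_measurable (sources_algebra (own_sources Signal))"
    by (rule conditional_mean_measurable[OF \<phi>])
  then have c_Signal: "c \<in> borel_measurable (sources_algebra (own_sources Signal))" by (simp add: mean)
  have X_own: "X n \<in> borel_measurable (sources_algebra (own_sources Signal \<union> own_sources (Member n)))" for n
  proof -
    let ?A = "own_sources Signal \<union> own_sources (Member n)"
    have "(\<lambda>(\<omega>', \<omega>). \<phi> n \<omega>' \<omega>) \<in> borel_measurable (sources_algebra ?A \<Otimes>\<^sub>M sources_algebra ?A)"
      by (rule measurable_pair_sources_algebra_mono_left[OF _ measurable_pair_sources_algebra_mono[OF _ \<phi>]]) auto
    from measurable_sources_algebra_diagonal[OF this]
    have [measurable]: "(\<lambda>\<omega>. \<phi> n \<omega> \<omega>) \<in> borel_measurable (sources_algebra ?A)" by simp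
    have [measurable]: "c \<in> borel_measurable (sources_algebra ?A)"
      by (rule measurable_sources_algebra_mono[OF _ c_Signal]) simp
    show ?thesis unfolding X_def[abs_def] by measurable
  qed
  let ?A = "own_sources Signal \<union> (\<Union>i<n. own_sources (Member i))"
  have "(\<lambda>\<omega>. (\<Sum>i<n. X i \<omega>) ^ r) \<in> borel_measurable (sources_algebra ?A)"
    by (intro borel_measurable_power borel_measurable_sum measurable_sources_algebra_mono[OF _ X_own]) auto
  moreover have "own_sources (Member i) \<inter> own_sources (Member n) = {}" if "i < n" for i
    using that by (intro own_sources_disjoint) simp
  then have "?A \<inter> own_sources (Member n) = {}"
    using own_sources_disjoint[of Signal "Member n"] by blast
  ultimately show ?thesis
    by (fold X_def, unfold X_def[of n]) (intro orthogonal_to_centered[OF Un_upper1 _ _ \<phi> mean])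
qed

text \<open>Orthogonality lets the moment of order 2k of the centered sum grow only like N^k.
  Dividing the sum by N and scaling by sqrt N multiplies that moment by N^(-k), so the bounds are
  uniform. The conditional mean \<open>c\<close> is common to all terms because the copies share one
  law for given data.\<close>

lemma root_N_close_conditional_mean:
  fixes \<phi> :: "nat \<Rightarrow> 'w \<Rightarrow> 'w \<Rightarrow> real"
  assumes \<phi>: "\<And>n. (\<lambda>(\<omega>', \<omega>). \<phi> n \<omega>' \<omega>)
      \<in> borel_measurable (sources_algebra (own_sources Signal) \<Otimes>\<^sub>M sources_algebra (own_sources (Member n)))"
    and mean: "\<And>n \<omega>'. expectation (\<phi> n \<omega>') = c \<omega>'"
    and bounded: "bounded_moments (\<lambda>N n \<omega>. \<phi> n \<omega> \<omega>)"
  shows "root_N_close (\<lambda>N n \<omega>. (\<Sum>m<N. \<phi> m \<omega> \<omega>) / N) (\<lambda>N n \<omega>. c \<omega>)"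
proof -
  have "(\<lambda>\<omega>'. expectation (\<phi> 0 \<omega>')) \<in> borel_measurable (sources_algebra (own_sources Signal))"
    by (rule conditional_mean_measurable[OF \<phi>])
  then have c_Signal: "c \<in> borel_measurable (sources_algebra (own_sources Signal))" by (simp add: mean)
  note c [measurable] = measurable_sources_algebraD[OF c_Signal]
  \<comment> \<open>Conditional Jensen: the moments of \<open>c\<close> are at most those of one
    term, here the term 0, integrated first over its own noises and then over the data.\<close>
  have c_bounded: "bounded_moments (\<lambda>N n. c)"
    unfolding bounded_moments_def
  proof (intro conjI allI impI c)
    fix k
    obtain b where b: "\<And>N n. n < N \<Longrightarrow> (\<integral>\<^sup>+\<omega>. ennreal (\<phi> n \<omega> \<omega> ^ (2 * k)) \<partial>M) \<le> ennreal b"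
      using bounded_momentsE[OF bounded] by metis
    have sections: "\<phi> 0 \<omega>' \<in> borel_measurable M" if "\<omega>' \<in> space M" for \<omega>'
      using measurable_Pair2[OF measurable_pair_sources_algebraD[OF \<phi>[of 0]], of \<omega>'] that by simp
    have "(\<integral>\<^sup>+\<omega>'. ennreal (c \<omega>' ^ (2 * k)) \<partial>M) \<le> (\<integral>\<^sup>+\<omega>'. \<integral>\<^sup>+\<omega>. ennreal (\<phi> 0 \<omega>' \<omega> ^ (2 * k)) \<partial>M \<partial>M)"
      using even_power_expectation_le[OF sections] by (intro nn_integral_mono) (simp add: mean)
    also have "\<dots> = (\<integral>\<^sup>+\<omega>. ennreal (\<phi> 0 \<omega> \<omega> ^ (2 * k)) \<partial>M)"
    proof -
      note [measurable] = \<phi>[of 0, unfolded case_prod_beta']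
      show ?thesis
        using nn_integral_diagonal[OF own_sources_disjoint[of Signal "Member 0"],
            of "\<lambda>z. ennreal (\<phi> 0 (fst z) (snd z) ^ (2 * k))"] by simp
    qed
    also have "\<dots> \<le> ennreal b" using b[of 0 1] by simp
    finally show "\<exists>b. \<forall>N n. n < N \<longrightarrow> (\<integral>\<^sup>+\<omega>'. ennreal (c \<omega>' ^ (2 * k)) \<partial>M) \<le> ennreal b" by blast
  qed
  define X where "X n \<omega> = \<phi> n \<omega> \<omega> - c \<omega>" for n \<omega>
  have X_bounded: "bounded_moments (\<lambda>N. X)"
    unfolding X_def[abs_def] by (rule bounded_moments_diff[OF bounded c_bounded])
  note X_meas [measurable] = bounded_moments_measurable[OF X_bounded lessI]
  note avg_meas [measurable] = bounded_moments_measurable[OF bounded_moments_average[OF bounded]]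
  have \<phi>_meas [measurable]: "(\<lambda>\<omega>. \<phi> n \<omega> \<omega>) \<in> borel_measurable M" for n
    using bounded_moments_measurable[OF bounded lessI[of n]] by simp
  have orth: "expectation (\<lambda>\<omega>. (\<Sum>i<n. X i \<omega>) ^ r * X n \<omega>) = 0" for n r
    unfolding X_def by (rule centered_partial_sums_orthogonal[OF \<phi> mean])
  have "bounded_moments (\<lambda>N n \<omega>. sqrt N * ((\<Sum>m<N. \<phi> m \<omega> \<omega>) / N - c \<omega>))"
  proof (rule bounded_momentsI)
    fix k :: nat assume k: "k \<ge> 2"
    obtain m where m: "m \<ge> 0" "\<And>n. expectation (\<lambda>\<omega>. X n \<omega> ^ (2 * k)) \<le> m"
      using bounded_moments_expectationE[OF X_bounded] lessI by metis
    have intX: "integrable M (\<lambda>\<omega>. X n \<omega> ^ (2 * k))" for n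
      using bounded_moments_integrable[OF X_bounded lessI] .
    have "(\<integral>\<^sup>+\<omega>. ennreal ((sqrt N * ((\<Sum>m<N. \<phi> m \<omega> \<omega>) / N - c \<omega>)) ^ (2 * k)) \<partial>M)
        \<le> ennreal (2 * (4 ^ k) ^ k * m)" if "n < N" for N n :: nat
    proof -
      let ?S = "\<lambda>\<omega>. \<Sum>i<N. X i \<omega>"
      have N: "N > 0" using that by simp
      have "(sqrt N * ((\<Sum>m<N. \<phi> m \<omega> \<omega>) / N - c \<omega>)) ^ (2 * k) = ?S \<omega> ^ (2 * k) / N ^ k" for \<omega>
      proof -
        have "(\<Sum>m<N. \<phi> m \<omega> \<omega>) / N - c \<omega> = ?S \<omega> / N"
          using N by (simp add: X_def sum_subtractf field_simps)
        then have "(sqrt N * ((\<Sum>m<N. \<phi> m \<omega> \<omega>) / N - c \<omega>)) ^ (2 * k) = ((sqrt N * (?S \<omega> / N))\<^sup>2) ^ k"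
          by (simp only: power_mult)
        also have "(sqrt N * (?S \<omega> / N))\<^sup>2 = (?S \<omega>)\<^sup>2 / N"
          using N by (simp add: power_mult_distrib power_divide) (simp add: power2_eq_square)
        also have "((?S \<omega>)\<^sup>2 / N) ^ k = ?S \<omega> ^ (2 * k) / N ^ k" by (simp only: power_divide power_mult of_nat_power)
        finally show ?thesis .
      qed
      then have "(\<integral>\<^sup>+\<omega>. ennreal ((sqrt N * ((\<Sum>m<N. \<phi> m \<omega> \<omega>) / N - c \<omega>)) ^ (2 * k)) \<partial>M)
          = (\<integral>\<^sup>+\<omega>. ennreal (?S \<omega> ^ (2 * k) / N ^ k) \<partial>M)" by simp
      also have "\<dots> = ennreal (expectation (\<lambda>\<omega>. ?S \<omega> ^ (2 * k) / N ^ k))"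
        by (intro nn_integral_eq_integral integrable_divide integrable_even_power_sum[of N] X_meas intX)
          (auto simp: zero_le_even_power)
      also have "\<dots> \<le> ennreal (2 * (4 ^ k) ^ k * m)"
      proof (rule ennreal_leI)
        have "expectation (\<lambda>\<omega>. ?S \<omega> ^ (2 * k)) \<le> 2 * (4 ^ k) ^ k * real N ^ k * m"
          by (rule even_moment_orthogonal_sum[OF k X_meas intX m(2) orth m(1)])
        then show "expectation (\<lambda>\<omega>. ?S \<omega> ^ (2 * k) / N ^ k) \<le> 2 * (4 ^ k) ^ k * m"
          using N by (simp add: field_simps)
      qed
      finally show ?thesis .
    qed
    then show "\<exists>b. \<forall>N n. n < N \<longrightarrow>
        (\<integral>\<^sup>+\<omega>. ennreal ((sqrt N * ((\<Sum>m<N. \<phi> m \<omega> \<omega>) / N - c \<omega>)) ^ (2 * k)) \<partial>M) \<le> ennreal b" by blast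
  qed measurable
  then show ?thesis by (intro root_N_closeI c_bounded) measurable
qed

end

section \<open>Comparison of the ensemble with its coupled copies\<close>

context ensemble_kalman
begin

lemma signal_measurable:
  "signal \<Phi> init drive j \<in> borel_measurable (sources_algebra (own_sources Signal \<inter> past_sources j))"
proof (induction j)
  case 0
  then show ?case by (simp add: measurable_init_sources)
next
  case (Suc j)
  have [measurable]: "signal \<Phi> init drive j
      \<in> borel_measurable (sources_algebra (own_sources Signal \<inter> past_sources (Suc j)))"
    using past_sources_mono[of j "Suc j"] by (intro measurable_sources_algebra_mono[OF _ Suc]) auto
  have [measurable]: "drive Signal j \<in> sources_algebra (own_sources Signal \<inter> past_sources (Suc j)) \<rightarrow>\<^sub>M \<nu>"
    by (rule measurable_drive_sources) simp
  show ?case by simp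
qed

lemma observed_measurable:
  assumes "i < j" "own_sources Signal \<inter> past_sources j \<subseteq> A"
  shows "(\<lambda>\<omega>. observed \<omega> i) \<in> borel_measurable (sources_algebra A)"
proof -
  \<comment> \<open>Entry \<open>i\<close> of the data is the observation at time index i + 1. It
    uses the signal at \<open>Suc i\<close> and the Gaussian noise of index \<open>i\<close>, both
    belonging to the past of \<open>Suc i\<close>.\<close>
  have "own_sources Signal \<inter> past_sources (Suc i) \<subseteq> A"
    using assms past_sources_mono[of "Suc i" j] by auto
  from measurable_sources_algebra_mono[OF this signal_measurable]
  have [measurable]: "signal \<Phi> init drive (Suc i) \<in> borel_measurable (sources_algebra A)" .
  have [measurable]: "gauss Signal i \<in> borel_measurable (sources_algebra A)"
    using assms by (intro measurable_gauss_sources) auto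
  show ?thesis unfolding observations_def by measurable
qed

lemma observed_random_variable [measurable]: "(\<lambda>\<omega>. observed \<omega> i) \<in> borel_measurable M"
  by (rule measurable_sources_algebraD[OF observed_measurable[OF lessI subset_UNIV]])

lemma bounded_moments_signal: "bounded_moments (\<lambda>N n \<omega>. signal \<Phi> init drive j \<omega> $ i)"
proof (induction j arbitrary: i)
  case 0
  then show ?case using bounded_moments_init[of "\<lambda>_. Signal"] by simp
next
  case (Suc j)
  have "bounded_moments (\<lambda>N n \<omega>. \<Phi> (signal \<Phi> init drive j \<omega>) (drive ((\<lambda>_. Signal) n) j \<omega>) $ i)"
    by (rule bounded_moments_kernel_step[OF signal_measurable _ Suc]) simp
  then show ?case by simp
qed

lemma bounded_moments_observed: "bounded_moments (\<lambda>N n \<omega>. observed \<omega> j $ k)"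
proof -
  have "bounded_moments (\<lambda>N n \<omega>. (\<Sum>l\<in>UNIV. H $ k $ l * signal \<Phi> init drive (Suc j) \<omega> $ l)
      + gauss ((\<lambda>_. Signal) n) j \<omega> $ k)"
    by (intro bounded_moments_add bounded_moments_sum bounded_moments_mult bounded_moments_const
        bounded_moments_signal bounded_moments_gauss)
  then show ?thesis by (simp add: observations_def matrix_vector_mult_def)
qed

text \<open>The same sample point supplies the data and the noises: this is the diagonal of the
  two-argument function used for conditioning.\<close>

abbreviation copy :: "nat \<Rightarrow> nat \<Rightarrow> 'w \<Rightarrow> real^'d" where
  "copy j n \<omega> \<equiv> mean_field (Member n) (observed \<omega>) j \<omega>"

abbreviation copy_forecast :: "nat \<Rightarrow> nat \<Rightarrow> 'w \<Rightarrow> real^'d" where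
  "copy_forecast j n \<omega> \<equiv> mean_field_forecast (Member n) (observed \<omega>) j \<omega>"

abbreviation member :: "nat \<Rightarrow> nat \<Rightarrow> nat \<Rightarrow> 'w \<Rightarrow> real^'d" where
  "member N j n \<omega> \<equiv> enkf H \<Gamma> \<Phi> init drive gauss N j \<omega> n"

definition member_forecast :: "nat \<Rightarrow> nat \<Rightarrow> nat \<Rightarrow> 'w \<Rightarrow> real^'d" where
  "member_forecast N j n \<omega> = \<Phi> (member N j n \<omega>) (drive (Member n) j \<omega>)"

lemma member_0: "member N 0 n \<omega> = init (Member n) \<omega>"
  by simp

lemma member_Suc: "member N (Suc j) n \<omega> = analysis H
    (kalman_gain H \<Gamma> (ensemble_covariance N (\<lambda>n. member_forecast N j n \<omega>)))
    (observed \<omega> j + gauss (Member n) j \<omega>) (member_forecast N j n \<omega>)"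
  by (simp add: member_forecast_def Let_def)

declare enkf.simps [simp del]

lemma copy_measurable: "copy j n \<in> borel_measurable (sources_algebra (past_sources j))"
  by (intro borel_measurable_mean_field_diagonal observed_measurable) auto

text \<open>The sample covariance mixes the noises of the whole ensemble, so members are separated
  by time and not by source. This still leaves the current driving noise independent of all
  states.\<close>

lemma member_measurable: "member N j n \<in> borel_measurable (sources_algebra (past_sources j))"
proof (induction j arbitrary: n)
  case 0
  show ?case by (simp add: member_0[abs_def] measurable_init_sources)
next
  case (Suc j)
  have [measurable]: "member N j n \<in> borel_measurable (sources_algebra (past_sources (Suc j)))" for n
    by (rule measurable_sources_algebra_mono[OF past_sources_mono Suc]) simp
  have [measurable]: "drive (Member n) j \<in> sources_algebra (past_sources (Suc j)) \<rightarrow>\<^sub>M \<nu>"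
      "gauss (Member n) j \<in> borel_measurable (sources_algebra (past_sources (Suc j)))" for n
    by (auto intro!: measurable_drive_sources measurable_gauss_sources)
  have [measurable]: "(\<lambda>\<omega>. observed \<omega> j) \<in> borel_measurable (sources_algebra (past_sources (Suc j)))"
    by (rule observed_measurable[of _ "Suc j"]) auto
  have [measurable]: "member_forecast N j n \<in> borel_measurable (sources_algebra (past_sources (Suc j)))" for n
    unfolding member_forecast_def[abs_def] by measurable
  have [measurable]: "(\<lambda>\<omega>. kalman_gain H \<Gamma> (ensemble_covariance N (\<lambda>n. member_forecast N j n \<omega>)))
      \<in> borel_measurable (sources_algebra (past_sources (Suc j)))"
    by (intro borel_measurable_kalman_gain borel_measurable_ensemble_covariance psd_ensemble_covariance) measurable
  show ?case unfolding member_Suc[abs_def] by measurable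
qed

lemma copy_random_variable [measurable]: "copy j n \<in> borel_measurable M"
  by (rule measurable_sources_algebraD[OF copy_measurable])

lemma member_random_variable [measurable]: "member N j n \<in> borel_measurable M"
  by (rule measurable_sources_algebraD[OF member_measurable])

lemma copy_forecast_random_variable [measurable]: "copy_forecast j n \<in> borel_measurable M"
  unfolding mean_field_forecast_def by measurable

lemma member_forecast_random_variable [measurable]: "member_forecast N j n \<in> borel_measurable M"
  unfolding member_forecast_def[abs_def] by measurable

text \<open>Member and copy are moved by the same driving noise, so their distance grows by at most
  the Lipschitz factor. Moment bounds are proved for the copy, and those of the member come with
  \<open>root_N_closeI\<close>.\<close>

lemma forecast_close:
  assumes "\<And>i. root_N_close (\<lambda>N n \<omega>. member N j n \<omega> $ i) (\<lambda>N n \<omega>. copy j n \<omega> $ i)"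
  shows "root_N_close (\<lambda>N n \<omega>. member_forecast N j n \<omega> $ i) (\<lambda>N n \<omega>. copy_forecast j n \<omega> $ i)"
proof (rule root_N_closeI)
  have drive_past: "Drive (Member n) j \<notin> past_sources j" for n by simp
  show "bounded_moments (\<lambda>N n \<omega>. copy_forecast j n \<omega> $ i)"
    unfolding mean_field_forecast_def
    by (rule bounded_moments_kernel_step[OF copy_measurable drive_past])
      (use assms in \<open>simp add: root_N_close_def\<close>)
  show "random_variable borel (\<lambda>\<omega>. member_forecast N j n \<omega> $ i)" for N n by measurable
  obtain L where L: "L > 0"
    "\<And>A X X' p j. X \<in> borel_measurable (sources_algebra A) \<Longrightarrow> X' \<in> borel_measurable (sources_algebra A) \<Longrightarrow>
      Drive p j \<notin> A \<Longrightarrow>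
      AE \<omega> in M. norm (\<Phi> (X \<omega>) (drive p j \<omega>) - \<Phi> (X' \<omega>) (drive p j \<omega>)) \<le> L * norm (X \<omega> - X' \<omega>)"
    using lipschitz_drive_AE by blast
  have "bounded_moments (\<lambda>N n \<omega>. L * (\<Sum>i\<in>UNIV. \<bar>sqrt N * (member N j n \<omega> $ i - copy j n \<omega> $ i)\<bar>))"
  proof (rule bounded_moments_mult[OF bounded_moments_const bounded_moments_sum[OF bounded_moments_abs]])
    show "bounded_moments (\<lambda>N n \<omega>. sqrt N * (member N j n \<omega> $ i - copy j n \<omega> $ i))" for i
      using assms[of i] by (simp add: root_N_close_def)
  qed
  then show "bounded_moments (\<lambda>N n \<omega>. sqrt N * (member_forecast N j n \<omega> $ i - copy_forecast j n \<omega> $ i))"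
  proof (rule bounded_moments_mono_AE)
    fix N n :: nat
    show "random_variable borel (\<lambda>\<omega>. sqrt N * (member_forecast N j n \<omega> $ i - copy_forecast j n \<omega> $ i))"
      by measurable
    show "AE \<omega> in M. \<bar>sqrt N * (member_forecast N j n \<omega> $ i - copy_forecast j n \<omega> $ i)\<bar>
        \<le> \<bar>L * (\<Sum>i\<in>UNIV. \<bar>sqrt N * (member N j n \<omega> $ i - copy j n \<omega> $ i)\<bar>)\<bar>"
      using L(2)[OF member_measurable copy_measurable drive_past, of N n n n]
    proof eventually_elim
      case (elim \<omega>)
      let ?d = "member N j n \<omega> - copy j n \<omega>"
      have "\<bar>member_forecast N j n \<omega> $ i - copy_forecast j n \<omega> $ i\<bar> \<le> L * norm ?d"
        using order_trans[OF component_le_norm_cart[of "member_forecast N j n \<omega> - copy_forecast j n \<omega>" i]] elim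
        by (simp add: member_forecast_def mean_field_forecast_def)
      also have "\<dots> \<le> L * (\<Sum>i\<in>UNIV. \<bar>?d $ i\<bar>)"
        using L(1) by (intro mult_left_mono norm_le_l1_cart) auto
      finally have "sqrt N * \<bar>member_forecast N j n \<omega> $ i - copy_forecast j n \<omega> $ i\<bar>
          \<le> sqrt N * (L * (\<Sum>i\<in>UNIV. \<bar>?d $ i\<bar>))" by (intro mult_left_mono) auto
      also have "\<dots> = L * (\<Sum>i\<in>UNIV. \<bar>sqrt N * (member N j n \<omega> $ i - copy j n \<omega> $ i)\<bar>)"
        by (simp add: abs_mult sum_distrib_left mult_ac)
      finally show ?case by (intro order_trans[OF _ abs_ge_self]) (simp add: abs_mult)
    qed
  qed
qed

text \<open>For given data all copies have the same covariance
  (\<open>mean_field_covariance_eq\<close>); copy 0 is the representative.\<close>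

abbreviation copy_covariance :: "nat \<Rightarrow> 'w \<Rightarrow> real^'d^'d" where
  "copy_covariance j \<omega> \<equiv> mean_field_covariance (Member 0) (observed \<omega>) j"

abbreviation member_covariance :: "nat \<Rightarrow> nat \<Rightarrow> 'w \<Rightarrow> real^'d^'d" where
  "member_covariance N j \<omega> \<equiv> ensemble_covariance N (\<lambda>n. member_forecast N j n \<omega>)"

lemma forecast_pair_measurable:
  "(\<lambda>(\<omega>', \<omega>). mean_field_forecast (Member n) (observed \<omega>') j \<omega>)
    \<in> borel_measurable (sources_algebra (own_sources Signal) \<Otimes>\<^sub>M sources_algebra (own_sources (Member n)))"
  by (intro borel_measurable_mean_field_forecast observed_measurable[OF lessI]) auto

lemma copy_covariance_random_variable [measurable]: "copy_covariance j \<in> borel_measurable M"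
  unfolding mean_field_covariance_def
proof (rule borel_measurable_covariance_of)
  show "(\<lambda>(l, \<omega>). mean_field_forecast (Member 0) (observed l) j \<omega>) \<in> borel_measurable (M \<Otimes>\<^sub>M M)"
    by (rule measurable_pair_sources_algebraD[OF borel_measurable_mean_field_forecast[OF _ subset_UNIV]])
      measurable
qed

lemma member_covariance_random_variable [measurable]: "member_covariance N j \<in> borel_measurable M"
  by (rule borel_measurable_ensemble_covariance) measurable

lemma copy_covariance_entry_AE:
  assumes bounded: "\<And>i. bounded_moments (\<lambda>N n \<omega>. copy_forecast j n \<omega> $ i)"
  shows "AE \<omega> in M. copy_covariance j \<omega> $ i $ k =
    expectation (\<lambda>\<omega>'. mean_field_forecast (Member 0) (observed \<omega>) j \<omega>' $ i
      * mean_field_forecast (Member 0) (observed \<omega>) j \<omega>' $ k)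
    - expectation (\<lambda>\<omega>'. mean_field_forecast (Member 0) (observed \<omega>) j \<omega>' $ i)
      * expectation (\<lambda>\<omega>'. mean_field_forecast (Member 0) (observed \<omega>) j \<omega>' $ k)"
proof -
  note [measurable] = forecast_pair_measurable[of 0 j, unfolded case_prod_beta']
  have "AE \<omega> in M. integrable M (\<lambda>\<omega>'. (mean_field_forecast (Member 0) (observed \<omega>) j \<omega>' $ i)\<^sup>2)" for i
  proof -
    let ?h = "\<lambda>z. ennreal ((mean_field_forecast (Member 0) (observed (fst z)) j (snd z) $ i)\<^sup>2)"
    have [measurable]: "?h \<in> borel_measurable (sources_algebra (own_sources Signal) \<Otimes>\<^sub>M sources_algebra (own_sources (Member 0)))"
      by measurable
    have [measurable]: "?h \<in> borel_measurable (M \<Otimes>\<^sub>M M)"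
    proof -
      have [measurable]: "(\<lambda>z. mean_field_forecast (Member 0) (observed (fst z)) j (snd z)) \<in> borel_measurable (M \<Otimes>\<^sub>M M)"
        using measurable_pair_sources_algebraD[OF borel_measurable_mean_field_forecast[OF _ subset_UNIV],
            of j observed M "Member 0"] by (simp add: case_prod_beta')
      show ?thesis by measurable
    qed
    have "(\<integral>\<^sup>+\<omega>. \<integral>\<^sup>+\<omega>'. ?h (\<omega>, \<omega>') \<partial>M \<partial>M) = (\<integral>\<^sup>+\<omega>. ?h (\<omega>, \<omega>) \<partial>M)"
      using nn_integral_diagonal[OF own_sources_disjoint[of Signal "Member 0"], of ?h] by simp
    also have "\<dots> < \<infinity>"
      using bounded_moments_integrable[OF bounded[of i] lessI[of 0], of 1] by (simp add: integrable_iff_bounded)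
    finally have "(\<integral>\<^sup>+\<omega>. \<integral>\<^sup>+\<omega>'. ?h (\<omega>, \<omega>') \<partial>M \<partial>M) \<noteq> \<infinity>" by simp
    then have "AE \<omega> in M. (\<integral>\<^sup>+\<omega>'. ?h (\<omega>, \<omega>') \<partial>M) \<noteq> \<infinity>"
      by (intro nn_integral_PInf_AE) measurable
    then show ?thesis
      by eventually_elim (auto simp: less_top intro!: integrableI_nonneg)
  qed
  then have "AE \<omega> in M. \<forall>i. integrable M (\<lambda>\<omega>'. (mean_field_forecast (Member 0) (observed \<omega>) j \<omega>' $ i)\<^sup>2)"
    by (simp add: AE_all_countable)
  then show ?thesis
    unfolding mean_field_covariance_def by eventually_elim (intro covariance_of_entry; simp)
qed

text \<open>Each average is compared in two stages: member average with copy average, by closeness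
  of the terms, and copy average with conditional mean, by the law of large numbers. Applied to
  coordinates and their products this treats every ingredient of the covariance.\<close>

lemma covariance_close:
  assumes close: "\<And>i. root_N_close (\<lambda>N n \<omega>. member_forecast N j n \<omega> $ i) (\<lambda>N n \<omega>. copy_forecast j n \<omega> $ i)"
  shows "root_N_close (\<lambda>N n \<omega>. member_covariance N j \<omega> $ i $ k) (\<lambda>N n \<omega>. copy_covariance j \<omega> $ i $ k)"
proof -
  let ?E = "\<lambda>f \<omega>. expectation (\<lambda>\<omega>'. f (mean_field_forecast (Member 0) (observed \<omega>) j \<omega>') :: real)"
  have bounded: "bounded_moments (\<lambda>N n \<omega>. copy_forecast j n \<omega> $ i)" for i
    using close by (simp add: root_N_close_def)
  have avg: "root_N_close (\<lambda>N n \<omega>. (\<Sum>m<N. f (member_forecast N j m \<omega>)) / N) (\<lambda>N n. ?E f)"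
    if [measurable]: "f \<in> borel_measurable borel"
      and fclose: "root_N_close (\<lambda>N n \<omega>. f (member_forecast N j n \<omega>)) (\<lambda>N n \<omega>. f (copy_forecast j n \<omega>))" for f
  proof (rule root_N_close_trans[OF root_N_close_average[OF fclose]])
    show "root_N_close (\<lambda>N n \<omega>. (\<Sum>m<N. f (copy_forecast j m \<omega>)) / N) (\<lambda>N n. ?E f)"
    proof (rule root_N_close_conditional_mean[where \<phi>="\<lambda>n \<omega>' \<omega>. f (mean_field_forecast (Member n) (observed \<omega>') j \<omega>)"])
      fix n
      note [measurable] = forecast_pair_measurable[of n j, unfolded case_prod_beta']
      show "(\<lambda>(\<omega>', \<omega>). f (mean_field_forecast (Member n) (observed \<omega>') j \<omega>))
          \<in> borel_measurable (sources_algebra (own_sources Signal) \<Otimes>\<^sub>M sources_algebra (own_sources (Member n)))"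
        unfolding case_prod_beta' by measurable
      show "expectation (\<lambda>\<omega>. f (mean_field_forecast (Member n) (observed \<omega>') j \<omega>)) = ?E f \<omega>'" for \<omega>'
        by (rule expectation_mean_field_forecast_eq) measurable
    qed (use fclose in \<open>simp add: root_N_close_def\<close>)
  qed
  have "root_N_close
      (\<lambda>N n \<omega>. (\<Sum>m<N. member_forecast N j m \<omega> $ i * member_forecast N j m \<omega> $ k) / N
        - (\<Sum>m<N. member_forecast N j m \<omega> $ i) / N * ((\<Sum>m<N. member_forecast N j m \<omega> $ k) / N))
      (\<lambda>N n \<omega>. ?E (\<lambda>v. v $ i * v $ k) \<omega> - ?E (\<lambda>v. v $ i) \<omega> * ?E (\<lambda>v. v $ k) \<omega>)"
    by (rule root_N_close_diff[OF avg root_N_close_mult[OF avg avg]]; (rule root_N_close_mult close)?)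
      (auto intro: close)
  then have "root_N_close
      (\<lambda>N n \<omega>. (\<Sum>m<N. member_forecast N j m \<omega> $ i * member_forecast N j m \<omega> $ k) / N
        - (\<Sum>m<N. member_forecast N j m \<omega> $ i) / N * ((\<Sum>m<N. member_forecast N j m \<omega> $ k) / N))
      (\<lambda>N n \<omega>. copy_covariance j \<omega> $ i $ k)"
    by (rule root_N_close_cong_right) (measurable, rule copy_covariance_entry_AE[OF bounded])
  \<comment> \<open>As an identity of functions it includes N = 0, where division by zero makes both
    sides 0.\<close>
  moreover have "(\<lambda>N (n::nat) \<omega>. member_covariance N j \<omega> $ i $ k) =
      (\<lambda>N n \<omega>. (\<Sum>m<N. member_forecast N j m \<omega> $ i * member_forecast N j m \<omega> $ k) / N
        - (\<Sum>m<N. member_forecast N j m \<omega> $ i) / N * ((\<Sum>m<N. member_forecast N j m \<omega> $ k) / N))"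
  proof (intro ext)
    fix N n \<omega>
    show "member_covariance N j \<omega> $ i $ k =
      (\<Sum>m<N. member_forecast N j m \<omega> $ i * member_forecast N j m \<omega> $ k) / N
        - (\<Sum>m<N. member_forecast N j m \<omega> $ i) / N * ((\<Sum>m<N. member_forecast N j m \<omega> $ k) / N)"
      by (cases "N = 0") (simp add: ensemble_covariance_def, simp add: ensemble_covariance_entry)
  qed
  ultimately show ?thesis by simp
qed

text \<open>The gain difference is at most the covariance difference times a factor affine in the
  norm of the mean-field covariance. Replacing norms by the entry sums \<open>?C\<close> and
  \<open>?D\<close> gives scalar families with bounded moments, and a product of such families is
  again one.\<close>

lemma gain_close:
  assumes close: "\<And>i k. root_N_close (\<lambda>N n \<omega>. member_covariance N j \<omega> $ i $ k) (\<lambda>N n \<omega>. copy_covariance j \<omega> $ i $ k)"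
  shows "root_N_close (\<lambda>N n \<omega>. kalman_gain H \<Gamma> (member_covariance N j \<omega>) $ i $ k)
    (\<lambda>N n \<omega>. kalman_gain H \<Gamma> (copy_covariance j \<omega>) $ i $ k)"
proof -
  obtain l where "gain_bounds \<Gamma> l" using ex_gain_bounds by blast
  then interpret gain_bounds H \<Gamma> l .
  have psd: "psd_matrix (member_covariance N j \<omega>)" "psd_matrix (copy_covariance j \<omega>)" for N \<omega>
    by (simp_all add: psd_ensemble_covariance mean_field_covariance_def psd_covariance_of)
  note [measurable] = borel_measurable_kalman_gain[OF member_covariance_random_variable psd(1)]
    borel_measurable_kalman_gain[OF copy_covariance_random_variable psd(2)]
  define a where "a = norm (transpose H) / l"
  have a: "a \<ge> 0" using l by (simp add: a_def)
  let ?C = "\<lambda>\<omega>. \<Sum>i\<in>UNIV. \<Sum>k\<in>UNIV. \<bar>copy_covariance j \<omega> $ i $ k\<bar>"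
  let ?D = "\<lambda>N \<omega>. \<Sum>i\<in>UNIV. \<Sum>k\<in>UNIV. \<bar>sqrt N * (member_covariance N j \<omega> $ i $ k - copy_covariance j \<omega> $ i $ k)\<bar>"
  have C: "bounded_moments (\<lambda>N n. ?C)" and D: "bounded_moments (\<lambda>N n. ?D N)"
    using close by (auto intro!: bounded_moments_sum bounded_moments_abs simp: root_N_close_def)
  have C_norm: "norm (copy_covariance j \<omega>) \<le> ?C \<omega>" for \<omega> by (rule norm_matrix_le_sum_entries)
  have C0: "?C \<omega> \<ge> 0" for \<omega> by (intro sum_nonneg) auto
  have D_norm: "sqrt N * norm (member_covariance N j \<omega> - copy_covariance j \<omega>) \<le> ?D N \<omega>" for N \<omega>
    using mult_left_mono[OF norm_matrix_le_sum_entries[of "member_covariance N j \<omega> - copy_covariance j \<omega>"], of "sqrt N"]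
    by (simp add: sum_distrib_left abs_mult)
  have D0: "?D N \<omega> \<ge> 0" for N \<omega> by (intro sum_nonneg) auto
  show ?thesis
  proof (rule root_N_closeI)
    show "bounded_moments (\<lambda>N n \<omega>. kalman_gain H \<Gamma> (copy_covariance j \<omega>) $ i $ k)"
    proof (rule bounded_moments_mono_AE[OF bounded_moments_mult[OF C bounded_moments_const[of a]]])
      fix N n :: nat
      have "\<bar>kalman_gain H \<Gamma> (copy_covariance j \<omega>) $ i $ k\<bar> \<le> \<bar>?C \<omega> * a\<bar>" for \<omega>
        using abs_kalman_gain_entry_le[OF psd(2), of \<omega> i k, folded a_def]
          mult_right_mono[OF C_norm a, of \<omega>] by linarith
      then show "AE \<omega> in M. \<bar>kalman_gain H \<Gamma> (copy_covariance j \<omega>) $ i $ k\<bar> \<le> \<bar>?C \<omega> * a\<bar>"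
        by (intro AE_I2)
    qed measurable
    have "bounded_moments (\<lambda>N n \<omega>. ?D N \<omega> * (a * (1 + ?C \<omega> * (a * norm H))))"
      by (intro bounded_moments_mult bounded_moments_add bounded_moments_const C D)
    then show "bounded_moments (\<lambda>N n \<omega>. sqrt N * (kalman_gain H \<Gamma> (member_covariance N j \<omega>) $ i $ k
        - kalman_gain H \<Gamma> (copy_covariance j \<omega>) $ i $ k))"
    proof (rule bounded_moments_mono_AE)
      fix N n :: nat
      have "\<bar>sqrt N * (kalman_gain H \<Gamma> (member_covariance N j \<omega>) $ i $ k
          - kalman_gain H \<Gamma> (copy_covariance j \<omega>) $ i $ k)\<bar>
        \<le> \<bar>?D N \<omega> * (a * (1 + ?C \<omega> * (a * norm H)))\<bar>" for \<omega>
      proof -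
        have "\<bar>sqrt N * (kalman_gain H \<Gamma> (member_covariance N j \<omega>) $ i $ k
            - kalman_gain H \<Gamma> (copy_covariance j \<omega>) $ i $ k)\<bar>
          = sqrt N * \<bar>kalman_gain H \<Gamma> (member_covariance N j \<omega>) $ i $ k
            - kalman_gain H \<Gamma> (copy_covariance j \<omega>) $ i $ k\<bar>" by (simp add: abs_mult)
        also have "\<dots> \<le> sqrt N * (norm (member_covariance N j \<omega> - copy_covariance j \<omega>)
            * (norm (transpose H) / l * (1 + norm (copy_covariance j \<omega>) * norm (transpose H) / l * norm H)))"
          by (intro mult_left_mono abs_kalman_gain_entry_diff_le psd) simp
        also have "\<dots> = (sqrt N * norm (member_covariance N j \<omega> - copy_covariance j \<omega>))
            * (a * (1 + norm (copy_covariance j \<omega>) * (a * norm H)))" by (simp add: a_def)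
        also have "\<dots> \<le> ?D N \<omega> * (a * (1 + ?C \<omega> * (a * norm H)))"
          using a C0 D0 by (intro mult_mono D_norm mult_left_mono add_left_mono mult_right_mono C_norm
              mult_nonneg_nonneg add_nonneg_nonneg) auto
        finally show ?thesis by linarith
      qed
      then show "AE \<omega> in M. \<bar>sqrt N * (kalman_gain H \<Gamma> (member_covariance N j \<omega>) $ i $ k
          - kalman_gain H \<Gamma> (copy_covariance j \<omega>) $ i $ k)\<bar>
        \<le> \<bar>?D N \<omega> * (a * (1 + ?C \<omega> * (a * norm H)))\<bar>" by (intro AE_I2)
    qed measurable
  qed measurable
qed

text \<open>At time 0 member and copy coincide. In an analysis step both use the same data and the
  same perturbation, so these terms are close to themselves; forecast and gain are close by the
  preceding lemmas, and the polynomial form of the analysis does the rest.\<close>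

lemma member_close: "root_N_close (\<lambda>N n \<omega>. member N j n \<omega> $ i) (\<lambda>N n \<omega>. copy j n \<omega> $ i)"
proof (induction j arbitrary: i)
  case 0
  show ?case
    unfolding member_0 mean_field_0 by (intro root_N_close_refl bounded_moments_init)
next
  case (Suc j)
  note forecast = forecast_close[OF Suc]
  note gain = gain_close[OF covariance_close[OF forecast]]
  \<comment> \<open>The gain of copy \<open>n\<close> is rewritten with the representative copy 0,
    the form in which \<open>gain\<close> is stated.\<close>
  have copy: "copy (Suc j) n \<omega> = analysis H (kalman_gain H \<Gamma> (copy_covariance j \<omega>))
      (observed \<omega> j + gauss (Member n) j \<omega>) (copy_forecast j n \<omega>)" for n \<omega>
    unfolding mean_field_Suc by (subst mean_field_covariance_eq[of _ _ _ "Member 0"]) (rule refl)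
  have "root_N_close
      (\<lambda>N n \<omega>. member_forecast N j n \<omega> $ i + (\<Sum>k\<in>UNIV. kalman_gain H \<Gamma> (member_covariance N j \<omega>) $ i $ k
        * (observed \<omega> j $ k + gauss (Member n) j \<omega> $ k - (\<Sum>l\<in>UNIV. H $ k $ l * member_forecast N j n \<omega> $ l))))
      (\<lambda>N n \<omega>. copy_forecast j n \<omega> $ i + (\<Sum>k\<in>UNIV. kalman_gain H \<Gamma> (copy_covariance j \<omega>) $ i $ k
        * (observed \<omega> j $ k + gauss (Member n) j \<omega> $ k - (\<Sum>l\<in>UNIV. H $ k $ l * copy_forecast j n \<omega> $ l))))"
    by (intro root_N_close_add root_N_close_sum root_N_close_mult root_N_close_diff forecast gain
        root_N_close_refl bounded_moments_const bounded_moments_observed bounded_moments_gauss)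
  then show ?case by (simp add: member_Suc copy analysis_entry)
qed

end

section \<open>From closeness of members and copies to the metric\<close>

lemma bounded_lipschitz_norm_le_1_lipschitz:
  fixes f :: "'a::euclidean_space \<Rightarrow> real"
  assumes "bounded_lipschitz_norm f \<le> 1"
  shows "\<bar>f x - f y\<bar> \<le> norm (x - y)"
proof (cases "x = y")
  case False
  have "ennreal (\<bar>f x - f y\<bar> / norm (x - y))
      \<le> (SUP (x, x') \<in> {(x, x'). x \<noteq> x'}. ennreal (\<bar>f x - f x'\<bar> / norm (x - x')))"
    using False by (intro SUP_upper2[of "(x, y)"]) auto
  also have "\<dots> \<le> bounded_lipschitz_norm f" unfolding bounded_lipschitz_norm_def by simp
  also note assms
  finally show ?thesis using False by (simp add: ennreal_le_1)
qed simp

lemma bounded_lipschitz_norm_le_1_measurable: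
  fixes f :: "'a::euclidean_space \<Rightarrow> real"
  assumes "bounded_lipschitz_norm f \<le> 1"
  shows "f \<in> borel_measurable borel"
proof (rule borel_measurable_continuous_onI)
  show "continuous_on UNIV f"
    unfolding continuous_on_iff
  proof (intro ballI allI impI)
    fix x and e :: real assume "e > 0"
    then show "\<exists>d>0. \<forall>x'\<in>UNIV. dist x' x < d \<longrightarrow> dist (f x') (f x) < e"
      using bounded_lipschitz_norm_le_1_lipschitz[OF assms]
      by (intro exI[of _ e]) (auto simp: dist_norm intro: le_less_trans)
  qed
qed

lemma integral_empirical_measure:
  fixes f :: "'a::euclidean_space \<Rightarrow> real"
  assumes "f \<in> borel_measurable borel"
  shows "(\<integral>x. f x \<partial>empirical_measure N v) = (\<Sum>n<N. f (v n)) / N"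
proof -
  have "v \<in> uniform_count_measure {..<N} \<rightarrow>\<^sub>M borel"
    by (simp add: measurable_def space_uniform_count_measure sets_uniform_count_measure)
  then show ?thesis
    by (simp add: empirical_measure_def integral_distr assms integral_uniform_count_measure)
qed

context ensemble_kalman
begin

text \<open>A test function of norm at most 1 moves by no more than its argument, so by Jensen the
  difference of averages is controlled by the mean squared distances between members and copies.
  This makes \<open>D\<close> independent of the test function.\<close>

lemma member_mean_square_close:
  obtains D where "D \<ge> 0" "\<And>N f. N > 0 \<Longrightarrow> bounded_lipschitz_norm f \<le> 1 \<Longrightarrow>
    expectation (\<lambda>\<omega>. ((\<Sum>n<N. f (member N j n \<omega>)) / N - (\<Sum>n<N. f (copy j n \<omega>)) / N)\<^sup>2) \<le> D / real N"
proof -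
  have bounded: "bounded_moments (\<lambda>N n \<omega>. sqrt N * (member N j n \<omega> $ i - copy j n \<omega> $ i))" for i
    using member_close by (simp add: root_N_close_def)
  have "\<exists>c\<ge>0. \<forall>N n. n < N \<longrightarrow> expectation (\<lambda>\<omega>. (sqrt N * (member N j n \<omega> $ i - copy j n \<omega> $ i)) ^ (2 * 1)) \<le> c" for i
    by (rule bounded_moments_expectationE[OF bounded[of i], of 1]) blast
  then have "\<forall>i. \<exists>c. c \<ge> 0 \<and> (\<forall>N n. n < N \<longrightarrow>
      expectation (\<lambda>\<omega>. (sqrt N * (member N j n \<omega> $ i - copy j n \<omega> $ i)) ^ (2 * 1)) \<le> c)" ..
  from choice[OF this] obtain c where c: "\<And>i. c i \<ge> 0"
    "\<And>i N n. n < N \<Longrightarrow> expectation (\<lambda>\<omega>. (sqrt N * (member N j n \<omega> $ i - copy j n \<omega> $ i)) ^ (2 * 1)) \<le> c i"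
    by blast
  have int: "integrable M (\<lambda>\<omega>. (member N j n \<omega> $ i - copy j n \<omega> $ i)\<^sup>2)"
    and le: "expectation (\<lambda>\<omega>. (member N j n \<omega> $ i - copy j n \<omega> $ i)\<^sup>2) \<le> c i / N" if "n < N" for n N i
  proof -
    have e: "(sqrt N * x) ^ (2 * 1) = real N * x\<^sup>2" for x
      by (simp only: mult_1_right power_mult_distrib) simp
    have N: "real N > 0" using that by simp
    show "integrable M (\<lambda>\<omega>. (member N j n \<omega> $ i - copy j n \<omega> $ i)\<^sup>2)"
      using bounded_moments_integrable[OF bounded[of i] that, of 1] N unfolding e by simp
    show "expectation (\<lambda>\<omega>. (member N j n \<omega> $ i - copy j n \<omega> $ i)\<^sup>2) \<le> c i / N"
      using c(2)[OF that, of i] N unfolding e by (simp add: pos_le_divide_eq mult.commute)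
  qed
  show ?thesis
  proof
    show "(\<Sum>i\<in>UNIV. c i) \<ge> 0" by (intro sum_nonneg c)
    fix N :: nat and f :: "real^'d \<Rightarrow> real" assume N: "N > 0" and f: "bounded_lipschitz_norm f \<le> 1"
    note [measurable] = bounded_lipschitz_norm_le_1_measurable[OF f]
    let ?Q = "\<lambda>\<omega>. (\<Sum>n<N. \<Sum>i\<in>UNIV. (member N j n \<omega> $ i - copy j n \<omega> $ i)\<^sup>2) / N"
    have Q: "((\<Sum>n<N. f (member N j n \<omega>)) / N - (\<Sum>n<N. f (copy j n \<omega>)) / N)\<^sup>2 \<le> ?Q \<omega>" for \<omega>
    proof -
      have "((\<Sum>n<N. f (member N j n \<omega>)) / N - (\<Sum>n<N. f (copy j n \<omega>)) / N)\<^sup>2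
          = ((\<Sum>n<N. f (member N j n \<omega>) - f (copy j n \<omega>)) / N) ^ (2 * 1)"
        by (simp add: sum_subtractf diff_divide_distrib)
      also have "\<dots> \<le> (\<Sum>n<N. (f (member N j n \<omega>) - f (copy j n \<omega>)) ^ (2 * 1)) / N"
        by (rule even_power_average_le[OF N])
      also have "\<dots> \<le> ?Q \<omega>"
      proof (intro divide_right_mono sum_mono)
        fix n
        have "(f (member N j n \<omega>) - f (copy j n \<omega>)) ^ (2 * 1) \<le> (norm (member N j n \<omega> - copy j n \<omega>)) ^ (2 * 1)"
          using bounded_lipschitz_norm_le_1_lipschitz[OF f] by (intro even_power_mono) simp
        also have "\<dots> = (\<Sum>i\<in>UNIV. (member N j n \<omega> $ i - copy j n \<omega> $ i)\<^sup>2)"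
          unfolding mult_1_right power2_norm_eq_inner by (simp add: inner_vec_def power2_eq_square)
        finally show "(f (member N j n \<omega>) - f (copy j n \<omega>)) ^ (2 * 1)
            \<le> (\<Sum>i\<in>UNIV. (member N j n \<omega> $ i - copy j n \<omega> $ i)\<^sup>2)" .
      qed simp
      finally show ?thesis .
    qed
    have intQ: "integrable M ?Q" by (intro integrable_divide Bochner_Integration.integrable_sum int) auto
    have "expectation (\<lambda>\<omega>. ((\<Sum>n<N. f (member N j n \<omega>)) / N - (\<Sum>n<N. f (copy j n \<omega>)) / N)\<^sup>2) \<le> expectation ?Q"
      by (intro integral_mono_AE' intQ AE_I2 Q order_trans[OF zero_le_power2 Q])
    also have "\<dots> = (\<Sum>n<N. \<Sum>i\<in>UNIV. expectation (\<lambda>\<omega>. (member N j n \<omega> $ i - copy j n \<omega> $ i)\<^sup>2)) / N"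
      using int by (simp add: Bochner_Integration.integral_sum Bochner_Integration.integrable_sum)
    also have "\<dots> \<le> (\<Sum>n<N. \<Sum>i\<in>UNIV. c i / N) / N"
      by (intro divide_right_mono sum_mono le) auto
    also have "\<dots> = (\<Sum>i\<in>UNIV. c i) / N"
      using N by (simp add: sum_divide_distrib)
    finally show "expectation (\<lambda>\<omega>. ((\<Sum>n<N. f (member N j n \<omega>)) / N - (\<Sum>n<N. f (copy j n \<omega>)) / N)\<^sup>2)
        \<le> (\<Sum>i\<in>UNIV. c i) / real N" .
  qed
qed

text \<open>The centered values are bounded by 2 and mutually orthogonal, so the mean square is at
  most 4N / N^2. The variance estimate replaces \<open>root_N_close_conditional_mean\<close> here
  because its constant is explicit and the same for all test functions.\<close>

lemma copy_mean_square_close: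
  assumes N: "N > 0" and f: "bounded_lipschitz_norm f \<le> 1"
  shows "expectation (\<lambda>\<omega>. ((\<Sum>n<N. f (copy j n \<omega>)) / N
    - expectation (\<lambda>\<omega>'. f (mean_field MeanField (observed \<omega>) j \<omega>')))\<^sup>2) \<le> 4 / real N"
proof -
  note f_meas [measurable] = bounded_lipschitz_norm_le_1_measurable[OF f]
  let ?c = "\<lambda>\<omega>. expectation (\<lambda>\<omega>'. f (mean_field MeanField (observed \<omega>) j \<omega>'))"
  have \<phi>: "(\<lambda>(\<omega>', \<omega>). f (mean_field (Member n) (observed \<omega>') j \<omega>))
      \<in> borel_measurable (sources_algebra (own_sources Signal) \<Otimes>\<^sub>M sources_algebra (own_sources (Member n)))" for n
  proof -
    have "(\<lambda>(\<omega>', \<omega>). mean_field (Member n) (observed \<omega>') j \<omega>)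
        \<in> borel_measurable (sources_algebra (own_sources Signal) \<Otimes>\<^sub>M sources_algebra (own_sources (Member n)))"
      by (intro borel_measurable_mean_field observed_measurable[OF lessI]) auto
    from measurable_compose[OF this f_meas] show ?thesis by (simp add: case_prod_beta')
  qed
  have mean: "expectation (\<lambda>\<omega>. f (mean_field (Member n) (observed \<omega>') j \<omega>)) = ?c \<omega>'" for n \<omega>'
    by (rule expectation_mean_field_eq[OF f_meas])
  let ?X = "\<lambda>n \<omega>. f (copy j n \<omega>) - ?c \<omega>"
  have "(\<lambda>\<omega>'. expectation (\<lambda>\<omega>. f (mean_field (Member 0) (observed \<omega>') j \<omega>))) \<in> borel_measurable M"
    using measurable_sources_algebraD[OF conditional_mean_measurable[OF \<phi>[of 0]]] .
  then have [measurable]: "?c \<in> borel_measurable M" by (simp only: mean)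
  have "expectation (\<lambda>\<omega>. (\<Sum>n<N. ?X n \<omega>)\<^sup>2) \<le> real N * 2\<^sup>2"
  proof (rule second_moment_orthogonal_sum)
    show "random_variable borel (?X n)" for n by measurable
    show "\<bar>?X n \<omega>\<bar> \<le> 2" for n \<omega>
      using bounded_lipschitz_norm_le_1_bound[OF f, of "copy j n \<omega>"]
        prob_integral_bound[OF prob_space_axioms, of "\<lambda>\<omega>'. f (mean_field MeanField (observed \<omega>) j \<omega>')"]
        bounded_lipschitz_norm_le_1_bound[OF f] by fastforce
    show "expectation (\<lambda>\<omega>. (\<Sum>i<n. ?X i \<omega>) * ?X n \<omega>) = 0" for n
      using centered_partial_sums_orthogonal[OF \<phi> mean, of n 1] by simp
  qed
  moreover have "((\<Sum>n<N. f (copy j n \<omega>)) / N - ?c \<omega>)\<^sup>2 = (\<Sum>n<N. ?X n \<omega>)\<^sup>2 / (real N)\<^sup>2" for \<omega>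
  proof -
    have "(\<Sum>n<N. f (copy j n \<omega>)) / N - ?c \<omega> = (\<Sum>n<N. ?X n \<omega>) / N"
      using N by (simp add: sum_subtractf field_simps)
    then show ?thesis by (simp only: power_divide)
  qed
  ultimately show ?thesis using N by (simp add: field_simps power2_eq_square)
qed

text \<open>The triangle inequality through the empirical measure of the copies, in the squared form
  (a - c)^2 \<le> 2 (a - b)^2 + 2 (b - c)^2. The constant \<open>K\<close> is fixed before
  \<open>N\<close> and \<open>f\<close>, so it passes to the supremum.\<close>

lemma random_measure_dist_enkf_le:
  obtains K where "\<And>N f. N > 0 \<Longrightarrow> bounded_lipschitz_norm f \<le> 1 \<Longrightarrow>
    sqrt (\<integral>\<omega>. \<bar>(\<integral>x. f x \<partial>empirical_measure N (enkf H \<Gamma> \<Phi> init drive gauss N j \<omega>))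
      - (\<integral>x. f x \<partial>mfenkf_law M H \<Gamma> \<Phi> init drive gauss (observed \<omega>) j)\<bar>\<^sup>2 \<partial>M)
    \<le> K * real N powr (- 1 / 2)"
proof -
  obtain D where D: "D \<ge> 0" "\<And>N f. N > 0 \<Longrightarrow> bounded_lipschitz_norm f \<le> 1 \<Longrightarrow>
    expectation (\<lambda>\<omega>. ((\<Sum>n<N. f (member N j n \<omega>)) / N - (\<Sum>n<N. f (copy j n \<omega>)) / N)\<^sup>2) \<le> D / real N"
    using member_mean_square_close by blast
  show ?thesis
  proof
    fix N :: nat and f :: "real^'d \<Rightarrow> real" assume N: "N > 0" and f: "bounded_lipschitz_norm f \<le> 1"
    note f_meas [measurable] = bounded_lipschitz_norm_le_1_measurable[OF f]
    let ?a = "\<lambda>\<omega>. (\<Sum>n<N. f (member N j n \<omega>)) / N"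
    let ?b = "\<lambda>\<omega>. (\<Sum>n<N. f (copy j n \<omega>)) / N"
    let ?c = "\<lambda>\<omega>. expectation (\<lambda>\<omega>'. f (mean_field MeanField (observed \<omega>) j \<omega>'))"
    have avg: "\<bar>(\<Sum>n<N. f (v n)) / N\<bar> \<le> 1" for v :: "nat \<Rightarrow> real^'d"
    proof -
      have "\<bar>\<Sum>n<N. f (v n)\<bar> \<le> (\<Sum>n<N. 1)"
        using bounded_lipschitz_norm_le_1_bound[OF f] by (intro order_trans[OF sum_abs] sum_mono)
      then show ?thesis using N by (simp add: field_simps)
    qed
    have c1: "\<bar>?c \<omega>\<bar> \<le> 1" for \<omega>
      by (rule prob_integral_bound[OF prob_space_axioms bounded_lipschitz_norm_le_1_bound[OF f]])
    have "(\<lambda>(\<omega>', \<omega>). mean_field MeanField (observed \<omega>') j \<omega>) \<in> borel_measurable (M \<Otimes>\<^sub>M M)"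
      by (rule measurable_pair_sources_algebraD[OF borel_measurable_mean_field[OF _ subset_UNIV[of _]]]) measurable
    from measurable_compose[OF this f_meas]
    have [measurable]: "?c \<in> borel_measurable M"
      by (intro borel_measurable_lebesgue_integral) (simp add: case_prod_beta')
    have sq: "x\<^sup>2 \<le> 4" if "\<bar>x\<bar> \<le> 2" for x :: real
      using power_mono[OF that, of 2] by simp
    have int: "integrable M (\<lambda>\<omega>. (?a \<omega> - ?b \<omega>)\<^sup>2)" "integrable M (\<lambda>\<omega>. (?b \<omega> - ?c \<omega>)\<^sup>2)"
      by (rule integrable_const_bound[where B=4],
          intro AE_I2, simp, rule sq, use avg[of "\<lambda>n. member N j n _"] avg[of "\<lambda>n. copy j n _"] in \<open>smt (verit)\<close>, measurable)
        (rule integrable_const_bound[where B=4],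
          intro AE_I2, simp, rule sq, use avg[of "\<lambda>n. copy j n _"] c1 in \<open>smt (verit)\<close>, measurable)
    have emp: "(\<integral>x. f x \<partial>empirical_measure N (enkf H \<Gamma> \<Phi> init drive gauss N j \<omega>)) = ?a \<omega>" for \<omega>
      by (rule integral_empirical_measure[OF f_meas])
    have law: "(\<integral>x. f x \<partial>mfenkf_law M H \<Gamma> \<Phi> init drive gauss (observed \<omega>) j) = ?c \<omega>" for \<omega>
      unfolding mfenkf_law_def mfenkf_eq_mean_field by (rule integral_distr) measurable
    have "(\<integral>\<omega>. \<bar>?a \<omega> - ?c \<omega>\<bar>\<^sup>2 \<partial>M) \<le> expectation (\<lambda>\<omega>. 2 * (?a \<omega> - ?b \<omega>)\<^sup>2 + 2 * (?b \<omega> - ?c \<omega>)\<^sup>2)"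
    proof (rule integral_mono_AE')
      have "\<bar>a - c\<bar>\<^sup>2 \<le> 2 * (a - b)\<^sup>2 + 2 * (b - c)\<^sup>2" for a b c :: real
        using zero_le_power2[of "(a - b) - (b - c)"] by (simp add: power2_eq_square algebra_simps)
      then show "AE \<omega> in M. \<bar>?a \<omega> - ?c \<omega>\<bar>\<^sup>2 \<le> 2 * (?a \<omega> - ?b \<omega>)\<^sup>2 + 2 * (?b \<omega> - ?c \<omega>)\<^sup>2"
        by (intro AE_I2)
    qed (use int in auto)
    also have "\<dots> = 2 * expectation (\<lambda>\<omega>. (?a \<omega> - ?b \<omega>)\<^sup>2) + 2 * expectation (\<lambda>\<omega>. (?b \<omega> - ?c \<omega>)\<^sup>2)"
      using int by simp
    also have "\<dots> \<le> 2 * (D / N) + 2 * (4 / N)"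
      by (intro add_mono mult_left_mono D(2) copy_mean_square_close N f) auto
    also have "\<dots> = (2 * D + 8) / N" by (simp add: add_divide_distrib)
    finally have "sqrt (\<integral>\<omega>. \<bar>?a \<omega> - ?c \<omega>\<bar>\<^sup>2 \<partial>M) \<le> sqrt ((2 * D + 8) / N)" by (rule real_sqrt_le_mono)
    also have "\<dots> = sqrt (2 * D + 8) * real N powr (- 1 / 2)"
    proof -
      have powr: "real N powr (- 1 / 2) = inverse (sqrt N)"
        using powr_minus[of "real N" "1 / 2"] by (simp add: powr_half_sqrt)
      show ?thesis unfolding powr real_sqrt_divide by (rule divide_inverse)
    qed
    finally show "sqrt (\<integral>\<omega>. \<bar>(\<integral>x. f x \<partial>empirical_measure N (enkf H \<Gamma> \<Phi> init drive gauss N j \<omega>))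
        - (\<integral>x. f x \<partial>mfenkf_law M H \<Gamma> \<Phi> init drive gauss (observed \<omega>) j)\<bar>\<^sup>2 \<partial>M)
      \<le> sqrt (2 * D + 8) * real N powr (- 1 / 2)"
      unfolding emp law .
  qed
qed

end

text \<open>A real-valued supremum is meaningful only over a nonempty set; the zero function
  witnesses that there are test functions.\<close>

lemma bounded_lipschitz_norm_zero: "bounded_lipschitz_norm (\<lambda>_. 0) \<le> 1"
  unfolding bounded_lipschitz_norm_def by (simp add: SUP_constant case_prod_beta')

theorem theorem5p2:
  fixes \<K> :: "real^'d \<Rightarrow> (real^'d) measure"
    and \<nu> :: "'x measure"
    and \<Phi> :: "real^'d \<Rightarrow> 'x \<Rightarrow> real^'d"
    and \<rho>\<^sub>0 :: "(real^'d) measure"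
    and H :: "real^'d^'m"
    and \<Gamma> :: "real^'m^'m"
    and M :: "'w measure"
    and init :: "system \<Rightarrow> 'w \<Rightarrow> real^'d"
    and drive :: "system \<Rightarrow> nat \<Rightarrow> 'w \<Rightarrow> 'x"
    and gauss :: "system \<Rightarrow> nat \<Rightarrow> 'w \<Rightarrow> real^'m"
    and j :: nat
  assumes "pos_def_matrix \<Gamma>"
    and "markov_kernel \<K>"
    and "realizes_kernel \<K> \<nu> \<Phi>"
    and "has_lebesgue_density \<rho>\<^sub>0"
    and "\<And>a. has_lebesgue_density (\<K> a)"
    and "independent_sources M \<rho>\<^sub>0 \<nu> \<Gamma> init drive gauss"
    and "lipschitz_same_noise \<nu> \<Phi>"
    and "moment_growth \<K>"
    and "\<And>p. p \<ge> 2 \<Longrightarrow> finite_moment p \<rho>\<^sub>0"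
  shows "(\<lambda>N. random_measure_dist M
            (\<lambda>\<omega>. empirical_measure N (enkf H \<Gamma> \<Phi> init drive gauss N j \<omega>))
            (\<lambda>\<omega>. mfenkf_law M H \<Gamma> \<Phi> init drive gauss
                     (observations H \<Phi> init drive gauss \<omega>) j))
         \<in> O(\<lambda>N. real N powr (-1/2))"
proof -
  interpret ensemble_kalman \<K> \<nu> \<Phi> \<rho>\<^sub>0 H \<Gamma> M init drive gauss
    using assms by unfold_locales auto
  let ?g = "\<lambda>N f. sqrt (\<integral>\<omega>. \<bar>(\<integral>x. f x \<partial>empirical_measure N (enkf H \<Gamma> \<Phi> init drive gauss N j \<omega>))
      - (\<integral>x. f x \<partial>mfenkf_law M H \<Gamma> \<Phi> init drive gauss (observed \<omega>) j)\<bar>\<^sup>2 \<partial>M)"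
  obtain K where K: "\<And>N f. N > 0 \<Longrightarrow> bounded_lipschitz_norm f \<le> 1 \<Longrightarrow> ?g N f \<le> K * real N powr (- 1 / 2)"
    using random_measure_dist_enkf_le by blast
  show ?thesis
  proof (rule bigoI[where c = K])
    show "\<forall>\<^sub>F N in at_top. norm (random_measure_dist M
            (\<lambda>\<omega>. empirical_measure N (enkf H \<Gamma> \<Phi> init drive gauss N j \<omega>))
            (\<lambda>\<omega>. mfenkf_law M H \<Gamma> \<Phi> init drive gauss (observed \<omega>) j))
          \<le> K * norm (real N powr (-1/2))"
      using eventually_gt_at_top[of 0]
    proof eventually_elim
      case (elim N)
      let ?F = "{f :: real^'d \<Rightarrow> real. bounded_lipschitz_norm f \<le> 1}"
      have "bdd_above (?g N ` ?F)" using K[OF elim] by (intro bdd_aboveI2) auto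
      \<comment> \<open>The zero function contributes the value 0, so the supremum is nonnegative
        and the norm in the Landau bound can be removed.\<close>
      then have "?g N (\<lambda>_. 0) \<le> (SUP f\<in>?F. ?g N f)"
        using bounded_lipschitz_norm_zero by (intro cSUP_upper) auto
      moreover have "(SUP f\<in>?F. ?g N f) \<le> K * real N powr (- 1 / 2)"
        using K[OF elim] bounded_lipschitz_norm_zero by (intro cSUP_least) auto
      ultimately show ?case by (simp add: random_measure_dist_def)
    qed
  qed
qed

end
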